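(* Let $n\ge2$. For all $c_1,c_2\in(0,1)$ there is a constant $s>0$ depending only on $n,c_1,c_2$ such that the following holds. Let $G\subsetneq\mathbb{R}^n$ be a domain and $E\subset G$ a compact set such that $E$ and $\partial G$ are uniformly perfect, with $E\in\mathrm{UP}_n(c_1)$ and $\partial G\in\mathrm{UP}_n(c_2)$. Then $$\operatorname{cap}(G,E)\ \ge\ s\,\log\left(1+\frac{d(E)}{d(E,\partial G)}\right).$$
   Context: For a condenser $(A,C)$, i.e. $A\subset\mathbb{R}^n$ open and non-empty and $C\subset A$ compact and non-empty, the (conformal) capacity is $\operatorname{cap}(A,C)=\inf_u\int_{\mathbb{R}^n}|\nabla u|^n\,dm$, the infimum over all non-negative $\mathrm{ACL}^n$ functions $u$ with compact support in $A$ and $u\ge 1$ on $C$. $d(E)$ is the Euclidean diameter and $d(E,\partial G)$ the Euclidean distance from $E$ to the finite boundary points of $G$. The boundary $\partial G$ is taken in $\overline{\mathbb{R}}^n=\mathbb{R}^n\cup\{\infty\}$ (so $\infty\in\partial G$ if $G$ is unbounded). For $c\in(0,1)$, $\mathrm{UP}_n(c)$ is the class of compact sets $F\subset\overline{\mathbb{R}}^n$ with at least two points such that $\{x\in F: cr<|x-a|<r\}\ne\emptyset$ for all $a\in F\setminus\{\infty\}$ and all $0<r<d(F)/2$, where $d(F)=+\infty$ if $\infty\in F$ (the point $\infty$ itself is not counted as satisfying $cr<|x-a|<r$). A set is uniformly perfect if it belongs to $\mathrm{UP}_n(c)$ for some $c\in(0,1)$, and $c$ is then a uniform perfectness parameter.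 *)

theory Defs
  imports "HOL-Analysis.Analysis"
begin

section \<open>ACL functions and conformal capacity\<close>

text \<open>
  The finite families of non-overlapping intervals are those \<open>\<D>\<close> with
  \<open>\<D> division_of \<Union>\<D>\<close>.
\<close>

definition absolutely_continuous_on :: "real set \<Rightarrow> (real \<Rightarrow> real) \<Rightarrow> bool" where
  "absolutely_continuous_on S f \<longleftrightarrow>
     (\<forall>\<epsilon>>0. \<exists>\<delta>>0. \<forall>\<D>. \<D> division_of \<Union>\<D> \<and> \<Union>\<D> \<subseteq> S \<and> (\<Sum>K\<in>\<D>. Sup K - Inf K) < \<delta>
        \<longrightarrow> (\<Sum>K\<in>\<D>. \<bar>f (Sup K) - f (Inf K)\<bar>) < \<epsilon>)"

text \<open>
  Absolute continuity on almost every segment of each closed box parallel to a coordinate axis.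
  The segments in direction \<open>i\<close> are parametrised by their projection \<open>z\<close> to the coordinate
  hyperplane orthogonal to \<open>i\<close>, and ``almost every'' refers to the \<open>(n-1)\<close>-dimensional Lebesgue
  measure of that hyperplane. As usual, continuity is part of the definition.
\<close>

definition ACL :: "('a::euclidean_space \<Rightarrow> real) \<Rightarrow> bool" where
  "ACL u \<longleftrightarrow> continuous_on UNIV u \<and>
     (\<forall>a b. \<forall>i\<in>Basis. AE z in (\<Pi>\<^sub>M j\<in>Basis - {i}. lborel).
        (\<forall>j\<in>Basis - {i}. z j \<in> {a \<bullet> j..b \<bullet> j}) \<longrightarrow>
        absolutely_continuous_on {a \<bullet> i..b \<bullet> i}
          (\<lambda>t. u ((\<Sum>j\<in>Basis - {i}. z j *\<^sub>R j) + t *\<^sub>R i)))"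

text \<open>
  For an ACL function the partial derivatives exist almost everywhere; where one does not exist,
  \<open>deriv\<close> returns an unspecified value, which does not affect any of the integrals below.
\<close>

definition partial_deriv :: "'a::euclidean_space \<Rightarrow> ('a \<Rightarrow> real) \<Rightarrow> 'a \<Rightarrow> real" where
  "partial_deriv i u x = deriv (\<lambda>t. u (x + t *\<^sub>R i)) 0"

definition grad :: "('a::euclidean_space \<Rightarrow> real) \<Rightarrow> 'a \<Rightarrow> 'a" where
  "grad u x = (\<Sum>i\<in>Basis. partial_deriv i u x *\<^sub>R i)"

text \<open>The class \<open>ACL\<^sup>n\<close>: the partial derivatives of \<open>u\<close> are locally in \<open>L\<^sup>n\<close>, \<open>n\<close> being the dimension.\<close>

definition ACLn :: "('a::euclidean_space \<Rightarrow> real) \<Rightarrow> bool" where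
  "ACLn u \<longleftrightarrow> ACL u \<and>
     (\<forall>i\<in>Basis. partial_deriv i u \<in> borel_measurable lebesgue \<and>
        (\<forall>K. compact K \<longrightarrow> set_integrable lebesgue K (\<lambda>x. \<bar>partial_deriv i u x\<bar> ^ DIM('a))))"

definition admissible :: "'a::euclidean_space set \<Rightarrow> 'a set \<Rightarrow> ('a \<Rightarrow> real) set" where
  "admissible A C = {u. ACLn u \<and> (\<forall>x. u x \<ge> 0) \<and>
     compact (closure {x. u x \<noteq> 0}) \<and> closure {x. u x \<noteq> 0} \<subseteq> A \<and> (\<forall>x\<in>C. u x \<ge> 1)}"

definition cap :: "'a::euclidean_space set \<Rightarrow> 'a set \<Rightarrow> ennreal" where
  "cap A C = (INF u\<in>admissible A C. \<integral>\<^sup>+ x. ennreal (norm (grad u x) ^ DIM('a)) \<partial>lebesgue)"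


section \<open>Uniformly perfect sets\<close>

text \<open>
  The one-point compactification of the Euclidean space is carried by the type \<open>'a option\<close>,
  with \<open>None\<close> in the role of the point at infinity.
\<close>

definition ext_space :: "'a::euclidean_space option topology" where
  "ext_space = Alexandroff_compactification euclidean"

definition ext_boundary :: "'a::euclidean_space set \<Rightarrow> 'a option set" where
  "ext_boundary G = ext_space frontier_of (Some ` G)"

definition finite_points :: "'a option set \<Rightarrow> 'a set" where
  "finite_points F = {x. Some x \<in> F}"

definition ext_diameter :: "'a::euclidean_space option set \<Rightarrow> ereal" where
  "ext_diameter F = (if None \<in> F then \<infinity> else ereal (diameter (finite_points F)))"

definition UP :: "real \<Rightarrow> 'a::euclidean_space option set set" where
  "UP c = {F. compactin ext_space F \<and> (\<exists>x\<in>F. \<exists>y\<in>F. x \<noteq> y) \<and>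
     (\<forall>a\<in>finite_points F. \<forall>r>0. ereal r < ext_diameter F / 2 \<longrightarrow>
        {x \<in> finite_points F. c * r < dist x a \<and> dist x a < r} \<noteq> {})}"

end

theory Submission
  imports Defs
begin

text \<open>
  Let \<open>n\<close> be the dimension, \<open>u\<close> an admissible function and \<open>F\<close> the set of finite boundary points
  of \<open>G\<close>; so \<open>u \<ge> 1\<close> on \<open>E\<close> and \<open>u = 0\<close> on \<open>F\<close>. The energy, the integral of
  \<open>\<bar>grad u\<bar>\<close> to the power \<open>n\<close>, is invariant under scaling, and so is uniform perfectness. Therefore
  every scale at which both sets are visible from one point should contribute at least a fixed
  amount of energy. Take \<open>a \<in> E\<close> and \<open>b \<in> F\<close> with \<open>dist a b = \<delta> = d(E, F)\<close> and
  let \<open>D = d(E)\<close>. Both sets meet the annuli around \<open>a\<close> of every radius between (a multiple of) \<open>\<delta>\<close>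
  and \<open>D / 2\<close>; there are about \<open>log (D / \<delta>)\<close> disjoint annuli of this kind, and the bound follows
  by summation. The proof has three ingredients.

  \<^item> A Poincare inequality (\<open>avg_subbox\<close>): the averages of \<open>u\<close> over a box and a comparable
  box inside it differ by at most a constant times the \<open>n\<close>-th root of the energy in the larger box.
  One coordinate is changed at a time, so only the increments of \<open>u\<close> along lines parallel to an axis
  matter. On almost all of these lines \<open>u\<close> is absolutely continuous, and its increments are bounded by
  the integral of the partial derivative (\<open>absolutely_continuous_increment_le\<close>). This rests on
  the almost everywhere differentiability of functions of bounded variation, which is derived from
  Vitali's covering theorem.

  \<^item> On a uniformly perfect set the values of \<open>u\<close> control its means
  (\<open>mean_near_value_on_perfect_set\<close>). Each cube centred in the set contains two
  disjoint cubes of comparable size centred in the set, and one of them carries at most half of the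
  energy. Always passing to this one, the energy decays geometrically, so by the Poincare
  inequality the means change by the terms of a geometric series. In the limit
  the mean over the first cube differs from a value of \<open>u\<close> on the set by at most a constant
  times the \<open>n\<close>-th root of the energy.

  \<^item> An annulus is connected by few boxes as soon as \<open>n \<ge> 2\<close>, so the means of \<open>u\<close> over two small
  cubes in it can be compared (\<open>means_in_annulus\<close>). If one cube is centred in \<open>E\<close> and the other one
  in \<open>F\<close>, then the means are near \<open>1\<close> or above, and near \<open>0\<close>, respectively, unless the energy in
  the annulus is large (\<open>energy_at_scale\<close>).

  If \<open>D / \<delta>\<close> is bounded, there may be no annulus to use. Then cubes of size \<open>D\<close> around \<open>a\<close> and \<open>b\<close>
  are doubled until they are comparable with \<open>\<delta>\<close> (\<open>energy_far\<close>). The number of doublings is of order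
  \<open>log (\<delta> / D)\<close>, and a power of its reciprocal still exceeds a multiple of \<open>D / \<delta>\<close>, hence of
  \<open>ln (1 + D / \<delta>)\<close>.
\<close>


section \<open>Differentiability of functions of bounded variation\<close>

text \<open>
  Tagging each interval with its left end point turns this into the telescoping sum over a tagged
  division.
\<close>

lemma sum_increments_division:
  fixes f :: "real \<Rightarrow> real"
  assumes q: "q division_of {a..b}" and ab: "a \<le> b"
  shows "(\<Sum>K\<in>q. f (Sup K) - f (Inf K)) = f b - f a"
proof -
  define p where "p = (\<lambda>K. (Inf K, K)) ` q"
  have IK: "Inf K \<in> K" if KQ: "K \<in> q" for K
  proof -
    obtain c d where K: "K = {c..d}" using division_ofD(4)[OF q KQ] by auto
    moreover have "c \<le> d" using division_ofD(3)[OF q KQ] K by auto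
    ultimately show ?thesis by simp
  qed
  have pt: "p tagged_division_of {a..b}"
    unfolding p_def
  proof (rule tagged_division_ofI)
    show "finite ((\<lambda>K. (Inf K, K)) ` q)" using division_ofD(1)[OF q] by simp
    show "interior K1 \<inter> interior K2 = {}"
      if "(x1, K1) \<in> (\<lambda>K. (Inf K, K)) ` q" "(x2, K2) \<in> (\<lambda>K. (Inf K, K)) ` q" "(x1, K1) \<noteq> (x2, K2)"
      for x1 K1 x2 K2
      using that division_ofD(5)[OF q] by auto
    show "\<Union>{K. \<exists>x. (x, K) \<in> (\<lambda>K. (Inf K, K)) ` q} = {a..b}"
    proof -
      have "{K. \<exists>x. (x, K) \<in> (\<lambda>K. (Inf K, K)) ` q} = q" by auto
      then show ?thesis using division_ofD(6)[OF q] by simp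
    qed
  qed (use IK division_ofD(1,2,4)[OF q] in \<open>fastforce+\<close>)
  have "(\<Sum>K\<in>q. f (Sup K) - f (Inf K)) = (\<Sum>(x,K)\<in>p. f (Sup K) - f (Inf K))"
    unfolding p_def by (subst sum.reindex) (auto simp: inj_on_def)
  also have "\<dots> = f b - f a"
    by (rule additive_tagged_division_1[OF ab pt])
  finally show ?thesis .
qed

text \<open>
  The gain in variation behind Lebesgue's theorem: if \<open>f\<close> moves against its total increment on the
  intervals of \<open>p\<close>, the remaining part of \<open>{a..b}\<close> has to make up for it, and every such movement is
  counted twice.
\<close>

lemma refined_variation:
  fixes f :: "real \<Rightarrow> real"
  assumes p: "p division_of \<Union>p" "\<Union>p \<subseteq> {a..b}" and ab: "a \<le> b"
    and up: "f b - f a \<ge> 0 \<Longrightarrow> \<forall>K\<in>p. f (Sup K) - f (Inf K) \<le> - (e * (Sup K - Inf K))"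
    and down: "f b - f a < 0 \<Longrightarrow> \<forall>K\<in>p. f (Sup K) - f (Inf K) \<ge> e * (Sup K - Inf K)"
  shows "\<exists>q. q division_of {a..b} \<and>
    \<bar>f b - f a\<bar> + 2 * e * (\<Sum>K\<in>p. Sup K - Inf K) \<le> (\<Sum>K\<in>q. \<bar>f (Sup K) - f (Inf K)\<bar>)"
proof -
  obtain q where pq: "p \<subseteq> q" and q: "q division_of cbox a b"
    using partial_division_extend_interval[OF p(1)] p(2) by (metis cbox_interval)
  have fq: "finite q" using q by auto
  have tel: "(\<Sum>K\<in>q. f (Sup K) - f (Inf K)) = f b - f a"
    using q ab by (intro sum_increments_division) auto
  have spl: "(\<Sum>K\<in>q. h K) = (\<Sum>K\<in>p. h K) + (\<Sum>K\<in>q-p. h K)" for h :: "real set \<Rightarrow> real"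
    using sum.subset_diff[OF pq fq] by (simp add: add.commute)
  have tri: "\<bar>\<Sum>K\<in>q-p. f (Sup K) - f (Inf K)\<bar> \<le> (\<Sum>K\<in>q-p. \<bar>f (Sup K) - f (Inf K)\<bar>)"
    by (rule sum_abs)
  have tri2: "\<bar>\<Sum>K\<in>p. f (Sup K) - f (Inf K)\<bar> \<le> (\<Sum>K\<in>p. \<bar>f (Sup K) - f (Inf K)\<bar>)"
    by (rule sum_abs)
  have "\<bar>f b - f a\<bar> + 2 * e * (\<Sum>K\<in>p. Sup K - Inf K) \<le> (\<Sum>K\<in>q. \<bar>f (Sup K) - f (Inf K)\<bar>)"
  proof (cases "f b - f a \<ge> 0")
    case True
    have "(\<Sum>K\<in>p. f (Sup K) - f (Inf K)) \<le> (\<Sum>K\<in>p. - (e * (Sup K - Inf K)))"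
      using up[OF True] by (intro sum_mono) auto
    also have "\<dots> = - (e * (\<Sum>K\<in>p. Sup K - Inf K))"
      by (simp add: sum_distrib_left sum_negf)
    finally show ?thesis
      using tel tri tri2 True spl[of "\<lambda>K. f (Sup K) - f (Inf K)"]
        spl[of "\<lambda>K. \<bar>f (Sup K) - f (Inf K)\<bar>"] by linarith
  next
    case False
    have "(\<Sum>K\<in>p. f (Sup K) - f (Inf K)) \<ge> (\<Sum>K\<in>p. e * (Sup K - Inf K))"
      using down False by (intro sum_mono) auto
    then have "(\<Sum>K\<in>p. f (Sup K) - f (Inf K)) \<ge> e * (\<Sum>K\<in>p. Sup K - Inf K)"
      by (simp add: sum_distrib_left)
    then show ?thesis
      using tel tri tri2 False spl[of "\<lambda>K. f (Sup K) - f (Inf K)"]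
        spl[of "\<lambda>K. \<bar>f (Sup K) - f (Inf K)\<bar>"] by linarith
  qed
  then show ?thesis using q by auto
qed

lemma division_of_cells:
  fixes D :: "'a::euclidean_space set set"
  assumes D: "D division_of S" and q: "\<And>I. I \<in> D \<Longrightarrow> q I division_of I"
  shows "(\<Union>I\<in>D. q I) division_of S"
proof (rule division_ofI)
  show "finite (\<Union>I\<in>D. q I)" using D q by (auto dest: division_ofD(1))
  show "\<Union> (\<Union> (q ` D)) = S" using division_ofD(6)[OF D] division_ofD(6)[OF q] by blast
next
  fix K assume "K \<in> \<Union>(q ` D)"
  then obtain I where I: "I \<in> D" "K \<in> q I" by auto
  show "K \<subseteq> S" using division_ofD(2)[OF q[OF I(1)] I(2)] division_ofD(2)[OF D I(1)] by blast
  show "K \<noteq> {}" "\<exists>a b. K = cbox a b" using division_ofD(3,4)[OF q[OF I(1)] I(2)] by auto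
next
  fix K K' assume K: "K \<in> \<Union>(q ` D)" "K' \<in> \<Union>(q ` D)" "K \<noteq> K'"
  then obtain I I' where I: "I \<in> D" "K \<in> q I" "I' \<in> D" "K' \<in> q I'" by auto
  show "interior K \<inter> interior K' = {}"
  proof (cases "I = I'")
    case True then show ?thesis using division_ofD(5)[OF q[OF I(1)] I(2)] I K by auto
  next
    case False
    then have "interior I \<inter> interior I' = {}" using division_ofD(5)[OF D] I by auto
    moreover have "interior K \<subseteq> interior I" "interior K' \<subseteq> interior I'"
      using I division_ofD(2)[OF q] by (auto intro!: interior_mono)
    ultimately show ?thesis by blast
  qed
qed

text \<open>
  Divisions may contain degenerate intervals, and such an interval may belong to the divisions of
  two neighbouring cells. The increment of \<open>f\<close> over it is zero, so the sums agree all the same.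
\<close>

lemma sum_cells:
  fixes D :: "real set set" and f :: "real \<Rightarrow> real"
  assumes D: "D division_of S" and q: "\<And>I. I \<in> D \<Longrightarrow> q I division_of I"
  shows "(\<Sum>K\<in>(\<Union>I\<in>D. q I). \<bar>f (Sup K) - f (Inf K)\<bar>) = (\<Sum>I\<in>D. \<Sum>K\<in>q I. \<bar>f (Sup K) - f (Inf K)\<bar>)"
proof -
  let ?g = "\<lambda>K. \<bar>f (Sup K) - f (Inf K)\<bar>"
  have fD: "finite D" and fq: "\<And>I. I \<in> D \<Longrightarrow> finite (q I)"
    using D q by (auto dest: division_ofD(1))
  have shared: "?g K = 0" if sh: "I \<in> D" "I' \<in> D" "I \<noteq> I'" "K \<in> q I" "K \<in> q I'" for I I' K
  proof -
    have "interior I \<inter> interior I' = {}" using division_ofD(5)[OF D] sh by auto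
    moreover have "interior K \<subseteq> interior I" "interior K \<subseteq> interior I'"
      using sh division_ofD(2)[OF q] by (auto intro!: interior_mono)
    ultimately have i: "interior K = {}" by blast
    obtain a b where K: "K = {a..b}" using division_ofD(4)[OF q[OF sh(1)] sh(4)] by auto
    have "K \<noteq> {}" using division_ofD(3)[OF q[OF sh(1)] sh(4)] .
    with K i show ?thesis by (auto simp: interior_atLeastAtMost_real)
  qed
  show ?thesis
    using fD fq shared
  proof (induction D rule: finite_induct)
    case (insert I D)
    have "(\<Sum>K\<in>(\<Union>I\<in>insert I D. q I). ?g K) = sum ?g (q I \<union> (\<Union>I\<in>D. q I))" by simp
    also have "\<dots> = sum ?g (q I) + sum ?g (\<Union>I\<in>D. q I)"
    proof (rule sum.union_inter_neutral)
      show "\<forall>x\<in>q I \<inter> \<Union> (q ` D). ?g x = 0"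
      proof
        fix x assume "x \<in> q I \<inter> \<Union> (q ` D)"
        then obtain I' where "I' \<in> D" "x \<in> q I'" "x \<in> q I" by auto
        then show "?g x = 0" using insert.prems(2)[of I I' x] insert.hyps by auto
      qed
    qed (use insert in auto)
    also have "sum ?g (\<Union>I\<in>D. q I) = (\<Sum>I\<in>D. sum ?g (q I))"
      by (rule insert.IH) (use insert.prems in blast)+
    finally show ?case using insert.hyps by simp
  qed simp
qed


text \<open>
  A finite version of Vitali's covering theorem. \<open>Z\<close> need not be measurable; the
  number \<open>e0\<close> stands for a positive lower bound of its outer measure. The finite set \<open>Ends\<close> makes room
  for the end points of a division, at which intervals inside a cell are not available.
\<close>

lemma vitali_disjoint_intervals:
  fixes Z :: "real set"
  assumes Zst: "Z \<subseteq> {s..t}" and e0: "e0 > 0"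
    and outer: "\<And>T. Z \<subseteq> T \<Longrightarrow> T \<in> lmeasurable \<Longrightarrow> measure lebesgue T \<ge> e0"
    and Ends: "finite Ends"
    and fine: "\<And>x d. x \<in> Z - Ends \<Longrightarrow> d > 0 \<Longrightarrow>
      \<exists>u v. u < v \<and> u \<le> x \<and> x \<le> v \<and> v - u < d \<and> {u..v} \<subseteq> {s..t} \<and> P u v"
  obtains D' where "D' division_of \<Union>D'" "\<Union>D' \<subseteq> {s..t}"
    "\<And>J. J \<in> D' \<Longrightarrow> \<exists>u v. J = {u..v} \<and> u < v \<and> P u v"
    "(\<Sum>J\<in>D'. Sup J - Inf J) > e0 / 2"
proof -
  define K where "K = {(u,v). u < v \<and> {u..v} \<subseteq> {s..t} \<and> P u v}"
  define mid where "mid = (\<lambda>(u::real,v). (u + v) / 2)"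
  define rad where "rad = (\<lambda>(u::real,v). (v - u) / 2)"
  have ball: "cball (mid k) (rad k) = {fst k..snd k}" for k
    by (auto simp: mid_def rad_def cball_eq_atLeastAtMost field_simps split: prod.splits)
  obtain C where C: "countable C" "C \<subseteq> K"
    and Cdisj: "pairwise (\<lambda>i j. disjnt (cball (mid i) (rad i)) (cball (mid j) (rad j))) C"
    and Cneg: "negligible ((Z - Ends) - (\<Union>i\<in>C. cball (mid i) (rad i)))"
  proof (rule Vitali_covering_theorem_cballs[of K rad "Z - Ends" mid])
    show "0 < rad i" if "i \<in> K" for i using that by (auto simp: K_def rad_def)
  next
    fix x d :: real assume x: "x \<in> Z - Ends" and d: "0 < d"
    then obtain u v where uv: "u < v" "u \<le> x" "x \<le> v" "v - u < d" "{u..v} \<subseteq> {s..t}" "P u v"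
      using fine by blast
    show "\<exists>i. i \<in> K \<and> x \<in> cball (mid i) (rad i) \<and> rad i < d"
    proof (intro exI[of _ "(u,v)"] conjI)
      show "x \<in> cball (mid (u,v)) (rad (u,v))" unfolding ball using uv by simp
    qed (use uv in \<open>auto simp: K_def rad_def\<close>)
  qed
  define CC where "CC = (\<lambda>k. {fst k..snd k}) ` C"
  have CCU: "\<Union>CC = (\<Union>i\<in>C. cball (mid i) (rad i))" by (simp add: CC_def ball)
  have Kst: "{fst k..snd k} \<subseteq> {s..t}" if "k \<in> K" for k
    using that by (cases k) (simp add: K_def)
  have CCst: "\<Union>CC \<subseteq> {s..t}" using Kst C(2) unfolding CC_def by blast
  have "\<Union>CC \<in> sets lebesgue"
    unfolding CC_def by (intro sets.countable_UN'') (use C(1) in auto)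
  then have CCm: "\<Union>CC \<in> lmeasurable"
    using bounded_subset[OF _ CCst] by (intro bounded_set_imp_lmeasurable) auto
  have negE: "negligible (Z - Ends - \<Union>CC)" "negligible Ends"
    using Cneg Ends by (auto simp: CCU intro!: negligible_finite)
  let ?T = "\<Union>CC \<union> ((Z - Ends - \<Union>CC) \<union> Ends)"
  have "e0 \<le> measure lebesgue ?T"
  proof (rule outer)
    show "Z \<subseteq> ?T" by blast
    show "?T \<in> lmeasurable"
      using CCm negE by (intro fmeasurable.Un) (auto intro: negligible_imp_measurable)
  qed
  also have "\<dots> = measure lebesgue (\<Union>CC)"
    by (rule measure_negligible_symdiff[OF CCm]) (rule negligible_subset[OF negligible_Un[OF negE]], auto)
  finally have big: "e0 \<le> measure lebesgue (\<Union>CC)" .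
  obtain D' where D': "D' \<subseteq> CC" "finite D'" "measure lebesgue (\<Union>CC) - e0/2 < measure lebesgue (\<Union>D')"
  proof (rule measure_countable_Union_approachable[of CC "e0/2" "measure lebesgue (\<Union>CC)"])
    show "countable CC" using C(1) by (simp add: CC_def)
    show "0 < e0/2" using e0 by simp
    show lm: "d \<in> lmeasurable" if "d \<in> CC" for d using that by (auto simp: CC_def)
    show "measure lebesgue (\<Union>D') \<le> measure lebesgue (\<Union>CC)" if "D' \<subseteq> CC" "finite D'" for D'
    proof -
      have "\<Union>D' \<in> lmeasurable"
        by (rule fmeasurable.finite_Union) (use that lm in auto)
      then show ?thesis using that CCm by (intro measure_mono_fmeasurable fmeasurableD Union_mono)
    qed
  qed
  have D'C: "\<exists>u v. J = {u..v} \<and> u < v \<and> P u v" if "J \<in> D'" for J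
  proof -
    obtain k where "k \<in> C" "J = {fst k..snd k}" using \<open>J \<in> D'\<close> D'(1) unfolding CC_def by blast
    moreover have "fst k < snd k \<and> P (fst k) (snd k)" using \<open>k \<in> C\<close> C(2) unfolding K_def by auto
    ultimately show ?thesis by blast
  qed
  have D'div: "D' division_of \<Union>D'"
  proof (rule division_ofI[OF D'(2)])
    fix J J' assume J: "J \<in> D'" "J' \<in> D'" "J \<noteq> J'"
    obtain k k' where k: "k \<in> C" "J = {fst k..snd k}" "k' \<in> C" "J' = {fst k'..snd k'}"
      using J D'(1) unfolding CC_def by blast
    then have "k \<noteq> k'" using J(3) by auto
    then have "disjnt J J'" using pairwiseD[OF Cdisj k(1) k(3)] k by (simp add: ball)
    then show "interior J \<inter> interior J' = {}"
      using interior_subset unfolding disjnt_def by blast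
  next
    fix J assume J: "J \<in> D'"
    show "J \<subseteq> \<Union>D'" "J \<noteq> {}" "\<exists>a b. J = cbox a b" using D'C[OF J] J by auto
  qed simp
  have "measure lebesgue (\<Union>D') = (\<Sum>J\<in>D'. measure lebesgue J)"
    by (rule content_division[OF D'div, symmetric])
  also have "\<dots> = (\<Sum>J\<in>D'. Sup J - Inf J)"
  proof (rule sum.cong[OF refl])
    fix J assume "J \<in> D'"
    then obtain u v where "J = {u..v}" "u < v" using D'C by blast
    then show "measure lebesgue J = Sup J - Inf J" by simp
  qed
  finally have "(\<Sum>J\<in>D'. Sup J - Inf J) > e0 / 2" using D'(3) big by simp
  then show thesis using that[OF D'div _ D'C] D'(1) CCst by blast
qed

text \<open>
  Choose a division that almost attains the total variation, and in each of its cells cover the points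
  of \<open>Z\<close> by disjoint small intervals on which \<open>f\<close> moves against its increment over the cell. By
  \<open>refined_variation\<close> the division refined by these intervals has variation larger by a multiple of
  the outer measure of \<open>Z\<close>, which exceeds the total variation unless \<open>Z\<close> is negligible.
\<close>

lemma oscillating_slopes_negligible:
  fixes f :: "real \<Rightarrow> real"
  assumes st: "s < t" and e: "e > 0"
    and bv: "\<And>D. D division_of {s..t} \<Longrightarrow> (\<Sum>K\<in>D. \<bar>f (Sup K) - f (Inf K)\<bar>) \<le> B"
    and Zst: "Z \<subseteq> {s<..<t}"
    and steep: "\<And>x \<eta>. x \<in> Z \<Longrightarrow> \<eta> > 0 \<Longrightarrow>
      \<exists>u v. u < v \<and> u \<le> x \<and> x \<le> v \<and> v - u < \<eta> \<and> f v - f u \<ge> e * (v - u)"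
    and falling: "\<And>x \<eta>. x \<in> Z \<Longrightarrow> \<eta> > 0 \<Longrightarrow>
      \<exists>u v. u < v \<and> u \<le> x \<and> x \<le> v \<and> v - u < \<eta> \<and> f v - f u \<le> - (e * (v - u))"
  shows "negligible Z"
proof (rule ccontr)
  assume "\<not> negligible Z"
  then obtain e0 where e0: "e0 > 0"
    and outer: "\<And>T. Z \<subseteq> T \<Longrightarrow> T \<in> lmeasurable \<Longrightarrow> measure lebesgue T \<ge> e0"
    unfolding negligible_outer by (meson not_le)
  define var where "var D = (\<Sum>K\<in>D. \<bar>f (Sup K) - f (Inf K)\<bar>)" for D
  define V where "V = (SUP D\<in>{D. D division_of {s..t}}. var D)"
  have "{s..t} \<noteq> {}" using st by simp
  then have ne: "{D. D division_of {s..t}} \<noteq> {}"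
    using division_of_self[of s t] by (metis cbox_interval empty_iff mem_Collect_eq)
  have bdd: "bdd_above (var ` {D. D division_of {s..t}})"
    using bv by (auto simp: var_def bdd_above_def)
  have varV: "var D \<le> V" if "D division_of {s..t}" for D
    unfolding V_def using that by (intro cSUP_upper bdd) auto
  have "V - e * e0 < V" using e e0 by simp
  then obtain D where D: "D division_of {s..t}" and varD: "V - e * e0 < var D"
    using less_cSUP_iff[OF ne bdd] unfolding V_def by blast
  have fD: "finite D" using D by auto
  have interval: "\<exists>c d. c \<le> d \<and> I = {c..d} \<and> Inf I = c \<and> Sup I = d" if "I \<in> D" for I
    using division_ofD(3,4)[OF D that] by fastforce
  \<comment> \<open>intervals in the cell \<open>I\<close> on which \<open>f\<close> moves against its increment over \<open>I\<close>\<close>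
  define good where "good I u v \<longleftrightarrow> {u..v} \<subseteq> interior I \<and>
      (f (Sup I) - f (Inf I) \<ge> 0 \<longrightarrow> f v - f u \<le> - (e * (v - u))) \<and>
      (f (Sup I) - f (Inf I) < 0 \<longrightarrow> f v - f u \<ge> e * (v - u))" for I u v
  define Ends where "Ends = Inf ` D \<union> Sup ` D"
  have inside: "\<exists>I\<in>D. x \<in> interior I" if x: "x \<in> Z - Ends" for x
  proof -
    have "x \<in> \<Union>D" using x Zst division_ofD(6)[OF D] by auto
    then obtain I where I: "I \<in> D" "x \<in> I" by auto
    then obtain c d where cd: "I = {c..d}" "Inf I = c" "Sup I = d" using interval by blast
    have "x \<noteq> c" "x \<noteq> d" using x I(1) cd(2,3) unfolding Ends_def by blast+
    with I cd(1) show ?thesis by (intro bexI[of _ I]) (auto simp: interior_atLeastAtMost_real)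
  qed
  obtain D' where D'div: "D' division_of \<Union>D'"
    and D'C: "\<And>J. J \<in> D' \<Longrightarrow> \<exists>u v. J = {u..v} \<and> u < v \<and> (\<exists>I\<in>D. good I u v)"
    and lenD'0: "(\<Sum>J\<in>D'. Sup J - Inf J) > e0 / 2"
  proof (rule vitali_disjoint_intervals[of Z s t e0 Ends "\<lambda>u v. \<exists>I\<in>D. good I u v"])
    show "Z \<subseteq> {s..t}" using Zst by auto
    show "finite Ends" using fD by (simp add: Ends_def)
  next
    fix x d :: real assume x: "x \<in> Z - Ends" and d: "0 < d"
    then obtain I where I: "I \<in> D" "x \<in> interior I" and xZ: "x \<in> Z" using inside by auto
    then obtain h where h: "h > 0" "ball x h \<subseteq> interior I"
      using open_contains_ball[of "interior I"] by auto
    have sub: "{u..v} \<subseteq> interior I" if "u \<le> x" "x \<le> v" "v - u < min h d" for u v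
      using that h(2) by (intro order_trans[OF _ h(2)]) (auto simp: dist_real_def)
    have hd: "min h d > 0" using h d by simp
    have "\<exists>u v. u < v \<and> u \<le> x \<and> x \<le> v \<and> v - u < min h d \<and> good I u v"
    proof (cases "f (Sup I) - f (Inf I) \<ge> 0")
      case True
      then show ?thesis using falling[OF xZ hd] sub unfolding good_def by fastforce
    next
      case False
      then show ?thesis using steep[OF xZ hd] sub unfolding good_def by fastforce
    qed
    then obtain u v where uv: "u < v" "u \<le> x" "x \<le> v" "v - u < min h d" "good I u v" by blast
    moreover have "{u..v} \<subseteq> {s..t}"
      using uv(5) interior_subset[of I] division_ofD(2)[OF D I(1)] unfolding good_def by blast
    ultimately show "\<exists>u v. u < v \<and> u \<le> x \<and> x \<le> v \<and> v - u < d \<and> {u..v} \<subseteq> {s..t} \<and> (\<exists>I\<in>D. good I u v)"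
      using I(1) by (intro exI[of _ u] exI[of _ v]) auto
  qed (use e0 outer in auto)
  define len where "len p = (\<Sum>J\<in>p. Sup J - Inf J)" for p :: "real set set"
  have lenD': "len D' > e0 / 2" using lenD'0 by (simp add: len_def)
  have finD': "finite D'" using D'div by auto
  define p where "p I = {J \<in> D'. J \<subseteq> interior I}" for I
  have D'p: "D' = (\<Union>I\<in>D. p I)"
  proof
    show "D' \<subseteq> (\<Union>I\<in>D. p I)"
    proof
      fix J assume J: "J \<in> D'"
      then obtain u v I where "J = {u..v}" "I \<in> D" "good I u v" using D'C by blast
      then show "J \<in> (\<Union>I\<in>D. p I)" using J unfolding p_def good_def by blast
    qed
  qed (auto simp: p_def)
  have "len (\<Union>I\<in>D. p I) = (\<Sum>I\<in>D. len (p I))"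
    unfolding len_def
  proof (rule sum.UNION_disjoint[OF fD])
    show "\<forall>i\<in>D. \<forall>j\<in>D. i \<noteq> j \<longrightarrow> p i \<inter> p j = {}"
    proof (intro ballI impI)
      fix I I' assume I: "I \<in> D" "I' \<in> D" "I \<noteq> I'"
      then have "interior I \<inter> interior I' = {}" using division_ofD(5)[OF D] by auto
      moreover have "J \<noteq> {}" if "J \<in> D'" for J using D'C[OF that] by auto
      ultimately show "p I \<inter> p I' = {}" unfolding p_def by blast
    qed
  qed (use finD' in \<open>auto simp: p_def\<close>)
  then have lensum: "len D' = (\<Sum>I\<in>D. len (p I))" using D'p by simp
  have "\<forall>I\<in>D. \<exists>q. q division_of I \<and> \<bar>f (Sup I) - f (Inf I)\<bar> + 2 * e * len (p I) \<le> var q"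
  proof
    fix I assume I: "I \<in> D"
    obtain c d where cd: "c \<le> d" "I = {c..d}" "Inf I = c" "Sup I = d" using interval[OF I] by blast
    have div: "p I division_of \<Union>(p I)"
      by (rule division_of_subset[OF D'div]) (auto simp: p_def)
    have sub: "\<Union>(p I) \<subseteq> {c..d}" using interior_subset[of I] cd unfolding p_def by blast
    have goodJ: "good I (Inf J) (Sup J)" if "J \<in> p I" for J
    proof -
      have J: "J \<in> D'" "J \<subseteq> interior I" using that by (auto simp: p_def)
      from D'C[OF J(1)] obtain u v I' where uv: "J = {u..v}" "u < v" "I' \<in> D" "good I' u v" by blast
      have "u \<in> interior I \<inter> interior I'" using uv J(2) unfolding good_def by force
      then have "I = I'" using division_ofD(5)[OF D I uv(3)] by blast
      then show ?thesis using uv by simp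
    qed
    show "\<exists>q. q division_of I \<and> \<bar>f (Sup I) - f (Inf I)\<bar> + 2 * e * len (p I) \<le> var q"
      unfolding cd(2) len_def var_def
      using refined_variation[OF div sub cd(1), of f e] goodJ cd unfolding good_def by auto
  qed
  then obtain q where q: "\<And>I. I \<in> D \<Longrightarrow> q I division_of I"
    and varq: "\<And>I. I \<in> D \<Longrightarrow> \<bar>f (Sup I) - f (Inf I)\<bar> + 2 * e * len (p I) \<le> var (q I)"
    by metis
  have "V - e * e0 + 2 * e * len D' < var D + 2 * e * len D'" using varD by simp
  also have "\<dots> = (\<Sum>I\<in>D. \<bar>f (Sup I) - f (Inf I)\<bar> + 2 * e * len (p I))"
    using lensum by (simp add: var_def sum.distrib sum_distrib_left)
  also have "\<dots> \<le> (\<Sum>I\<in>D. var (q I))" by (intro sum_mono varq)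
  also have "\<dots> = var (\<Union>I\<in>D. q I)"
    unfolding var_def by (rule sum_cells[symmetric, OF D q])
  also have "\<dots> \<le> V" by (rule varV[OF division_of_cells[OF D q]])
  finally have "2 * e * len D' < e * e0" by simp
  moreover have "e * e0 < e * (2 * len D')" using lenD' e by (intro mult_strict_left_mono) auto
  ultimately show False by simp
qed


text \<open>
  Disjoint intervals with slopes at least \<open>M\<close> that cover half of the outer measure of \<open>Z\<close> contribute \<open>M\<close>
  times this measure to the variation, for every \<open>M\<close>.
\<close>

lemma unbounded_slopes_negligible:
  fixes f :: "real \<Rightarrow> real"
  assumes st: "s < t"
    and bv: "\<And>D. D division_of {s..t} \<Longrightarrow> (\<Sum>K\<in>D. \<bar>f (Sup K) - f (Inf K)\<bar>) \<le> B"
    and Zst: "Z \<subseteq> {s<..<t}"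
    and steep: "\<And>x \<eta> M. x \<in> Z \<Longrightarrow> \<eta> > 0 \<Longrightarrow>
      \<exists>u v. u < v \<and> u \<le> x \<and> x \<le> v \<and> v - u < \<eta> \<and> \<bar>f v - f u\<bar> \<ge> M * (v - u)"
  shows "negligible Z"
proof (rule ccontr)
  assume "\<not> negligible Z"
  then obtain e0 where e0: "e0 > 0"
    and outer: "\<And>T. Z \<subseteq> T \<Longrightarrow> T \<in> lmeasurable \<Longrightarrow> measure lebesgue T \<ge> e0"
    unfolding negligible_outer by (meson not_le)
  \<comment> \<open>a total length above \<open>e0 / 2\<close> then produces a variation above \<open>B\<close>\<close>
  define M where "M = (\<bar>B\<bar> + 1) * 2 / e0"
  have M: "M > 0" using e0 by (simp add: M_def)
  obtain D where D: "D division_of \<Union>D" "\<Union>D \<subseteq> {s..t}"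
    and DM: "\<And>J. J \<in> D \<Longrightarrow> \<exists>u v. J = {u..v} \<and> u < v \<and> \<bar>f v - f u\<bar> \<ge> M * (v - u)"
    and len: "(\<Sum>J\<in>D. Sup J - Inf J) > e0 / 2"
  proof (rule vitali_disjoint_intervals[of Z s t e0 "{}" "\<lambda>u v. \<bar>f v - f u\<bar> \<ge> M * (v - u)"])
    show "Z \<subseteq> {s..t}" using Zst by auto
    fix x d :: real assume x: "x \<in> Z - {}" and d: "0 < d"
    \<comment> \<open>keeps the interval inside \<open>{s..t}\<close>\<close>
    define h where "h = min d (min (x - s) (t - x))"
    have h: "h > 0" using x d Zst by (auto simp: h_def)
    obtain u v where uv: "u < v" "u \<le> x" "x \<le> v" "v - u < h" "\<bar>f v - f u\<bar> \<ge> M * (v - u)"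
      using steep[of x h M] x h by auto
    then show "\<exists>u v. u < v \<and> u \<le> x \<and> x \<le> v \<and> v - u < d \<and> {u..v} \<subseteq> {s..t} \<and> \<bar>f v - f u\<bar> \<ge> M * (v - u)"
      by (intro exI[of _ u] exI[of _ v]) (auto simp: h_def)
  qed (use e0 outer in auto)
  obtain q where q: "D \<subseteq> q" "q division_of cbox s t"
    using partial_division_extend_interval[OF D(1)] D(2) by (metis cbox_interval)
  have "\<bar>B\<bar> + 1 = M * (e0 / 2)" using e0 by (simp add: M_def)
  also have "\<dots> < M * (\<Sum>J\<in>D. Sup J - Inf J)" using M len by (intro mult_strict_left_mono) auto
  also have "\<dots> = (\<Sum>J\<in>D. M * (Sup J - Inf J))" by (simp add: sum_distrib_left)
  also have "\<dots> \<le> (\<Sum>J\<in>D. \<bar>f (Sup J) - f (Inf J)\<bar>)"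
  proof (rule sum_mono)
    fix J assume "J \<in> D"
    then obtain u v where "J = {u..v}" "u < v" "\<bar>f v - f u\<bar> \<ge> M * (v - u)" using DM by blast
    then show "M * (Sup J - Inf J) \<le> \<bar>f (Sup J) - f (Inf J)\<bar>" by simp
  qed
  also have "\<dots> \<le> (\<Sum>J\<in>q. \<bar>f (Sup J) - f (Inf J)\<bar>)"
    using q by (intro sum_mono2) auto
  also have "\<dots> \<le> B" using q bv by simp
  finally show False by simp
qed

text \<open>
  At a point of non-differentiability the slopes over small intervals are unbounded, or they
  stay on both sides of some rational \<open>p\<close>, at distance at least \<open>1 / Suc n\<close> from it. In the second
  case \<open>f - p x\<close>, which has bounded variation as well, has oscillating slopes. So the exceptional set is a
  countable union of sets of the two kinds treated above.
\<close>

lemma bounded_variation_differentiable_ae: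
  fixes f :: "real \<Rightarrow> real"
  assumes st: "s < t"
    and bv: "\<And>D. D division_of {s..t} \<Longrightarrow> (\<Sum>K\<in>D. \<bar>f (Sup K) - f (Inf K)\<bar>) \<le> B"
  shows "negligible {x \<in> {s<..<t}. \<not> f differentiable at x}"
proof -
  define near where "near x \<eta> u v \<longleftrightarrow> u < v \<and> u \<le> x \<and> x \<le> v \<and> v - u < \<eta>" for x \<eta> u v :: real
  define Zinf where "Zinf = {x\<in>{s<..<t}. \<forall>\<eta>>0. \<forall>M. \<exists>u v. near x \<eta> u v \<and> \<bar>f v - f u\<bar> \<ge> M * (v - u)}"
  define Z where "Z p e = {x\<in>{s<..<t}. \<forall>\<eta>>0. (\<exists>u v. near x \<eta> u v \<and> f v - f u \<ge> (p + e) * (v - u)) \<and>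
      (\<exists>u v. near x \<eta> u v \<and> f v - f u \<le> (p - e) * (v - u))}" for p e
  have Zinf: "negligible Zinf"
    by (rule unbounded_slopes_negligible[OF st bv]) (auto simp: Zinf_def near_def)
  have Z: "negligible (Z p e)" if e: "e > 0" for p e
  proof (rule oscillating_slopes_negligible[OF st e, where f = "\<lambda>x. f x - p * x" and B = "B + \<bar>p\<bar> * (t - s)"])
    fix D assume D: "D division_of {s..t}"
    have "\<bar>(f (Sup K) - p * Sup K) - (f (Inf K) - p * Inf K)\<bar> \<le> \<bar>f (Sup K) - f (Inf K)\<bar> + \<bar>p\<bar> * (Sup K - Inf K)"
      if "K \<in> D" for K
    proof -
      have "Inf K \<le> Sup K" using division_ofD(3,4)[OF D that] by fastforce
      then have "\<bar>p * (Sup K - Inf K)\<bar> = \<bar>p\<bar> * (Sup K - Inf K)" by (simp add: abs_mult)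
      moreover have "(f (Sup K) - p * Sup K) - (f (Inf K) - p * Inf K) = f (Sup K) - f (Inf K) - p * (Sup K - Inf K)"
        by (simp add: algebra_simps)
      ultimately show ?thesis by linarith
    qed
    then have "(\<Sum>K\<in>D. \<bar>(f (Sup K) - p * Sup K) - (f (Inf K) - p * Inf K)\<bar>) \<le>
        (\<Sum>K\<in>D. \<bar>f (Sup K) - f (Inf K)\<bar> + \<bar>p\<bar> * (Sup K - Inf K))"
      by (rule sum_mono)
    also have "\<dots> = (\<Sum>K\<in>D. \<bar>f (Sup K) - f (Inf K)\<bar>) + \<bar>p\<bar> * (\<Sum>K\<in>D. Sup K - Inf K)"
      by (simp add: sum.distrib sum_distrib_left)
    also have "(\<Sum>K\<in>D. Sup K - Inf K) = t - s"
      using sum_increments_division[OF D, of "\<lambda>x. x"] st by simp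
    finally show "(\<Sum>K\<in>D. \<bar>(f (Sup K) - p * Sup K) - (f (Inf K) - p * Inf K)\<bar>) \<le> B + \<bar>p\<bar> * (t - s)"
      using bv[OF D] by simp
  next
    fix x \<eta> :: real assume "x \<in> Z p e" "0 < \<eta>"
    then have "(\<exists>u v. near x \<eta> u v \<and> f v - f u \<ge> (p + e) * (v - u)) \<and>
      (\<exists>u v. near x \<eta> u v \<and> f v - f u \<le> (p - e) * (v - u))" by (auto simp: Z_def)
    then show "\<exists>u v. u < v \<and> u \<le> x \<and> x \<le> v \<and> v - u < \<eta> \<and> e * (v - u) \<le> f v - p * v - (f u - p * u)"
      "\<exists>u v. u < v \<and> u \<le> x \<and> x \<le> v \<and> v - u < \<eta> \<and> f v - p * v - (f u - p * u) \<le> - (e * (v - u))"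
      unfolding near_def by (auto simp: algebra_simps intro!: exI)
  qed (auto simp: Z_def)
  define N where "N = Zinf \<union> (\<Union>p\<in>\<rat>. \<Union>n::nat. Z p (1 / Suc n))"
  have "negligible N"
    unfolding N_def
    by (intro negligible_Un Zinf negligible_countable_Union countable_image countable_rat)
      (auto intro!: negligible_countable_Union Z)
  moreover have "{x \<in> {s<..<t}. \<not> f differentiable at x} \<subseteq> N"
  proof (clarify, rule ccontr)
    fix x assume x: "x \<in> {s<..<t}" and nd: "\<not> f differentiable at x" and xN: "x \<notin> N"
    define q where "q y = (f y - f x) / (y - x)" for y
    have nearq: "(\<exists>u v. near x \<eta> u v \<and> q y * (v - u) = f v - f u)" if "y \<noteq> x" "\<bar>y - x\<bar> < \<eta>" for y \<eta>
    proof (cases "x < y")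
      case True
      then show ?thesis using that by (intro exI[of _ x] exI[of _ y]) (auto simp: near_def q_def)
    next
      case False
      then show ?thesis using that
        by (intro exI[of _ y] exI[of _ x]) (auto simp: near_def q_def divide_simps algebra_simps)
    qed
    have ev: "eventually (\<lambda>y. \<exists>u v. near x \<eta> u v \<and> q y * (v - u) = f v - f u) (at x)" if "\<eta> > 0" for \<eta>
      using that nearq unfolding eventually_at by (auto simp: dist_real_def)
    have "x \<notin> Zinf" using xN by (auto simp: N_def)
    then have "\<exists>\<eta>>0. \<exists>M. \<forall>u v. near x \<eta> u v \<longrightarrow> \<not> M * (v - u) \<le> \<bar>f v - f u\<bar>"
      using x unfolding Zinf_def by blast
    then obtain \<eta> M where \<eta>: "\<eta> > 0" and M: "\<And>u v. near x \<eta> u v \<Longrightarrow> \<bar>f v - f u\<bar> < M * (v - u)"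
      unfolding not_le by blast
    have evM: "eventually (\<lambda>y. \<bar>q y\<bar> < M) (at x)"
      using ev[OF \<eta>]
    proof eventually_elim
      case (elim y)
      then obtain u v where uv: "near x \<eta> u v" "q y * (v - u) = f v - f u" by blast
      then have "\<bar>q y\<bar> * (v - u) < M * (v - u)" using M[OF uv(1)] uv(2)[symmetric]
        by (simp add: near_def abs_mult)
      then show ?case using uv(1) by (simp add: near_def)
    qed
    have alt: "eventually (\<lambda>y. q y < p + 1 / Suc n) (at x) \<or> eventually (\<lambda>y. q y > p - 1 / Suc n) (at x)"
      if p: "p \<in> \<rat>" for p n
    proof -
      have "x \<notin> Z p (1 / Suc n)" using xN p by (auto simp: N_def)
      then have "\<exists>\<eta>>0. \<not> (\<exists>u v. near x \<eta> u v \<and> f v - f u \<ge> (p + 1 / Suc n) * (v - u)) \<or>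
          \<not> (\<exists>u v. near x \<eta> u v \<and> f v - f u \<le> (p - 1 / Suc n) * (v - u))"
        using x unfolding Z_def by blast
      then obtain \<eta> where \<eta>: "\<eta> > 0" and
        "(\<forall>u v. near x \<eta> u v \<longrightarrow> f v - f u < (p + 1 / Suc n) * (v - u)) \<or>
         (\<forall>u v. near x \<eta> u v \<longrightarrow> f v - f u > (p - 1 / Suc n) * (v - u))"
        by (metis not_le)
      then show ?thesis
      proof (elim disjE)
        assume A: "\<forall>u v. near x \<eta> u v \<longrightarrow> f v - f u < (p + 1 / Suc n) * (v - u)"
        have "eventually (\<lambda>y. q y < p + 1 / Suc n) (at x)"
          using ev[OF \<eta>]
        proof eventually_elim
          case (elim y)
          then obtain u v where uv: "near x \<eta> u v" "q y * (v - u) = f v - f u" by blast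
          then have "q y * (v - u) < (p + 1 / Suc n) * (v - u)" using A by metis
          then show ?case using uv(1) by (simp add: near_def)
        qed
        then show ?thesis ..
      next
        assume A: "\<forall>u v. near x \<eta> u v \<longrightarrow> f v - f u > (p - 1 / Suc n) * (v - u)"
        have "eventually (\<lambda>y. q y > p - 1 / Suc n) (at x)"
          using ev[OF \<eta>]
        proof eventually_elim
          case (elim y)
          then obtain u v where uv: "near x \<eta> u v" "q y * (v - u) = f v - f u" by blast
          then have "q y * (v - u) > (p - 1 / Suc n) * (v - u)" using A by metis
          then show ?case using uv(1) by (simp add: near_def)
        qed
        then show ?thesis ..
      qed
    qed
    \<comment> \<open>the supremum of \<open>A\<close> is the lower limit of the slopes, and turns out to be the derivative\<close>
    define A where "A = {a. eventually (\<lambda>y. q y > a) (at x)}"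
    have A1: "- M \<in> A" unfolding A_def using evM by (auto elim!: eventually_mono)
    have A2: "a \<le> M" if "a \<in> A" for a
    proof (rule ccontr)
      assume "\<not> a \<le> M"
      have "eventually (\<lambda>y. \<bar>q y\<bar> < M \<and> q y > a) (at x)"
        using evM that unfolding A_def by (auto intro: eventually_conj)
      then obtain y where "\<bar>q y\<bar> < M" "q y > a"
        using eventually_happens'[OF at_neq_bot] by blast
      then show False using \<open>\<not> a \<le> M\<close> by linarith
    qed
    have bdd: "bdd_above A" using A2 by (auto simp: bdd_above_def)
    define L where "L = Sup A"
    have "(q \<longlongrightarrow> L) (at x)"
    proof (rule tendstoI)
      fix e :: real assume e: "e > 0"
      obtain a where a: "a \<in> A" "a > L - e"
        using less_cSup_iff[of A "L - e"] A1 bdd e unfolding L_def by auto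
      obtain n where n: "1 / Suc n < e / 3" using e nat_approx_posE[of "e/3"] by auto
      obtain p where p: "p \<in> \<rat>" "L + e/3 < p" "p < L + 2*e/3"
        using Rats_dense_in_real[of "L + e/3" "L + 2*e/3"] e by auto
      have "\<not> eventually (\<lambda>y. q y > p - 1 / Suc n) (at x)"
      proof
        assume "eventually (\<lambda>y. q y > p - 1 / Suc n) (at x)"
        then have "p - 1 / Suc n \<le> L" unfolding L_def by (intro cSup_upper bdd) (simp add: A_def)
        then show False using n p by simp
      qed
      then have "eventually (\<lambda>y. q y < p + 1 / Suc n) (at x)" using alt[OF p(1)] by blast
      moreover have "eventually (\<lambda>y. q y > a) (at x)" using a by (simp add: A_def)
      ultimately show "eventually (\<lambda>y. dist (q y) L < e) (at x)"
        by eventually_elim (use a p n in \<open>auto simp: dist_real_def\<close>)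
    qed
    then have "(f has_field_derivative L) (at x)"
      unfolding has_field_derivative_iff q_def .
    then show False using nd by (auto simp: real_differentiable_def)
  qed
  ultimately show ?thesis by (rule negligible_subset)
qed

section \<open>Increments of absolutely continuous functions\<close>

lemma absolutely_continuous_on_subset:
  "absolutely_continuous_on S f \<Longrightarrow> T \<subseteq> S \<Longrightarrow> absolutely_continuous_on T f"
  unfolding absolutely_continuous_on_def by (meson order_trans)

text \<open>
  On intervals shorter than the \<open>\<delta>\<close> that belongs to \<open>\<epsilon> = 1\<close> the variation is at most 1. Compactness,
  in the form of the Bolzano principle, puts the short intervals together.
\<close>

lemma absolutely_continuous_differentiable_ae:
  assumes ac: "absolutely_continuous_on {a..b} f" and ab: "a \<le> b"
  shows "negligible {x \<in> {a<..<b}. \<not> f differentiable at x}"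
proof -
  define N where "N = {x \<in> {a<..<b}. \<not> f differentiable at x}"
  obtain \<delta> where \<delta>: "\<delta> > 0" and bv: "\<And>D. D division_of \<Union>D \<Longrightarrow> \<Union>D \<subseteq> {a..b} \<Longrightarrow>
      (\<Sum>K\<in>D. Sup K - Inf K) < \<delta> \<Longrightarrow> (\<Sum>K\<in>D. \<bar>f (Sup K) - f (Inf K)\<bar>) < 1"
    using ac unfolding absolutely_continuous_on_def by (meson zero_less_one)
  have "negligible (N \<inter> {a..b})"
    using ab
  proof (induction rule: Bolzano)
    case (trans x y z)
    then have "negligible ((N \<inter> {x..y}) \<union> (N \<inter> {y..z}))" by (intro negligible_Un)
    then show ?case by (rule negligible_subset) auto
  next
    case (local x)
    show ?case
    proof (intro exI[of _ \<delta>] conjI \<delta> allI impI)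
      fix c d assume cd: "c \<le> x \<and> x \<le> d \<and> d - c < \<delta>"
      define s t where "s = max a c" and "t = min b d"
      show "negligible (N \<inter> {c..d})"
      proof (cases "s < t")
        case True
        have "(\<Sum>K\<in>D. \<bar>f (Sup K) - f (Inf K)\<bar>) \<le> 1" if D: "D division_of {s..t}" for D
        proof -
          have "(\<Sum>K\<in>D. Sup K - Inf K) < \<delta>"
            using sum_increments_division[OF D, of "\<lambda>x. x"] True cd unfolding s_def t_def by auto
          moreover have U: "\<Union>D = {s..t}" using D by (rule division_ofD(6))
          ultimately show ?thesis
            using bv[of D] D by (simp add: s_def t_def)
        qed
        then have "negligible {x \<in> {s<..<t}. \<not> f differentiable at x}"
          by (rule bounded_variation_differentiable_ae[OF True])
        then have "negligible ({x \<in> {s<..<t}. \<not> f differentiable at x} \<union> {s,t})"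
          by (intro negligible_Un) auto
        then show ?thesis by (rule negligible_subset) (auto simp: N_def s_def t_def)
      next
        case False
        then have "N \<inter> {c..d} \<subseteq> {a,b,c,d}" by (auto simp: N_def s_def t_def)
        then show ?thesis by (rule negligible_subset[rotated]) auto
      qed
    qed
  qed
  then show ?thesis by (rule negligible_subset) (auto simp: N_def)
qed

text \<open>
  A gauge that is adapted to the derivative at points of differentiability makes the Riemann sums
  follow the increments of \<open>f\<close> there. Around the other points, a null set, it confines the
  intervals to an open set of small measure, on which absolute continuity makes the increments small.
\<close>

lemma absolutely_continuous_has_integral:
  assumes ac: "absolutely_continuous_on {a..b} f" and ab: "a \<le> b"
  shows "((\<lambda>x. if x \<in> {a<..<b} \<and> f differentiable at x then deriv f x else 0) has_integral (f b - f a)) {a..b}"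
proof -
  define Dom where "Dom = {x \<in> {a<..<b}. f differentiable at x}"
  define g where "g x = (if x \<in> Dom then deriv f x else 0)" for x
  define N where "N = {a..b} - Dom"
  have "negligible ({x \<in> {a<..<b}. \<not> f differentiable at x} \<union> {a,b})"
    by (intro negligible_Un absolutely_continuous_differentiable_ae[OF ac ab]) auto
  then have neg: "negligible N" by (rule negligible_subset) (auto simp: N_def Dom_def)
  have "(g has_integral (f b - f a)) (cbox a b)"
    unfolding has_integral
  proof (intro allI impI)
    fix e :: real assume e: "e > 0"
    define e' where "e' = e / (2 * (b - a + 1))"
    have e': "e' > 0" "e' * (b - a) \<le> e / 2" using e ab by (auto simp: e'_def field_simps)
    obtain \<delta> where \<delta>: "\<delta> > 0" and small: "\<And>D. D division_of \<Union>D \<Longrightarrow> \<Union>D \<subseteq> {a..b} \<Longrightarrow>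
        (\<Sum>K\<in>D. Sup K - Inf K) < \<delta> \<Longrightarrow> (\<Sum>K\<in>D. \<bar>f (Sup K) - f (Inf K)\<bar>) < e / 2"
      using ac e unfolding absolutely_continuous_on_def by (meson half_gt_zero)
    have N: "N \<in> lmeasurable" using neg by (rule negligible_imp_measurable)
    obtain T where T: "open T" "N \<subseteq> T" and TN: "T - N \<in> lmeasurable" "emeasure lebesgue (T - N) < ennreal \<delta>"
      using sets_lebesgue_outer_open[OF fmeasurableD[OF N] \<delta>] by blast
    have "T = (T - N) \<union> N" using T(2) by blast
    then have T': "T \<in> lmeasurable" using TN(1) N by (metis fmeasurable.Un)
    have "measure lebesgue T = measure lebesgue (T - N)"
      by (rule measure_negligible_symdiff[OF TN(1)]) (rule negligible_subset[OF neg], auto)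
    also have "\<dots> < \<delta>"
      using TN \<delta> by (simp add: emeasure_eq_measure2 ennreal_less_iff)
    finally have T\<delta>: "measure lebesgue T < \<delta>" .
    have "\<exists>d>0. \<forall>u v. u \<le> x \<longrightarrow> x \<le> v \<longrightarrow> {u..v} \<subseteq> ball x d \<longrightarrow> \<bar>f v - f u - g x * (v - u)\<bar> \<le> e' * (v - u)"
      if x: "x \<in> Dom" for x
    proof -
      have "(f has_real_derivative g x) (at x)"
        using x DERIV_deriv_iff_real_differentiable[of f x] unfolding Dom_def g_def by auto
      then have "(f has_derivative (\<lambda>h. h * g x)) (at x)"
        by (simp add: has_field_derivative_def mult.commute[of _ "g x"])
      then obtain d where d: "d > 0"
        "\<And>y. norm (y - x) < d \<Longrightarrow> norm (f y - f x - (y - x) * g x) \<le> e' * norm (y - x)"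
        using e' unfolding has_derivative_at_alt by metis
      show ?thesis
      proof (intro exI[of _ d] conjI d(1) allI impI)
        fix u v assume uv: "u \<le> x" "x \<le> v" "{u..v} \<subseteq> ball x d"
        then have "u \<in> {u..v}" "v \<in> {u..v}" by auto
        then have "u \<in> ball x d" "v \<in> ball x d" using uv(3) by blast+
        then have "\<bar>f u - f x - (u - x) * g x\<bar> \<le> e' * (x - u)" "\<bar>f v - f x - (v - x) * g x\<bar> \<le> e' * (v - x)"
          using d(2)[of u] d(2)[of v] uv by (auto simp: dist_real_def abs_minus_commute)
        then have "\<bar>(f v - f x - (v - x) * g x) - (f u - f x - (u - x) * g x)\<bar> \<le> e' * (x - u) + e' * (v - x)"
          by linarith
        then show "\<bar>f v - f u - g x * (v - u)\<bar> \<le> e' * (v - u)"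
          by (simp add: algebra_simps)
      qed
    qed
    then obtain d where d: "\<And>x. x \<in> Dom \<Longrightarrow> d x > 0" and dest: "\<And>x u v. x \<in> Dom \<Longrightarrow> u \<le> x \<Longrightarrow> x \<le> v \<Longrightarrow>
        {u..v} \<subseteq> ball x (d x) \<Longrightarrow> \<bar>f v - f u - g x * (v - u)\<bar> \<le> e' * (v - u)"
      by metis
    define \<gamma> where "\<gamma> x = (if x \<in> Dom then ball x (d x) else if x \<in> N then T else UNIV)" for x
    show "\<exists>\<gamma>. gauge \<gamma> \<and> (\<forall>\<D>. \<D> tagged_division_of cbox a b \<and> \<gamma> fine \<D> \<longrightarrow>
        norm ((\<Sum>(x,k)\<in>\<D>. measure lborel k *\<^sub>R g x) - (f b - f a)) < e)"
    proof (intro exI[of _ \<gamma>] conjI allI impI)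
      show "gauge \<gamma>" using d T by (auto simp: gauge_def \<gamma>_def)
      fix p assume p: "p tagged_division_of cbox a b \<and> \<gamma> fine p"
      then have pt: "p tagged_division_of {a..b}" by simp
      have finp: "finite p" using pt by auto
      have pk: "\<exists>u v. k = {u..v} \<and> u \<le> x \<and> x \<le> v \<and> Inf k = u \<and> Sup k = v \<and> x \<in> {a..b} \<and> k \<subseteq> {a..b} \<and> k \<subseteq> \<gamma> x" if xk: "(x,k) \<in> p" for x k
      proof -
        obtain u v where "k = cbox u v" using tagged_division_ofD(4)[OF pt xk] by blast
        moreover have "x \<in> k" "k \<subseteq> {a..b}" using tagged_division_ofD(2,3)[OF pt xk] by auto
        moreover have "k \<subseteq> \<gamma> x" using p xk by (auto simp: fine_def)
        ultimately show ?thesis by (intro exI[of _ u] exI[of _ v]) auto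
      qed
      let ?\<Delta> = "\<lambda>k. f (Sup k) - f (Inf k)"
      define p1 where "p1 = {(x,k)\<in>p. x \<in> N}"
      define p2 where "p2 = {(x,k)\<in>p. x \<in> Dom}"
      have split: "p = p1 \<union> p2" "p1 \<inter> p2 = {}" using pk by (fastforce simp: p1_def p2_def N_def)+
      have fin12: "finite p1" "finite p2" using finp split(1) by auto
      have "(\<Sum>(x,k)\<in>p. measure lborel k *\<^sub>R g x) - (f b - f a) = (\<Sum>(x,k)\<in>p. measure lborel k * g x - ?\<Delta> k)"
        using additive_tagged_division_1[OF ab pt, of f] by (simp add: sum_subtractf case_prod_unfold)
      also have "\<dots> = (\<Sum>(x,k)\<in>p1. measure lborel k * g x - ?\<Delta> k) + (\<Sum>(x,k)\<in>p2. measure lborel k * g x - ?\<Delta> k)"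
        unfolding split(1) using fin12 split(2) by (rule sum.union_disjoint)
      finally have eq: "norm ((\<Sum>(x,k)\<in>p. measure lborel k *\<^sub>R g x) - (f b - f a)) \<le>
          \<bar>\<Sum>(x,k)\<in>p1. measure lborel k * g x - ?\<Delta> k\<bar> + \<bar>\<Sum>(x,k)\<in>p2. measure lborel k * g x - ?\<Delta> k\<bar>"
        by simp
      have "\<bar>\<Sum>(x,k)\<in>p2. measure lborel k * g x - ?\<Delta> k\<bar> \<le> (\<Sum>(x,k)\<in>p2. e' * (Sup k - Inf k))"
      proof (rule order_trans[OF sum_abs], rule sum_mono, clarify)
        fix x k assume "(x,k) \<in> p2"
        then have xk: "(x,k) \<in> p" "x \<in> Dom" by (auto simp: p2_def)
        obtain u v where uv: "k = {u..v}" "u \<le> x" "x \<le> v" "Inf k = u" "Sup k = v" "k \<subseteq> \<gamma> x"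
          using pk[OF xk(1)] by blast
        have "\<bar>f v - f u - g x * (v - u)\<bar> \<le> e' * (v - u)"
          using dest[OF xk(2) uv(2,3)] uv(1,6) xk(2) by (simp add: \<gamma>_def)
        then show "\<bar>measure lborel k * g x - ?\<Delta> k\<bar> \<le> e' * (Sup k - Inf k)"
          using uv by (simp add: abs_minus_commute mult.commute)
      qed
      also have "\<dots> \<le> (\<Sum>(x,k)\<in>p. e' * (Sup k - Inf k))"
      proof (rule sum_mono2[OF finp])
        show "p2 \<subseteq> p" using split by auto
        fix b assume "b \<in> p - p2"
        then show "0 \<le> (case b of (x, k) \<Rightarrow> e' * (Sup k - Inf k))"
          using pk[of "fst b" "snd b"] e' by (auto simp: case_prod_unfold)
      qed
      also have "\<dots> = e' * (b - a)"
        using additive_tagged_division_1[OF ab pt, of "\<lambda>x. x"] by (simp add: sum_distrib_left[symmetric] case_prod_unfold)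
      finally have P2: "\<bar>\<Sum>(x,k)\<in>p2. measure lborel k * g x - ?\<Delta> k\<bar> \<le> e / 2" using e' by simp
      have t1: "p1 tagged_division_of \<Union>(snd ` p1)"
        by (rule tagged_partial_division_of_Union_self, rule tagged_partial_division_subset[of p "{a..b}"])
          (use pt split in \<open>auto simp: tagged_division_of_def\<close>)
      then have div1: "snd ` p1 division_of \<Union>(snd ` p1)" by (rule division_of_tagged_division)
      have sub1: "\<Union>(snd ` p1) \<subseteq> {a..b}" using pk split(1) by fastforce
      have subT: "\<Union>(snd ` p1) \<subseteq> T"
      proof
        fix y assume "y \<in> \<Union>(snd ` p1)"
        then obtain x k where "(x,k) \<in> p1" "y \<in> k" by auto
        then have "x \<in> N" "k \<subseteq> \<gamma> x" using pk by (auto simp: p1_def)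
        then show "y \<in> T" using \<open>y \<in> k\<close> by (auto simp: \<gamma>_def N_def)
      qed
      have "(\<Sum>k\<in>snd ` p1. Sup k - Inf k) = (\<Sum>k\<in>snd ` p1. measure lebesgue k)"
      proof (rule sum.cong[OF refl])
        fix k assume "k \<in> snd ` p1"
        then have "\<exists>x. (x,k) \<in> p" unfolding split(1) by auto
        then obtain x where "(x,k) \<in> p" ..
        then obtain u v where "k = {u..v}" "u \<le> v" using pk by (meson order_trans)
        then show "Sup k - Inf k = measure lebesgue k" by simp
      qed
      also have "\<dots> = measure lebesgue (\<Union>(snd ` p1))" by (rule content_division[OF div1])
      also have "\<dots> \<le> measure lebesgue T"
        using div1 subT T' by (intro measure_mono_fmeasurable fmeasurableD[OF lmeasurable_division])
      finally have "(\<Sum>k\<in>snd ` p1. Sup k - Inf k) < \<delta>" using T\<delta> by simp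
      then have S1: "(\<Sum>k\<in>snd ` p1. \<bar>?\<Delta> k\<bar>) < e / 2" using small[OF div1 sub1] by simp
      have "\<bar>\<Sum>(x,k)\<in>p1. measure lborel k * g x - ?\<Delta> k\<bar> \<le> (\<Sum>(x,k)\<in>p1. \<bar>?\<Delta> k\<bar>)"
        by (rule order_trans[OF sum_abs], rule sum_mono) (auto simp: p1_def g_def N_def)
      also have "\<dots> = (\<Sum>(x,k)\<in>p1. if k = {} then 0 else \<bar>?\<Delta> k\<bar>)"
      proof (rule sum.cong[OF refl])
        fix y assume "y \<in> p1"
        moreover have "k \<noteq> {}" if "(x,k) \<in> p1" for x k using tagged_division_ofD(2)[OF t1 that] by auto
        ultimately show "(case y of (x,k) \<Rightarrow> \<bar>?\<Delta> k\<bar>) = (case y of (x,k) \<Rightarrow> if k = {} then 0 else \<bar>?\<Delta> k\<bar>)"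
          by (cases y) auto
      qed
      also have "\<dots> = (\<Sum>k\<in>snd ` p1. if k = {} then 0 else \<bar>?\<Delta> k\<bar>)"
        by (rule sum.over_tagged_division_lemma[OF t1]) (auto simp: not_less)
      also have "\<dots> \<le> (\<Sum>k\<in>snd ` p1. \<bar>?\<Delta> k\<bar>)"
        by (rule sum_mono) simp
      finally show "norm ((\<Sum>(x,k)\<in>p. measure lborel k *\<^sub>R g x) - (f b - f a)) < e"
        using eq P2 S1 by linarith
    qed
  qed
  moreover have "g = (\<lambda>x. if x \<in> {a<..<b} \<and> f differentiable at x then deriv f x else 0)"
    by (auto simp: g_def Dom_def)
  ultimately show ?thesis by simp
qed


text \<open>
  The form that is used on lines: \<open>h\<close> is a Borel representative of \<open>\<bar>deriv f\<bar>\<close>, and the integral may be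
  infinite.
\<close>

lemma absolutely_continuous_increment_le:
  assumes ac: "absolutely_continuous_on {a..b} f" and s: "s \<in> {a..b}" and t: "t \<in> {a..b}"
    and h: "h \<in> borel_measurable borel" and h0: "\<And>x. h x \<ge> 0"
    and hd: "AE x in lborel. h x = \<bar>deriv f x\<bar>"
  shows "ennreal \<bar>f t - f s\<bar> \<le> (\<integral>\<^sup>+x. ennreal (h x) * indicator {a..b} x \<partial>lborel)"
proof -
  have main: "ennreal \<bar>f t - f s\<bar> \<le> (\<integral>\<^sup>+x. ennreal (h x) * indicator {a..b} x \<partial>lborel)"
    if s: "s \<in> {a..b}" and t: "t \<in> {a..b}" and st: "s \<le> t" for s t
  proof (cases "(\<integral>\<^sup>+x. ennreal (h x) * indicator {a..b} x \<partial>lborel) = \<infinity>")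
    case False
    define k where "k x = h x * indicator {a..b} x" for x
    have kint: "integrable lborel k"
    proof (rule integrableI_bounded)
      show "k \<in> borel_measurable lborel" unfolding k_def[abs_def] using h by simp
      have "(\<integral>\<^sup>+x. ennreal (norm (k x)) \<partial>lborel) = (\<integral>\<^sup>+x. ennreal (h x) * indicator {a..b} x \<partial>lborel)"
        by (intro nn_integral_cong) (use h0 in \<open>auto simp: k_def indicator_def\<close>)
      then show "(\<integral>\<^sup>+x. ennreal (norm (k x)) \<partial>lborel) < \<infinity>" using False by (simp add: less_top)
    qed
    have k0: "k x \<ge> 0" for x using h0 by (simp add: k_def)
    have kU: "(k has_integral integral\<^sup>L lborel k) UNIV" by (rule has_integral_integral_lborel[OF kint])
    then have kUo: "k integrable_on UNIV" by blast
    then have kst: "k integrable_on {s..t}"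
      using integrable_on_subcbox[of k UNIV s t] by simp
    define g where "g x = (if x \<in> {s<..<t} \<and> f differentiable at x then deriv f x else 0)" for x
    have ac': "absolutely_continuous_on {s..t} f"
      by (rule absolutely_continuous_on_subset[OF ac]) (use s t in auto)
    have g: "(g has_integral (f t - f s)) {s..t}"
      unfolding g_def by (rule absolutely_continuous_has_integral[OF ac' st])
    obtain M where M: "negligible M" "\<And>x. x \<notin> M \<Longrightarrow> h x = \<bar>deriv f x\<bar>"
    proof -
      have "AE x in lebesgue. h x = \<bar>deriv f x\<bar>" using hd by (rule AE_completion)
      then obtain M where "M \<in> null_sets lebesgue" "{x. h x \<noteq> \<bar>deriv f x\<bar>} \<subseteq> M"
        by (auto simp: eventually_ae_filter)
      then show ?thesis using that[of M] by (auto simp: negligible_iff_null_sets)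
    qed
    \<comment> \<open>outside the null set \<open>M\<close> the function \<open>k\<close> is \<open>\<bar>deriv f\<bar>\<close> and dominates \<open>g\<close>; on \<open>M\<close> it is changed so as to dominate \<open>g\<close> there too\<close>
    define k' where "k' x = (if x \<in> M then \<bar>g x\<bar> else k x)" for x
    have k'i: "(k' has_integral integral {s..t} k) {s..t}"
      by (rule has_integral_spike[OF M(1) _ integrable_integral[OF kst]]) (auto simp: k'_def)
    have "norm (f t - f s) \<le> integral {s..t} k"
    proof -
      have "norm (integral {s..t} g) \<le> integral {s..t} k'"
      proof (rule integral_norm_bound_integral)
        show "g integrable_on {s..t}" using g by blast
        show "k' integrable_on {s..t}" using k'i by blast
        fix x assume "x \<in> {s..t}"
        then show "norm (g x) \<le> k' x"
          using s t M(2)[of x] k0[of x] by (auto simp: k'_def g_def k_def)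
      qed
      then show ?thesis using g k'i by (simp add: integral_unique)
    qed
    also have "integral {s..t} k \<le> integral UNIV k"
      by (rule integral_subset_le) (use kst kUo k0 in auto)
    also have "integral UNIV k = integral\<^sup>L lborel k" using kU by (rule integral_unique)
    finally have "ennreal \<bar>f t - f s\<bar> \<le> ennreal (integral\<^sup>L lborel k)" by (intro ennreal_leI) simp
    also have "\<dots> = (\<integral>\<^sup>+x. ennreal (k x) \<partial>lborel)"
      using kint k0 by (simp add: nn_integral_eq_integral)
    also have "\<dots> = (\<integral>\<^sup>+x. ennreal (h x) * indicator {a..b} x \<partial>lborel)"
      by (intro nn_integral_cong) (auto simp: k_def indicator_def)
    finally show ?thesis .
  qed simp
  show ?thesis
  proof (cases "s \<le> t")
    case True
    then show ?thesis using main s t by blast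
  next
    case False
    then show ?thesis using main[of t s] s t by (simp add: abs_minus_commute)
  qed
qed

section \<open>Integration along lines parallel to an axis\<close>

text \<open>
  The point with coordinate \<open>t\<close> in direction \<open>i\<close> on the line over \<open>z\<close>, written as in the definition of
  \<^const>\<open>ACL\<close>.
\<close>

definition join_coord :: "'a::euclidean_space \<Rightarrow> ('a \<Rightarrow> real) \<Rightarrow> real \<Rightarrow> 'a" where
  "join_coord i z t = (\<Sum>j\<in>Basis - {i}. z j *\<^sub>R j) + t *\<^sub>R i"

lemma join_coord_inner:
  assumes "i \<in> Basis" "j \<in> Basis"
  shows "join_coord i z t \<bullet> j = (if j = i then t else z j)"
proof -
  have "(\<Sum>k\<in>Basis - {i}. z k *\<^sub>R k) \<bullet> j = (\<Sum>k\<in>Basis - {i}. if k = j then z k else 0)"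
    unfolding inner_sum_left by (intro sum.cong) (use assms in \<open>auto simp: inner_Basis\<close>)
  also have "\<dots> = (if j = i then 0 else z j)"
    using assms by (auto simp: sum.delta)
  finally show ?thesis using assms
    by (auto simp: join_coord_def inner_add_left inner_Basis)
qed

lemma join_coord_in_cbox:
  assumes "i \<in> Basis"
  shows "join_coord i z t \<in> cbox a b \<longleftrightarrow>
    (\<forall>j\<in>Basis - {i}. z j \<in> {a \<bullet> j..b \<bullet> j}) \<and> t \<in> {a \<bullet> i..b \<bullet> i}"
  using assms by (auto simp: mem_box join_coord_inner)

lemma join_coord_measurable [measurable]:
  "case_prod (join_coord i) \<in> borel_measurable ((\<Pi>\<^sub>M j\<in>Basis - {i}. lborel) \<Otimes>\<^sub>M lborel)"
proof -
  have "(\<lambda>p. fst p j) \<in> borel_measurable ((\<Pi>\<^sub>M j\<in>Basis - {i}. lborel :: real measure) \<Otimes>\<^sub>M (lborel :: real measure))"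
    if "j \<in> Basis - {i}" for j
  proof -
    have "(\<lambda>x. x j) \<circ> fst \<in> measurable ((\<Pi>\<^sub>M j\<in>Basis - {i}. lborel :: real measure) \<Otimes>\<^sub>M (lborel :: real measure)) lborel"
      by (rule measurable_comp[OF measurable_fst measurable_component_singleton[OF that]])
    then show ?thesis by (simp add: o_def)
  qed
  then show ?thesis
    unfolding join_coord_def case_prod_unfold
    by (intro borel_measurable_add borel_measurable_sum borel_measurable_scaleR) auto
qed

lemma join_coord_measurable_right [measurable]: "join_coord i z \<in> borel_measurable borel"
  unfolding join_coord_def by (intro borel_measurable_add borel_measurable_scaleR) auto

lemma lborel_split_sum:
  assumes "i \<in> Basis"
  shows "(\<Sum>b\<in>Basis. (z(i := t)) b *\<^sub>R b) = join_coord i z t"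
proof -
  have "(\<Sum>b\<in>Basis. (z(i := t)) b *\<^sub>R b) = t *\<^sub>R i + (\<Sum>b\<in>Basis - {i}. (z(i := t)) b *\<^sub>R b)"
    by (subst sum.remove[OF finite_Basis assms]) simp
  also have "(\<Sum>b\<in>Basis - {i}. (z(i := t)) b *\<^sub>R b) = (\<Sum>b\<in>Basis - {i}. z b *\<^sub>R b)"
    by (intro sum.cong) auto
  finally show ?thesis by (simp add: join_coord_def add.commute)
qed

lemma nn_integral_lborel_as_product:
  fixes i :: "'a::euclidean_space" and F :: "'a \<Rightarrow> ennreal"
  assumes i: "i \<in> Basis" and F: "F \<in> borel_measurable borel"
  shows "(\<integral>\<^sup>+x. F x \<partial>(lborel :: 'a measure)) = (\<integral>\<^sup>+f. F (\<Sum>b\<in>Basis. f b *\<^sub>R b) \<partial>(\<Pi>\<^sub>M b\<in>insert i (Basis - {i}). lborel))"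
proof -
  have ins: "insert i (Basis - {i}) = (Basis :: 'a set)" using i by auto
  show ?thesis unfolding ins
    by (subst lborel_eq, subst nn_integral_distr) (use F in auto)
qed

lemma nn_integral_lborel_coordinate:
  fixes i :: "'a::euclidean_space"
  assumes i: "i \<in> Basis" and F: "F \<in> borel_measurable borel"
  shows "(\<integral>\<^sup>+x. F x \<partial>lborel) =
    (\<integral>\<^sup>+z. (\<integral>\<^sup>+t. F (join_coord i z t) \<partial>lborel) \<partial>(\<Pi>\<^sub>M j\<in>Basis - {i}. lborel))"
proof -
  interpret product_sigma_finite "\<lambda>_::'a. lborel :: real measure" by standard
  have ins: "insert i (Basis - {i}) = (Basis :: 'a set)" using i by auto
  have "(\<integral>\<^sup>+x. F x \<partial>lborel) = (\<integral>\<^sup>+f. F (\<Sum>b\<in>Basis. f b *\<^sub>R b) \<partial>(\<Pi>\<^sub>M b\<in>insert i (Basis - {i}). lborel))"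
    using nn_integral_lborel_as_product[OF i F] .
  also have "\<dots> = (\<integral>\<^sup>+z. (\<integral>\<^sup>+t. F (\<Sum>b\<in>Basis. (z(i := t)) b *\<^sub>R b) \<partial>lborel) \<partial>(\<Pi>\<^sub>M j\<in>Basis - {i}. lborel))"
    by (rule product_nn_integral_insert) (use F in \<open>auto simp: ins\<close>)
  finally show ?thesis unfolding lborel_split_sum[OF i] .
qed

lemma integral_lborel_coordinate:
  fixes i :: "'a::euclidean_space" and F :: "'a \<Rightarrow> real"
  assumes i: "i \<in> Basis" and F: "integrable lborel F"
  shows "(\<integral>x. F x \<partial>lborel) =
    (\<integral>z. (\<integral>t. F (join_coord i z t) \<partial>lborel) \<partial>(\<Pi>\<^sub>M j\<in>Basis - {i}. lborel))"
proof -
  interpret product_sigma_finite "\<lambda>_::'a. lborel :: real measure" by standard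
  have ins: "insert i (Basis - {i}) = (Basis :: 'a set)" using i by auto
  have Fm: "F \<in> borel_measurable borel" using F by auto
  have meas: "(\<lambda>f. \<Sum>b\<in>Basis. f b *\<^sub>R b) \<in> measurable (\<Pi>\<^sub>M b\<in>Basis. (lborel :: real measure)) (borel :: 'a measure)"
    by measurable
  have "(\<integral>x. F x \<partial>lborel) = (\<integral>f. F (\<Sum>b\<in>Basis. f b *\<^sub>R b) \<partial>(\<Pi>\<^sub>M b\<in>Basis. lborel))"
    by (subst lborel_eq, subst integral_distr[OF meas Fm]) simp
  also have "\<dots> = (\<integral>f. F (\<Sum>b\<in>Basis. f b *\<^sub>R b) \<partial>(\<Pi>\<^sub>M b\<in>insert i (Basis - {i}). lborel))"
    unfolding ins ..
  also have "\<dots> = (\<integral>z. (\<integral>t. F (\<Sum>b\<in>Basis. (z(i := t)) b *\<^sub>R b) \<partial>lborel) \<partial>(\<Pi>\<^sub>M j\<in>Basis - {i}. lborel))"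
  proof (rule product_integral_insert)
    show "integrable (\<Pi>\<^sub>M b\<in>insert i (Basis - {i}). lborel) (\<lambda>f. F (\<Sum>b\<in>Basis. f b *\<^sub>R b))"
      unfolding ins using F integrable_distr_eq[OF meas Fm] by (simp add: lborel_eq[symmetric])
  qed auto
  finally show ?thesis unfolding lborel_split_sum[OF i] .
qed

text \<open>
  Fubini for null sets.
\<close>

lemma AE_lborel_coordinate:
  fixes i :: "'a::euclidean_space"
  assumes i: "i \<in> Basis" and P: "AE x in (lborel :: 'a measure). P x"
  shows "AE z in (\<Pi>\<^sub>M j\<in>Basis - {i}. lborel). AE t in lborel. P (join_coord i z t)"
proof -
  obtain N :: "'a set" where N: "N \<in> null_sets lborel" "\<And>x. x \<notin> N \<Longrightarrow> P x"
    using P by (auto simp: eventually_ae_filter)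
  have [measurable]: "N \<in> sets borel" using N(1) by auto
  let ?M = "\<Pi>\<^sub>M j\<in>Basis - {i}. (lborel :: real measure)"
  have Nm[measurable]: "(indicator N :: 'a \<Rightarrow> ennreal) \<in> borel_measurable borel" by simp
  have comp: "(\<lambda>p. indicator N (case_prod (join_coord i) p) :: ennreal) \<in> borel_measurable (?M \<Otimes>\<^sub>M lborel)"
    by measurable
  have meas: "(\<lambda>z. \<integral>\<^sup>+t. indicator N (join_coord i z t) \<partial>lborel) \<in> borel_measurable ?M"
    by (rule sigma_finite_measure.borel_measurable_nn_integral[OF sigma_finite_lborel])
      (use comp in \<open>simp add: case_prod_unfold\<close>)
  have "(\<integral>\<^sup>+z. (\<integral>\<^sup>+t. indicator N (join_coord i z t) \<partial>lborel) \<partial>?M) = (\<integral>\<^sup>+x. indicator N x \<partial>lborel)"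
    by (rule nn_integral_lborel_coordinate[OF i, symmetric]) simp
  also have "\<dots> = 0" using N(1) by auto
  finally have "AE z in ?M. (\<integral>\<^sup>+t. indicator N (join_coord i z t) \<partial>lborel) = 0"
    using nn_integral_0_iff_AE[OF meas] by auto
  then show ?thesis
  proof eventually_elim
    case (elim z)
    then have "AE t in lborel. (indicator N (join_coord i z t) :: ennreal) = 0"
      by (subst (asm) nn_integral_0_iff_AE) auto
    then show ?case by eventually_elim (use N(2) in \<open>auto simp: indicator_def split: if_splits\<close>)
  qed
qed

lemma partial_deriv_join_coord:
  "partial_deriv i u (join_coord i z t) = deriv (\<lambda>t. u (join_coord i z t)) t"
proof -
  have "(\<lambda>s. u (join_coord i z t + s *\<^sub>R i)) = (\<lambda>s. u (join_coord i z (t + s)))"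
    by (simp add: join_coord_def algebra_simps)
  moreover have "((\<lambda>s. u (join_coord i z (t + s))) has_field_derivative D) (at 0) \<longleftrightarrow>
      ((\<lambda>t. u (join_coord i z t)) has_field_derivative D) (at t)" for D
    using DERIV_shift[of "\<lambda>t. u (join_coord i z t)" D 0 t] by (simp add: add.commute)
  ultimately show ?thesis unfolding partial_deriv_def deriv_def by simp
qed

text \<open>
  For functions that are not integrable the left side is zero by convention.
\<close>

lemma ennreal_abs_integral_le:
  fixes f :: "'b \<Rightarrow> real"
  shows "ennreal \<bar>\<integral>x. f x \<partial>M\<bar> \<le> (\<integral>\<^sup>+x. ennreal \<bar>f x\<bar> \<partial>M)"
proof (cases "integrable M f")
  case True
  then show ?thesis using integral_norm_bound_ennreal[of M f] by simp
qed (simp add: not_integrable_integral_eq)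

text \<open>
  The weight has mean zero in direction \<open>i\<close>, so on each line in this direction \<open>u\<close> may be replaced by its
  increment from the face of the box. On almost every line this increment is at most the integral
  of \<open>h\<close> over the part of the line in the box. Fubini's theorem collects the lines. A weight that is the difference of two
  normalised indicator functions compares two averages of \<open>u\<close>.
\<close>

lemma weighted_coordinate_integral_le:
  fixes u :: "'a::euclidean_space \<Rightarrow> real"
  assumes acl: "ACL u" and i: "i \<in> Basis"
    and h: "h \<in> borel_measurable borel" and h0: "\<And>x. h x \<ge> 0"
    and hd: "AE x in lborel. h x = \<bar>partial_deriv i u x\<bar>"
    and w: "w \<in> borel_measurable borel" and wB: "\<And>t. \<bar>w t\<bar> \<le> B"
    and w0: "(\<integral>t. indicator {a \<bullet> i..b \<bullet> i} t * w t \<partial>lborel) = 0"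
  shows "ennreal \<bar>\<integral>x. indicator (cbox a b) x * (u x * w (x \<bullet> i)) \<partial>lborel\<bar> \<le>
    (\<integral>\<^sup>+t. indicator {a \<bullet> i..b \<bullet> i} t * ennreal \<bar>w t\<bar> \<partial>lborel) *
    (\<integral>\<^sup>+x. ennreal (h x) * indicator (cbox a b) x \<partial>lborel)"
proof -
  let ?M = "\<Pi>\<^sub>M j\<in>Basis - {i}. (lborel :: real measure)"
  let ?I = "{a \<bullet> i..b \<bullet> i}"
  have cont: "continuous_on UNIV u" using acl by (simp add: ACL_def)
  have um[measurable]: "u \<in> borel_measurable borel" using cont by (rule borel_measurable_continuous_onI)
  note [measurable] = h w
  have "compact (u ` cbox a b)" using cont by (intro compact_continuous_image continuous_on_subset[OF cont]) auto
  then obtain U where U: "\<And>x. x \<in> cbox a b \<Longrightarrow> \<bar>u x\<bar> \<le> U"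
    using compact_imp_bounded bounded_iff by (metis imageI real_norm_def)
  define F where "F x = indicator (cbox a b) x * (u x * w (x \<bullet> i))" for x
  have Fm[measurable]: "F \<in> borel_measurable borel" unfolding F_def[abs_def] by measurable
  have FB: "\<bar>F x\<bar> \<le> \<bar>U\<bar> * B * indicator (cbox a b) x" for x
  proof (cases "x \<in> cbox a b")
    case True
    then have "\<bar>u x\<bar> \<le> \<bar>U\<bar>" using U[of x] by linarith
    then have "\<bar>u x\<bar> * \<bar>w (x \<bullet> i)\<bar> \<le> \<bar>U\<bar> * B" using wB by (intro mult_mono) auto
    then show ?thesis using True by (simp add: F_def abs_mult)
  qed (simp add: F_def)
  have Fint: "integrable lborel F"
  proof (rule Bochner_Integration.integrable_bound)
    show "integrable lborel (\<lambda>x. \<bar>U\<bar> * B * indicator (cbox a b) x)"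
      by (intro integrable_mult_right integrable_real_indicator) (use emeasure_bounded_finite[OF bounded_cbox] in auto)
    show "AE x in lborel. norm (F x) \<le> norm (\<bar>U\<bar> * B * indicator (cbox a b) x)"
      using FB by (intro AE_I2) (metis abs_ge_self order_trans real_norm_def)
  qed simp
  define \<Phi> where "\<Phi> z = (\<integral>t. F (join_coord i z t) \<partial>lborel)" for z
  define H where "H z = (\<integral>\<^sup>+t. ennreal (h (join_coord i z t)) * indicator (cbox a b) (join_coord i z t) \<partial>lborel)" for z
  define W where "W = (\<integral>\<^sup>+t. indicator ?I t * ennreal \<bar>w t\<bar> \<partial>lborel)"
  have acl_ae: "AE z in ?M. (\<forall>j\<in>Basis - {i}. z j \<in> {a \<bullet> j..b \<bullet> j}) \<longrightarrow>
      absolutely_continuous_on ?I (\<lambda>t. u (join_coord i z t))"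
    using acl i unfolding ACL_def join_coord_def by blast
  have "AE z in ?M. ennreal \<bar>\<Phi> z\<bar> \<le> W * H z"
    using acl_ae AE_lborel_coordinate[OF i hd]
  proof eventually_elim
    case (elim z)
    show ?case
    proof (cases "\<forall>j\<in>Basis - {i}. z j \<in> {a \<bullet> j..b \<bullet> j}")
      case False
      then have "F (join_coord i z t) = 0" for t by (simp add: F_def join_coord_in_cbox[OF i])
      then show ?thesis by (simp add: \<Phi>_def)
    next
      case True
      define \<phi> where "\<phi> t = u (join_coord i z t)" for t
      have \<phi>m[measurable]: "\<phi> \<in> borel_measurable borel" unfolding \<phi>_def[abs_def] by measurable
      have ind: "indicator (cbox a b) (join_coord i z t) = (indicator ?I t :: real)"
        "indicator (cbox a b) (join_coord i z t) = (indicator ?I t :: ennreal)" for t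
        using True by (auto simp: indicator_def join_coord_in_cbox[OF i])
      have ac: "absolutely_continuous_on ?I \<phi>" using elim(1) True by (simp add: \<phi>_def[abs_def])
      have Hz: "H z = (\<integral>\<^sup>+t. ennreal (h (join_coord i z t)) * indicator ?I t \<partial>lborel)"
        unfolding H_def ind ..
      have inc: "ennreal \<bar>\<phi> t - \<phi> (a \<bullet> i)\<bar> \<le> H z" if "t \<in> ?I" for t
        unfolding Hz
      proof (rule absolutely_continuous_increment_le[OF ac])
        show "(\<lambda>t. h (join_coord i z t)) \<in> borel_measurable borel" by measurable
        show "AE t in lborel. h (join_coord i z t) = \<bar>deriv \<phi> t\<bar>"
          using elim(2) unfolding partial_deriv_join_coord \<phi>_def[abs_def] .
      qed (use that h0 in auto)
      have wint: "integrable lborel (\<lambda>t. indicator ?I t * w t)"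
      proof (rule Bochner_Integration.integrable_bound)
        show "integrable lborel (\<lambda>t. B * indicator ?I t)"
          by (intro integrable_mult_right integrable_real_indicator)
            (use emeasure_bounded_finite[OF bounded_closed_interval] in auto)
        show "AE t in lborel. norm (indicator ?I t * w t) \<le> norm (B * indicator ?I t)"
          using wB by (intro AE_I2) (auto simp: indicator_def intro: order_trans[OF _ abs_ge_self])
      qed simp
      have Ft: "F (join_coord i z t) = indicator ?I t * (\<phi> t * w t)" for t
        using i by (simp add: F_def ind \<phi>_def join_coord_inner)
      have ub: "\<bar>\<phi> t\<bar> \<le> U" if "t \<in> ?I" for t
        using U[of "join_coord i z t"] True that by (simp add: \<phi>_def join_coord_in_cbox[OF i])
      have Fzint: "integrable lborel (\<lambda>t. indicator ?I t * (\<phi> t * w t))"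
      proof (rule Bochner_Integration.integrable_bound)
        show "integrable lborel (\<lambda>t. \<bar>U\<bar> * B * indicator ?I t)"
          by (intro integrable_mult_right integrable_real_indicator)
            (use emeasure_bounded_finite[OF bounded_closed_interval] in auto)
        have "\<bar>\<phi> t * w t\<bar> \<le> \<bar>\<bar>U\<bar> * B\<bar>" if "t \<in> ?I" for t
        proof -
          have "\<bar>\<phi> t\<bar> * \<bar>w t\<bar> \<le> \<bar>U\<bar> * B" using wB ub[OF that] by (intro mult_mono) auto
          then show ?thesis unfolding abs_mult[of "\<phi> t"] by linarith
        qed
        then show "AE t in lborel. norm (indicator ?I t * (\<phi> t * w t)) \<le> norm (\<bar>U\<bar> * B * indicator ?I t)"
          by (intro AE_I2) (auto simp: indicator_def)
      qed simp
      have "\<Phi> z = (\<integral>t. indicator ?I t * (\<phi> t * w t) \<partial>lborel) - \<phi> (a \<bullet> i) * (\<integral>t. indicator ?I t * w t \<partial>lborel)"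
        unfolding \<Phi>_def Ft using w0 by simp
      also have "\<dots> = (\<integral>t. indicator ?I t * ((\<phi> t - \<phi> (a \<bullet> i)) * w t) \<partial>lborel)"
      proof -
        have "(\<integral>t. indicator ?I t * (\<phi> t * w t) \<partial>lborel) - \<phi> (a \<bullet> i) * (\<integral>t. indicator ?I t * w t \<partial>lborel)
          = (\<integral>t. indicator ?I t * (\<phi> t * w t) \<partial>lborel) - (\<integral>t. \<phi> (a \<bullet> i) * (indicator ?I t * w t) \<partial>lborel)"
          by simp
        also have "\<dots> = (\<integral>t. indicator ?I t * (\<phi> t * w t) - \<phi> (a \<bullet> i) * (indicator ?I t * w t) \<partial>lborel)"
          using Fzint wint by (intro Bochner_Integration.integral_diff[symmetric] integrable_mult_right)
        finally show ?thesis by (simp only: left_diff_distrib right_diff_distrib mult.left_commute)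
      qed
      finally have "ennreal \<bar>\<Phi> z\<bar> \<le> (\<integral>\<^sup>+t. ennreal \<bar>indicator ?I t * ((\<phi> t - \<phi> (a \<bullet> i)) * w t)\<bar> \<partial>lborel)"
        using ennreal_abs_integral_le by metis
      also have "\<dots> \<le> (\<integral>\<^sup>+t. (indicator ?I t * ennreal \<bar>w t\<bar>) * H z \<partial>lborel)"
      proof (rule nn_integral_mono)
        fix t
        show "ennreal \<bar>indicator ?I t * ((\<phi> t - \<phi> (a \<bullet> i)) * w t)\<bar> \<le> (indicator ?I t * ennreal \<bar>w t\<bar>) * H z"
        proof (cases "t \<in> ?I")
          case True
          have "ennreal \<bar>(\<phi> t - \<phi> (a \<bullet> i)) * w t\<bar> = ennreal \<bar>w t\<bar> * ennreal \<bar>\<phi> t - \<phi> (a \<bullet> i)\<bar>"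
            by (simp add: abs_mult ennreal_mult mult.commute)
          also have "\<dots> \<le> ennreal \<bar>w t\<bar> * H z" by (intro mult_left_mono inc True) simp
          finally show ?thesis using True by simp
        qed simp
      qed
      also have "\<dots> = W * H z" unfolding W_def by (rule nn_integral_multc) simp
      finally show ?thesis .
    qed
  qed
  then have "(\<integral>\<^sup>+z. ennreal \<bar>\<Phi> z\<bar> \<partial>?M) \<le> (\<integral>\<^sup>+z. W * H z \<partial>?M)"
    by (rule nn_integral_mono_AE)
  also have "\<dots> = W * (\<integral>\<^sup>+z. H z \<partial>?M)"
  proof (rule nn_integral_cmult)
    have "(\<lambda>p. ennreal (h (case_prod (join_coord i) p)) * indicator (cbox a b) (case_prod (join_coord i) p)) \<in> borel_measurable (?M \<Otimes>\<^sub>M lborel)"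
      by measurable
    then show "H \<in> borel_measurable ?M" unfolding H_def[abs_def]
      by (intro sigma_finite_measure.borel_measurable_nn_integral[OF sigma_finite_lborel])
        (simp add: case_prod_unfold)
  qed
  also have "(\<integral>\<^sup>+z. H z \<partial>?M) = (\<integral>\<^sup>+x. ennreal (h x) * indicator (cbox a b) x \<partial>lborel)"
    unfolding H_def by (rule nn_integral_lborel_coordinate[OF i, symmetric]) measurable
  finally have "(\<integral>\<^sup>+z. ennreal \<bar>\<Phi> z\<bar> \<partial>?M) \<le> W * (\<integral>\<^sup>+x. ennreal (h x) * indicator (cbox a b) x \<partial>lborel)" .
  moreover have "(\<integral>x. F x \<partial>lborel) = (\<integral>z. \<Phi> z \<partial>?M)"
    unfolding \<Phi>_def by (rule integral_lborel_coordinate[OF i Fint])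
  moreover have "ennreal \<bar>\<integral>z. \<Phi> z \<partial>?M\<bar> \<le> (\<integral>\<^sup>+z. ennreal \<bar>\<Phi> z\<bar> \<partial>?M)"
    by (rule ennreal_abs_integral_le)
  ultimately have "ennreal \<bar>\<integral>x. F x \<partial>lborel\<bar> \<le> W * (\<integral>\<^sup>+x. ennreal (h x) * indicator (cbox a b) x \<partial>lborel)"
    by simp
  then show ?thesis by (simp only: F_def W_def)
qed

section \<open>A Poincare inequality for boxes\<close>

text \<open>
  Young's inequality in a crude form. With a suitable \<open>\<tau>\<close> it takes the place of Hoelder's inequality.
\<close>

lemma young_power:
  fixes v \<tau> :: real
  assumes "v \<ge> 0" "\<tau> > 0"
  shows "v \<le> \<tau> + v ^ Suc m / \<tau> ^ m"
proof (cases "v \<le> \<tau>")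
  case True
  have "0 \<le> v ^ Suc m / \<tau> ^ m" using assms by simp
  then show ?thesis using True by linarith
next
  case False
  then have "\<tau> ^ m \<le> v ^ m" using assms by (intro power_mono) auto
  then have "v * \<tau> ^ m \<le> v * v ^ m" using assms by (intro mult_left_mono)
  then have "v \<le> v ^ Suc m / \<tau> ^ m" using assms by (simp add: pos_le_divide_eq)
  then show ?thesis using assms by linarith
qed

text \<open>
  The constant of the Poincare inequality in dimension \<open>n\<close>, for a box with sides at least \<open>\<kappa> * l\<close>
  inside a box with sides at most \<open>l\<close>.
\<close>

definition osc_const :: "nat \<Rightarrow> real \<Rightarrow> real" where
  "osc_const n \<kappa> = 4 * n / \<kappa> ^ (n - 1)"

text \<open>
  Admissible functions of infinite energy satisfy every lower bound, so \<open>u\<close> may be assumed to have finite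
  energy.
\<close>

locale finite_energy =
  fixes u :: "'a::euclidean_space \<Rightarrow> real"
  assumes ACLn: "ACLn u"
    and energy_integrable: "integrable lebesgue (\<lambda>x. norm (grad u x) ^ DIM('a))"
begin

definition energy :: "'a set \<Rightarrow> real" where
  "energy S = (\<integral>x. indicator S x * norm (grad u x) ^ DIM('a) \<partial>lebesgue)"

definition avg :: "'a \<Rightarrow> 'a \<Rightarrow> real" where
  "avg a b = (\<integral>x. indicator (cbox a b) x * u x \<partial>lborel) / measure lborel (cbox a b)"

lemma continuous_u: "continuous_on UNIV u"
  using ACLn by (simp add: ACLn_def ACL_def)

lemma energy_piece_integrable:
  "S \<in> sets lebesgue \<Longrightarrow> integrable lebesgue (\<lambda>x. indicator S x * norm (grad u x) ^ DIM('a))"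
  using integrable_mult_indicator[OF _ energy_integrable, of S] by simp

lemma energy_nonneg: "energy S \<ge> 0"
  unfolding energy_def by (intro integral_nonneg_AE AE_I2) auto

lemma energy_mono: "S \<in> sets lebesgue \<Longrightarrow> T \<in> sets lebesgue \<Longrightarrow> S \<subseteq> T \<Longrightarrow> energy S \<le> energy T"
  unfolding energy_def
  by (intro integral_mono energy_piece_integrable) (auto simp: indicator_def)

lemma energy_disjoint_Un:
  assumes "S \<in> sets lebesgue" "T \<in> sets lebesgue" "S \<inter> T = {}"
  shows "energy (S \<union> T) = energy S + energy T"
proof -
  have "energy (S \<union> T) = (\<integral>x. indicator S x * norm (grad u x) ^ DIM('a) + indicator T x * norm (grad u x) ^ DIM('a) \<partial>lebesgue)"
    unfolding energy_def by (intro Bochner_Integration.integral_cong) (use assms(3) in \<open>auto simp: indicator_def\<close>)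
  also have "\<dots> = energy S + energy T"
    unfolding energy_def by (intro Bochner_Integration.integral_add energy_piece_integrable assms)
  finally show ?thesis .
qed

lemma partial_deriv_le_grad: "i \<in> Basis \<Longrightarrow> \<bar>partial_deriv i u x\<bar> \<le> norm (grad u x)"
proof -
  assume i: "i \<in> Basis"
  have "grad u x \<bullet> i = partial_deriv i u x"
    using i by (simp add: grad_def)
  then show ?thesis using Basis_le_norm[OF i, of "grad u x"] by simp
qed

lemma obtain_partial_deriv_borel:
  assumes i: "i \<in> Basis"
  obtains h where "h \<in> borel_measurable borel" "\<And>x. h x \<ge> 0" "AE x in lborel. h x = \<bar>partial_deriv i u x\<bar>"
proof -
  have "partial_deriv i u \<in> borel_measurable (completion lborel)"
    using ACLn i by (simp add: ACLn_def)
  then obtain g where g: "g \<in> borel_measurable lborel" "AE x in lborel. partial_deriv i u x = g x"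
    using completion_ex_borel_measurable_real by blast
  show ?thesis
  proof (rule that[of "\<lambda>x. \<bar>g x\<bar>"])
    show "AE x in lborel. \<bar>g x\<bar> = \<bar>partial_deriv i u x\<bar>" using g(2) by eventually_elim simp
  qed (use g(1) in auto)
qed

text \<open>
  Energy bounds are stated with \<open>\<rho> ^ n\<close> instead of taking roots of the energy. The choice
  \<open>\<tau> = \<rho> / l\<close> balances the two terms of Young's inequality.
\<close>

lemma partial_deriv_L1_le:
  assumes i: "i \<in> Basis" and hm: "h \<in> borel_measurable borel"
    and hd: "AE x in lborel. h x = \<bar>partial_deriv i u x\<bar>"
    and l: "l > 0" and \<rho>: "\<rho> > 0"
    and sides: "\<And>j. j \<in> Basis \<Longrightarrow> a \<bullet> j \<le> b \<bullet> j \<and> b \<bullet> j - a \<bullet> j \<le> l"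
    and E: "energy (cbox a b) \<le> \<rho> ^ DIM('a)"
  shows "(\<integral>\<^sup>+x. ennreal (h x) * indicator (cbox a b) x \<partial>lborel) \<le> ennreal (2 * \<rho> * l ^ (DIM('a) - 1))"
proof -
  define m where "m = DIM('a) - 1"
  have N: "DIM('a) = Suc m" using DIM_positive[where 'a='a] by (simp add: m_def)
  define \<tau> where "\<tau> = \<rho> / l"
  have \<tau>: "\<tau> > 0" using l \<rho> by (simp add: \<tau>_def)
  let ?Q = "cbox a b"
  let ?F = "\<lambda>x. \<tau> * indicator ?Q x + (indicator ?Q x * norm (grad u x) ^ DIM('a)) / \<tau> ^ m"
  have "emeasure lebesgue ?Q < \<infinity>" using emeasure_bounded_finite[OF bounded_cbox, of a b] by simp
  then have Fint: "integrable lebesgue ?F"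
    by (intro Bochner_Integration.integrable_add integrable_mult_right integrable_divide energy_piece_integrable) auto
  have "(\<integral>\<^sup>+x. ennreal (h x) * indicator ?Q x \<partial>lborel) = (\<integral>\<^sup>+x. ennreal (h x) * indicator ?Q x \<partial>lebesgue)"
    by (rule nn_integral_completion[symmetric])
  also have "\<dots> \<le> (\<integral>\<^sup>+x. ennreal (?F x) \<partial>lebesgue)"
  proof (rule nn_integral_mono_AE)
    have "AE x in lebesgue. h x = \<bar>partial_deriv i u x\<bar>" using hd by (rule AE_completion)
    then show "AE x in lebesgue. ennreal (h x) * indicator ?Q x \<le> ennreal (?F x)"
    proof eventually_elim
      case (elim x)
      have "h x \<le> norm (grad u x)" using elim partial_deriv_le_grad[OF i, of x] by simp
      also have "\<dots> \<le> \<tau> + norm (grad u x) ^ Suc m / \<tau> ^ m" by (rule young_power) (use \<tau> in auto)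
      finally show ?case unfolding N by (auto simp: indicator_def intro!: ennreal_leI)
    qed
  qed
  also have "\<dots> = ennreal (\<integral>x. ?F x \<partial>lebesgue)"
    by (rule nn_integral_eq_integral[OF Fint]) (use \<tau> in auto)
  also have "(\<integral>x. ?F x \<partial>lebesgue) = \<tau> * measure lebesgue ?Q + energy ?Q / \<tau> ^ m"
    unfolding energy_def
    using energy_piece_integrable[of ?Q] \<open>emeasure lebesgue ?Q < \<infinity>\<close>
    by (subst Bochner_Integration.integral_add) auto
  also have "\<dots> \<le> \<tau> * l ^ Suc m + \<rho> ^ Suc m / \<tau> ^ m"
  proof (intro add_mono mult_left_mono divide_right_mono)
    have "measure lebesgue ?Q = (\<Prod>j\<in>Basis. b \<bullet> j - a \<bullet> j)"
      using sides by (simp add: measure_lborel_cbox_eq inner_diff_left)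
    also have "\<dots> \<le> (\<Prod>j\<in>(Basis::'a set). l)" using sides by (intro prod_mono) auto
    finally show "measure lebesgue ?Q \<le> l ^ Suc m" by (simp add: N)
    show "energy ?Q \<le> \<rho> ^ Suc m" using E by (simp add: N)
  qed (use \<tau> in auto)
  also have "\<tau> * l ^ Suc m + \<rho> ^ Suc m / \<tau> ^ m = 2 * \<rho> * l ^ m"
    using l \<rho> by (simp add: \<tau>_def power_divide field_simps)
  finally show ?thesis by (simp add: m_def ennreal_leI)
qed

lemma integrable_box_u: "integrable lborel (\<lambda>x. indicator (cbox a b) x * u x)"
  using borel_integrable_compact[OF compact_cbox continuous_on_subset[OF continuous_u]]
  by (simp add: indicator_def if_distrib cong: if_cong)

text \<open>
  The two boxes differ in direction \<open>i\<close> only, so the difference of the averages is the integral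
  of \<open>u\<close> against a weight that depends on the coordinate in this direction and has mean zero.
\<close>

lemma avg_change_coordinate:
  assumes i: "i \<in> Basis" and l: "l > 0" and \<rho>: "\<rho> > 0" and \<kappa>: "\<kappa> > 0"
    and sides: "\<And>j. j \<in> Basis \<Longrightarrow> \<kappa> * l \<le> b \<bullet> j - a \<bullet> j \<and> b \<bullet> j - a \<bullet> j \<le> l"
    and pq: "a \<bullet> i \<le> p" "p < q" "q \<le> b \<bullet> i"
    and E: "energy (cbox a b) \<le> \<rho> ^ DIM('a)"
  shows "\<bar>avg (a + (p - a \<bullet> i) *\<^sub>R i) (b + (q - b \<bullet> i) *\<^sub>R i) - avg a b\<bar> \<le> 4 / \<kappa> ^ (DIM('a) - 1) * \<rho>"
proof -
  define m where "m = DIM('a) - 1"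
  define a' b' where "a' = a + (p - a \<bullet> i) *\<^sub>R i" and "b' = b + (q - b \<bullet> i) *\<^sub>R i"
  have a'j: "a' \<bullet> j = (if j = i then p else a \<bullet> j)" "b' \<bullet> j = (if j = i then q else b \<bullet> j)" if "j \<in> Basis" for j
    using that i by (auto simp: a'_def b'_def inner_add_left inner_Basis)
  have lt: "a \<bullet> j < b \<bullet> j" if "j \<in> Basis" for j
  proof -
    have "0 < \<kappa> * l" using \<kappa> l by simp
    then show ?thesis using sides[OF that] by linarith
  qed
  define P where "P = (\<Prod>j\<in>Basis - {i}. b \<bullet> j - a \<bullet> j)"
  have P: "P > 0" unfolding P_def using lt by (intro prod_pos) auto
  have mQ: "measure lborel (cbox a b) = (b \<bullet> i - a \<bullet> i) * P"
    using lt i by (simp add: measure_lborel_cbox_eq less_imp_le prod.remove[OF finite_Basis i] P_def inner_diff_left)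
  have "(\<Prod>j\<in>Basis - {i}. b' \<bullet> j - a' \<bullet> j) = P" unfolding P_def
    by (intro prod.cong) (auto simp: a'j)
  then have mQ': "measure lborel (cbox a' b') = (q - p) * P"
    using lt i pq a'j by (simp add: measure_lborel_cbox_eq less_imp_le prod.remove[OF finite_Basis i] inner_diff_left)
  \<comment> \<open>the difference of the densities of the two averages in direction \<open>i\<close>\<close>
  define w where "w t = indicator {p..q} t / (q - p) - indicator {a \<bullet> i..b \<bullet> i} t / (b \<bullet> i - a \<bullet> i)" for t :: real
  have wm: "w \<in> borel_measurable borel" unfolding w_def[abs_def] by measurable
  have wabs: "\<bar>w t\<bar> \<le> indicator {p..q} t / (q - p) + indicator {a \<bullet> i..b \<bullet> i} t / (b \<bullet> i - a \<bullet> i)" for t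
  proof -
    have "0 \<le> indicator {p..q} t / (q - p)" "0 \<le> indicator {a \<bullet> i..b \<bullet> i} t / (b \<bullet> i - a \<bullet> i)"
      using pq lt[OF i] by (auto simp: indicator_def)
    then show ?thesis unfolding w_def by linarith
  qed
  have wB: "\<bar>w t\<bar> \<le> 1 / (q - p) + 1 / (b \<bullet> i - a \<bullet> i)" for t
    by (rule order_trans[OF wabs]) (use pq lt[OF i] in \<open>auto simp: indicator_def\<close>)
  have i1: "integrable lborel (\<lambda>t. indicator {c..d} t / (d - c) :: real)"
       "c < d \<Longrightarrow> (\<integral>t. indicator {c..d} t / (d - c) \<partial>lborel) = (1::real)" for c d :: real
    using emeasure_bounded_finite[OF bounded_closed_interval[of c d]]
    by (auto intro!: integrable_divide integrable_real_indicator)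
  have w0: "(\<integral>t. indicator {a \<bullet> i..b \<bullet> i} t * w t \<partial>lborel) = 0"
  proof -
    have "(\<integral>t. indicator {a \<bullet> i..b \<bullet> i} t * w t \<partial>lborel) = (\<integral>t. w t \<partial>lborel)"
      by (intro Bochner_Integration.integral_cong) (use pq in \<open>auto simp: w_def indicator_def\<close>)
    also have "\<dots> = 0" unfolding w_def
      by (subst Bochner_Integration.integral_diff) (use i1 pq lt[OF i] in auto)
    finally show ?thesis .
  qed
  have W: "(\<integral>\<^sup>+t. indicator {a \<bullet> i..b \<bullet> i} t * ennreal \<bar>w t\<bar> \<partial>lborel) \<le> 2"
  proof -
    let ?k = "\<lambda>t. indicator {p..q} t / (q - p) + indicator {a \<bullet> i..b \<bullet> i} t / (b \<bullet> i - a \<bullet> i)"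
    have "(\<integral>\<^sup>+t. indicator {a \<bullet> i..b \<bullet> i} t * ennreal \<bar>w t\<bar> \<partial>lborel) \<le> (\<integral>\<^sup>+t. ennreal (?k t) \<partial>lborel)"
      by (intro nn_integral_mono order_trans[OF _ ennreal_leI[OF wabs]]) (auto simp: indicator_def)
    also have "\<dots> = ennreal (\<integral>t. ?k t \<partial>lborel)"
      by (intro nn_integral_eq_integral Bochner_Integration.integrable_add i1) (use pq lt[OF i] in auto)
    also have "(\<integral>t. ?k t \<partial>lborel) = 2"
      by (subst Bochner_Integration.integral_add) (use i1 pq lt[OF i] in auto)
    finally show ?thesis by simp
  qed
  obtain h where h: "h \<in> borel_measurable borel" "\<And>x. h x \<ge> 0" "AE x in lborel. h x = \<bar>partial_deriv i u x\<bar>"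
    using obtain_partial_deriv_borel[OF i] by blast
  let ?X = "\<integral>x. indicator (cbox a b) x * (u x * w (x \<bullet> i)) \<partial>lborel"
  have "ennreal \<bar>?X\<bar> \<le> (\<integral>\<^sup>+t. indicator {a \<bullet> i..b \<bullet> i} t * ennreal \<bar>w t\<bar> \<partial>lborel) *
      (\<integral>\<^sup>+x. ennreal (h x) * indicator (cbox a b) x \<partial>lborel)"
    by (rule weighted_coordinate_integral_le[OF _ i h wm wB w0]) (use ACLn in \<open>simp add: ACLn_def\<close>)
  also have "\<dots> \<le> 2 * ennreal (2 * \<rho> * l ^ m)"
    unfolding m_def
    by (intro mult_mono W partial_deriv_L1_le[OF i h(1,3) l \<rho> _ E]) (use sides lt in \<open>auto simp: less_imp_le\<close>)
  also have "\<dots> = ennreal (2 * (2 * \<rho> * l ^ m))"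
    using ennreal_mult[of 2 "2 * \<rho> * l ^ m"] \<rho> l by simp
  finally have "\<bar>?X\<bar> \<le> 2 * (2 * \<rho> * l ^ m)" using \<rho> l by (subst (asm) ennreal_le_iff) auto
  then have X: "\<bar>?X\<bar> \<le> 4 * \<rho> * l ^ m" by simp
  have "x \<in> cbox a' b' \<longleftrightarrow> x \<in> cbox a b \<and> x \<bullet> i \<in> {p..q}" for x
  proof -
    have "(\<forall>j\<in>Basis. a' \<bullet> j \<le> x \<bullet> j \<and> x \<bullet> j \<le> b' \<bullet> j) \<longleftrightarrow>
        (\<forall>j\<in>Basis - {i}. a \<bullet> j \<le> x \<bullet> j \<and> x \<bullet> j \<le> b \<bullet> j) \<and> p \<le> x \<bullet> i \<and> x \<bullet> i \<le> q"
      using i by (auto simp: a'j)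
    moreover have "(\<forall>j\<in>Basis. a \<bullet> j \<le> x \<bullet> j \<and> x \<bullet> j \<le> b \<bullet> j) \<longleftrightarrow>
        (\<forall>j\<in>Basis - {i}. a \<bullet> j \<le> x \<bullet> j \<and> x \<bullet> j \<le> b \<bullet> j) \<and> a \<bullet> i \<le> x \<bullet> i \<and> x \<bullet> i \<le> b \<bullet> i"
      using i by auto
    ultimately show ?thesis using pq unfolding mem_box atLeastAtMost_iff by linarith
  qed
  then have in': "indicator (cbox a b) x * indicator {p..q} (x \<bullet> i) = (indicator (cbox a' b') x :: real)" for x
    by (simp add: indicator_def)
  have in0: "indicator (cbox a b) x * indicator {a \<bullet> i..b \<bullet> i} (x \<bullet> i) = (indicator (cbox a b) x :: real)" for x
    using i by (auto simp: indicator_def mem_box)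
  have "indicator (cbox a b) x * (u x * w (x \<bullet> i)) =
      (indicator (cbox a b) x * indicator {p..q} (x \<bullet> i)) * u x / (q - p) -
      (indicator (cbox a b) x * indicator {a \<bullet> i..b \<bullet> i} (x \<bullet> i)) * u x / (b \<bullet> i - a \<bullet> i)" for x
    by (simp add: w_def right_diff_distrib mult.commute mult.left_commute)
  then have "indicator (cbox a b) x * (u x * w (x \<bullet> i)) =
      indicator (cbox a' b') x * u x / (q - p) - indicator (cbox a b) x * u x / (b \<bullet> i - a \<bullet> i)" for x
    unfolding in' in0 .
  then have "?X = (\<integral>x. indicator (cbox a' b') x * u x \<partial>lborel) / (q - p) -
      (\<integral>x. indicator (cbox a b) x * u x \<partial>lborel) / (b \<bullet> i - a \<bullet> i)"
    using integrable_box_u by (simp add: integrable_divide)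
  then have "?X / P = avg a' b' - avg a b"
    using P by (simp add: avg_def mQ mQ' diff_divide_distrib)
  then have "\<bar>avg a' b' - avg a b\<bar> = \<bar>?X\<bar> / P" using P by (metis abs_divide abs_of_pos)
  also have "\<dots> \<le> (4 * \<rho> * l ^ m) / (\<kappa> * l) ^ m"
  proof (rule frac_le)
    have "(\<kappa> * l) ^ m = (\<Prod>j\<in>Basis - {i}. \<kappa> * l)" using i by (simp add: m_def)
    also have "\<dots> \<le> P" unfolding P_def using sides \<kappa> l by (intro prod_mono) auto
    finally show "(\<kappa> * l) ^ m \<le> P" .
  qed (use X \<kappa> l \<rho> in auto)
  also have "\<dots> = 4 / \<kappa> ^ m * \<rho>" using l by (simp add: power_mult_distrib)
  finally show ?thesis by (simp add: a'_def b'_def m_def)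
qed

text \<open>
  Poincare inequality. The smaller box is reached from the larger one by changing one coordinate
  at a time; all intermediate boxes lie in the larger box.
\<close>

lemma avg_subbox:
  assumes l: "l > 0" and \<rho>: "\<rho> > 0" and \<kappa>: "\<kappa> > 0"
    and sides: "\<And>j. j \<in> Basis \<Longrightarrow> a \<bullet> j \<le> a' \<bullet> j \<and> b' \<bullet> j \<le> b \<bullet> j \<and> \<kappa> * l \<le> b' \<bullet> j - a' \<bullet> j \<and> b \<bullet> j - a \<bullet> j \<le> l"
    and E: "energy (cbox a b) \<le> \<rho> ^ DIM('a)"
  shows "\<bar>avg a' b' - avg a b\<bar> \<le> osc_const DIM('a) \<kappa> * \<rho>"
proof -
  \<comment> \<open>the corners in which the coordinates in \<open>S\<close> have been changed already\<close>
  define mix where "mix S c c' = (\<Sum>j\<in>Basis. (if j \<in> S then c' \<bullet> j else c \<bullet> j) *\<^sub>R j)" for S and c c' :: 'a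
  have mixj: "mix S c c' \<bullet> j = (if j \<in> S then c' \<bullet> j else c \<bullet> j)" if "j \<in> Basis" for S c c' j
    using that by (simp add: mix_def)
  have "\<bar>avg (mix S a a') (mix S b b') - avg a b\<bar> \<le> card S * (4 / \<kappa> ^ (DIM('a) - 1) * \<rho>)"
    if "finite S" "S \<subseteq> Basis" for S
    using that
  proof (induction S rule: finite_induct)
    case empty
    have "mix {} c c' = c" for c c' by (simp add: mix_def euclidean_representation)
    then show ?case by simp
  next
    case (insert i S)
    have i: "i \<in> Basis" using insert by auto
    let ?a = "mix S a a'" and ?b = "mix S b b'"
    have step: "mix (insert i S) c c' = mix S c c' + (c' \<bullet> i - mix S c c' \<bullet> i) *\<^sub>R i" for c c'
      by (rule euclidean_eqI) (use i in \<open>auto simp: mixj inner_add_left inner_Basis\<close>)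
    have \<kappa>l: "0 < \<kappa> * l" using \<kappa> l by simp
    have "cbox ?a ?b \<subseteq> cbox a b"
      using sides by (auto simp: mem_box mixj split: if_splits) (meson order_trans)+
    then have E': "energy (cbox ?a ?b) \<le> \<rho> ^ DIM('a)"
      using E by (meson energy_mono order_trans lmeasurable_cbox fmeasurableD)
    have "\<bar>avg (mix (insert i S) a a') (mix (insert i S) b b') - avg ?a ?b\<bar> \<le> 4 / \<kappa> ^ (DIM('a) - 1) * \<rho>"
      unfolding step
    proof (rule avg_change_coordinate[OF i l \<rho> \<kappa> _ _ _ _ E'])
      fix j :: 'a assume j: "j \<in> Basis"
      show "\<kappa> * l \<le> ?b \<bullet> j - ?a \<bullet> j \<and> ?b \<bullet> j - ?a \<bullet> j \<le> l"
        using sides[OF j] by (auto simp: mixj j)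
    qed (use sides[OF i] insert.hyps \<kappa>l in \<open>auto simp: mixj i\<close>)
    moreover have "\<bar>avg ?a ?b - avg a b\<bar> \<le> card S * (4 / \<kappa> ^ (DIM('a) - 1) * \<rho>)"
      using insert by auto
    ultimately have "\<bar>avg (mix (insert i S) a a') (mix (insert i S) b b') - avg a b\<bar> \<le>
        4 / \<kappa> ^ (DIM('a) - 1) * \<rho> + card S * (4 / \<kappa> ^ (DIM('a) - 1) * \<rho>)"
      by linarith
    also have "\<dots> = card (insert i S) * (4 / \<kappa> ^ (DIM('a) - 1) * \<rho>)"
      by (subst card_insert_disjoint[OF insert.hyps]) (simp only: of_nat_Suc distrib_right mult_1_left)
    finally show ?case .
  qed
  from this[of Basis] have "\<bar>avg (mix Basis a a') (mix Basis b b') - avg a b\<bar> \<le> osc_const DIM('a) \<kappa> * \<rho>"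
    by (simp add: osc_const_def ac_simps)
  moreover have "mix Basis c c' = c'" for c c' by (simp add: mix_def euclidean_representation)
  ultimately show ?thesis by simp
qed

end

section \<open>Cubes, annuli and perfect sets\<close>

definition cube :: "'a::euclidean_space \<Rightarrow> real \<Rightarrow> 'a set" where
  "cube x r = cbox (x - r *\<^sub>R One) (x + r *\<^sub>R One)"

definition annulus :: "'a::euclidean_space \<Rightarrow> real \<Rightarrow> real \<Rightarrow> 'a set" where
  "annulus p s t = cube p t - box (p - s *\<^sub>R One) (p + s *\<^sub>R One)"

text \<open>
  The uniform perfectness condition with parameter \<open>c\<close> at scales below \<open>R\<close>; it can be required
  of \<open>E\<close> and of the finite boundary points of \<open>G\<close> in the same way.
\<close>

definition perfect_upto :: "real \<Rightarrow> real \<Rightarrow> 'a::metric_space set \<Rightarrow> bool" where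
  "perfect_upto c R F \<longleftrightarrow> (\<forall>a\<in>F. \<forall>r. 0 < r \<and> r < R \<longrightarrow> (\<exists>x\<in>F. c * r < dist x a \<and> dist x a < r))"

lemma mem_cube: "y \<in> cube x r \<longleftrightarrow> (\<forall>j\<in>Basis. \<bar>y \<bullet> j - x \<bullet> j\<bar> \<le> r)"
  unfolding cube_def mem_box by (auto simp: inner_diff_left inner_add_left abs_le_iff algebra_simps)

lemma mem_annulus: "y \<in> annulus p s t \<longleftrightarrow> y \<in> cube p t \<and> (\<exists>j\<in>Basis. s \<le> \<bar>y \<bullet> j - p \<bullet> j\<bar>)"
proof -
  have "y \<in> box (p - s *\<^sub>R One) (p + s *\<^sub>R One) \<longleftrightarrow> (\<forall>j\<in>Basis. \<bar>y \<bullet> j - p \<bullet> j\<bar> < s)"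
    unfolding mem_box by (auto simp: inner_diff_left inner_add_left abs_less_iff algebra_simps)
  then show ?thesis by (auto simp: annulus_def not_less)
qed

lemma sets_cube_annulus [simp]: "cube x r \<in> sets lebesgue" "annulus x s t \<in> sets lebesgue"
  by (auto simp: cube_def annulus_def)

lemma cube_subset_cube:
  "(\<And>j. j \<in> Basis \<Longrightarrow> \<bar>y \<bullet> j - x \<bullet> j\<bar> + s \<le> r) \<Longrightarrow> cube y s \<subseteq> cube x r"
  unfolding subset_iff mem_cube by (smt (verit))

lemma norm_le_DIM_max:
  fixes x :: "'a::euclidean_space"
  shows "\<exists>j\<in>Basis. norm x \<le> DIM('a) * \<bar>x \<bullet> j\<bar>"
proof (rule ccontr)
  assume "\<not> ?thesis"
  then have "\<And>j. j \<in> Basis \<Longrightarrow> \<bar>x \<bullet> j\<bar> < norm x / DIM('a)"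
    by (auto simp: not_le pos_less_divide_eq mult.commute)
  then have "(\<Sum>j\<in>Basis. \<bar>x \<bullet> j\<bar>) < (\<Sum>j\<in>(Basis::'a set). norm x / DIM('a))"
    by (intro sum_strict_mono) auto
  then show False using norm_le_l1[of x] by simp
qed

lemma dist_cube_le:
  fixes x :: "'a::euclidean_space" and r :: real
  assumes "y \<in> cube x r"
  shows "dist y x \<le> DIM('a) * r"
proof -
  have "dist y x \<le> (\<Sum>j\<in>Basis. \<bar>(y - x) \<bullet> j\<bar>)" unfolding dist_norm by (rule norm_le_l1)
  also have "\<dots> \<le> (\<Sum>j\<in>(Basis::'a set). r)"
    using assms by (intro sum_mono) (auto simp: mem_cube inner_diff_left)
  finally show ?thesis by simp
qed

lemma coord_le_dist: "j \<in> Basis \<Longrightarrow> \<bar>y \<bullet> j - x \<bullet> j\<bar> \<le> dist y x"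
  using Basis_le_norm[of j "y - x"] by (simp add: dist_norm inner_diff_left)

section \<open>Means over cubes centred in a perfect set\<close>

text \<open>
  The ratio between the size of a cube and that of its two subcubes in the choice of the subcube with
  less energy. It is small enough for the subcubes to be disjoint.
\<close>

definition child_ratio :: "nat \<Rightarrow> real \<Rightarrow> real" where
  "child_ratio n c = c / (8 * n)"

text \<open>
  If the energy is halved, then its \<open>n\<close>-th root shrinks by this factor.
\<close>

definition half_root :: "nat \<Rightarrow> real" where
  "half_root n = root n (1 / 2)"

lemma half_root:
  assumes "n > 0"
  shows "0 < half_root n" "half_root n < 1" "half_root n ^ n = 1 / 2"
  using assms by (auto simp: half_root_def)

text \<open>
  The sum of the geometric series with ratio \<open>half_root n\<close> whose first term comes from the Poincare
  inequality for a cube and its subcube.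
\<close>

definition density_const :: "nat \<Rightarrow> real \<Rightarrow> real" where
  "density_const n c = osc_const n (child_ratio n c) / (1 - half_root n)"

lemma osc_const_nonneg: "\<kappa> > 0 \<Longrightarrow> osc_const n \<kappa> \<ge> 0"
  by (simp add: osc_const_def)

lemma osc_const_pos: "n > 0 \<Longrightarrow> \<kappa> > 0 \<Longrightarrow> osc_const n \<kappa> > 0"
  by (simp add: osc_const_def)

lemma density_const_pos: "n > 0 \<Longrightarrow> c > 0 \<Longrightarrow> density_const n c > 0"
  using half_root[of n] by (auto simp: density_const_def child_ratio_def intro!: divide_pos_pos osc_const_pos)

context finite_energy
begin

definition mean :: "'a \<Rightarrow> real \<Rightarrow> real" where
  "mean x r = avg (x - r *\<^sub>R One) (x + r *\<^sub>R One)"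

lemma mean_in_box:
  assumes s: "s > 0" and l: "l > 0" and \<rho>: "\<rho> > 0" and \<kappa>: "\<kappa> > 0" "\<kappa> * l \<le> 2 * s"
    and sides: "\<And>j. j \<in> Basis \<Longrightarrow> a \<bullet> j \<le> y \<bullet> j - s \<and> y \<bullet> j + s \<le> b \<bullet> j \<and> b \<bullet> j - a \<bullet> j \<le> l"
    and E: "energy (cbox a b) \<le> \<rho> ^ DIM('a)"
  shows "\<bar>mean y s - avg a b\<bar> \<le> osc_const DIM('a) \<kappa> * \<rho>"
  unfolding mean_def
  by (rule avg_subbox[OF l \<rho> \<kappa>(1) _ E]) (use sides \<kappa>(2) in \<open>auto simp: inner_diff_left inner_add_left algebra_simps\<close>)

lemma mean_nested:
  assumes s: "s > 0" and r: "r > 0" and \<rho>: "\<rho> > 0" and \<kappa>: "\<kappa> > 0" "\<kappa> * r \<le> s"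
    and sub: "\<And>j. j \<in> Basis \<Longrightarrow> \<bar>y \<bullet> j - x \<bullet> j\<bar> + s \<le> r"
    and E: "energy (cube x r) \<le> \<rho> ^ DIM('a)"
  shows "\<bar>mean y s - mean x r\<bar> \<le> osc_const DIM('a) \<kappa> * \<rho>"
  unfolding mean_def[of x]
proof (rule mean_in_box[OF s _ \<rho> \<kappa>(1)])
  show "0 < 2 * r" using r by simp
  show "\<kappa> * (2 * r) \<le> 2 * s" using \<kappa> by simp
  show "energy (cbox (x - r *\<^sub>R One) (x + r *\<^sub>R One)) \<le> \<rho> ^ DIM('a)" using E by (simp add: cube_def)
  fix j :: 'a assume j: "j \<in> Basis"
  show "(x - r *\<^sub>R One) \<bullet> j \<le> y \<bullet> j - s \<and> y \<bullet> j + s \<le> (x + r *\<^sub>R One) \<bullet> j \<and> (x + r *\<^sub>R One) \<bullet> j - (x - r *\<^sub>R One) \<bullet> j \<le> 2 * r"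
    using sub[OF j] j by (auto simp: inner_diff_left inner_add_left)
qed

lemma avg_close:
  assumes m: "measure lborel (cbox a b) > 0" and close: "\<And>z. z \<in> cbox a b \<Longrightarrow> \<bar>u z - c\<bar> \<le> \<epsilon>"
  shows "\<bar>avg a b - c\<bar> \<le> \<epsilon>"
proof -
  let ?m = "measure lborel (cbox a b)"
  have i: "integrable lborel (\<lambda>x. indicator (cbox a b) x * d)" for d :: real
    using emeasure_bounded_finite[OF bounded_cbox[of a b]] by (intro integrable_mult_left integrable_real_indicator) auto
  have v: "(\<integral>x. indicator (cbox a b) x * d \<partial>lborel) = ?m * d" for d :: real
    using emeasure_bounded_finite[OF bounded_cbox[of a b]] by simp
  have "(\<integral>x. indicator (cbox a b) x * u x \<partial>lborel) \<le> (\<integral>x. indicator (cbox a b) x * (c + \<epsilon>) \<partial>lborel)"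
  proof (rule integral_mono[OF integrable_box_u i])
    fix x show "indicator (cbox a b) x * u x \<le> indicator (cbox a b) x * (c + \<epsilon>)"
      using close[of x] by (auto simp: indicator_def abs_le_iff)
  qed
  moreover have "(\<integral>x. indicator (cbox a b) x * (c - \<epsilon>) \<partial>lborel) \<le> (\<integral>x. indicator (cbox a b) x * u x \<partial>lborel)"
  proof (rule integral_mono[OF i integrable_box_u])
    fix x show "indicator (cbox a b) x * (c - \<epsilon>) \<le> indicator (cbox a b) x * u x"
      using close[of x] by (auto simp: indicator_def abs_le_iff)
  qed
  ultimately have "avg a b \<le> c + \<epsilon>" "c - \<epsilon> \<le> avg a b"
    unfolding avg_def v using m by (auto simp: pos_divide_le_eq pos_le_divide_eq mult.commute)
  then show ?thesis by linarith
qed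

lemma measure_cube_pos:
  fixes x :: 'a
  assumes "r > 0" shows "measure lborel (cbox (x - r *\<^sub>R One) (x + r *\<^sub>R One)) > 0"
  using assms by (subst measure_lborel_cbox_eq) (auto intro!: prod_pos simp: inner_diff_left inner_add_left)

text \<open>
  Uniformity in the centre matters, because the centre of the last cube in a descending chain depends
  on the length of the chain.
\<close>

lemma mean_tendsto_uniform:
  assumes e: "\<epsilon> > 0"
  shows "\<exists>s0>0. \<forall>y\<in>cube x r. \<forall>s. 0 < s \<and> s < s0 \<longrightarrow> \<bar>mean y s - u y\<bar> \<le> \<epsilon>"
proof -
  have "uniformly_continuous_on (cube x (r + 1)) u"
    by (intro compact_uniformly_continuous continuous_on_subset[OF continuous_u]) (auto simp: cube_def)
  then obtain \<delta> where \<delta>: "\<delta> > 0" "\<And>y z. y \<in> cube x (r + 1) \<Longrightarrow> z \<in> cube x (r + 1) \<Longrightarrow> dist z y < \<delta> \<Longrightarrow> dist (u z) (u y) < \<epsilon>"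
    using e unfolding uniformly_continuous_on_def by metis
  show ?thesis
  proof (intro exI[of _ "min 1 (\<delta> / DIM('a))"] conjI ballI allI impI)
    show "0 < min 1 (\<delta> / DIM('a))" using \<delta>(1) by simp
    fix y s assume y: "y \<in> cube x r" and s: "0 < s \<and> s < min 1 (\<delta> / DIM('a))"
    show "\<bar>mean y s - u y\<bar> \<le> \<epsilon>"
      unfolding mean_def
    proof (rule avg_close)
      show "measure lborel (cbox (y - s *\<^sub>R One) (y + s *\<^sub>R One)) > 0" using s by (intro measure_cube_pos) auto
      fix z assume "z \<in> cbox (y - s *\<^sub>R One) (y + s *\<^sub>R One)"
      then have z: "z \<in> cube y s" by (simp add: cube_def)
      have "cube y s \<subseteq> cube x (r + 1)" using y s by (intro cube_subset_cube) (auto simp: mem_cube intro: add_mono)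
      then have "z \<in> cube x (r + 1)" using z by blast
      moreover have "y \<in> cube x (r + 1)" using y by (force simp: mem_cube)
      moreover have "dist z y < \<delta>"
      proof -
        have "dist z y \<le> DIM('a) * s" by (rule dist_cube_le[OF z])
        also have "\<dots> < \<delta>" using s by (simp add: pos_less_divide_eq mult.commute)
        finally show ?thesis .
      qed
      ultimately show "\<bar>u z - u y\<bar> \<le> \<epsilon>" using \<delta>(2) by (force simp: dist_real_def)
    qed
  qed
qed

text \<open>
  Besides \<open>a\<close> there is a point of \<open>F\<close> at distance comparable with \<open>r\<close>. The small cubes
  around these two points are disjoint, so one of them has at most half of the energy.
\<close>

lemma child_cube:
  assumes F: "perfect_upto c R F" and c: "0 < c" "c < 1" and a: "a \<in> F" and r: "0 < r" "r \<le> R"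
    and E: "energy (cube a r) \<le> \<rho> ^ DIM('a)"
  shows "\<exists>y\<in>F. (\<forall>j\<in>Basis. \<bar>y \<bullet> j - a \<bullet> j\<bar> + child_ratio DIM('a) c * r \<le> r) \<and>
    energy (cube y (child_ratio DIM('a) c * r)) \<le> (half_root DIM('a) * \<rho>) ^ DIM('a)"
proof -
  let ?l = "child_ratio DIM('a) c * r"
  have N: "real DIM('a) \<ge> 1" using DIM_positive[where 'a='a] by linarith
  have l8: "?l \<le> r / 8"
  proof -
    have "c \<le> real DIM('a)" using c N by linarith
    then have "c / (8 * DIM('a)) \<le> 1 / 8" by (simp add: divide_le_eq)
    then show ?thesis using r mult_right_mono[of "c / (8 * DIM('a))" "1/8" r] by (simp add: child_ratio_def)
  qed
  have l0: "?l > 0" using c r by (simp add: child_ratio_def)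
  obtain x where x: "x \<in> F" "c * (r / 2) < dist x a" "dist x a < r / 2"
    using F a r unfolding perfect_upto_def by (metis half_gt_zero field_sum_of_halves less_add_same_cancel1 less_le_trans)
  obtain j where j: "j \<in> Basis" "norm (x - a) \<le> DIM('a) * \<bar>(x - a) \<bullet> j\<bar>"
    using norm_le_DIM_max by blast
  have "c * (r / 2) < DIM('a) * \<bar>x \<bullet> j - a \<bullet> j\<bar>"
    using x(2) j by (simp add: dist_norm inner_diff_left)
  then have gap: "4 * ?l < \<bar>x \<bullet> j - a \<bullet> j\<bar>"
    using N by (simp add: child_ratio_def field_simps)
  have disj: "cube a ?l \<inter> cube x ?l = {}"
  proof (rule ccontr)
    assume "cube a ?l \<inter> cube x ?l \<noteq> {}"
    then obtain z where "z \<in> cube a ?l" "z \<in> cube x ?l" by blast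
    then have "\<bar>z \<bullet> j - a \<bullet> j\<bar> \<le> ?l" "\<bar>z \<bullet> j - x \<bullet> j\<bar> \<le> ?l" using j by (auto simp: mem_cube)
    then show False using gap l0 by linarith
  qed
  have suba: "\<bar>a \<bullet> j - a \<bullet> j\<bar> + ?l \<le> r" for j using l8 r by simp
  have subx: "\<bar>x \<bullet> j - a \<bullet> j\<bar> + ?l \<le> r" if "j \<in> Basis" for j
    using coord_le_dist[OF that, of x a] x(3) l8 by linarith
  have "energy (cube a ?l) + energy (cube x ?l) = energy (cube a ?l \<union> cube x ?l)"
    using disj by (intro energy_disjoint_Un[symmetric]) auto
  also have "\<dots> \<le> energy (cube a r)"
    using cube_subset_cube[OF suba] cube_subset_cube[OF subx] by (intro energy_mono) auto
  finally have sum: "energy (cube a ?l) + energy (cube x ?l) \<le> \<rho> ^ DIM('a)" using E by simp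
  have half: "(half_root DIM('a) * \<rho>) ^ DIM('a) = \<rho> ^ DIM('a) / 2"
    by (simp add: power_mult_distrib half_root)
  show ?thesis
  proof (cases "energy (cube a ?l) \<le> \<rho> ^ DIM('a) / 2")
    case True
    then show ?thesis using a suba half by (intro bexI[of _ a]) auto
  next
    case False
    then show ?thesis using x subx half sum by (intro bexI[of _ x]) auto
  qed
qed

text \<open>
  Each step costs a constant times the current bound \<open>\<rho>\<close>, and \<open>\<rho>\<close> shrinks by the factor \<open>half_root n\<close>. The
  bound does not depend on \<open>k\<close>, since \<open>density_const\<close> solves the fixed point equation
  \<open>osc_const + half_root * density_const = density_const\<close>.
\<close>

lemma descend_cubes:
  assumes F: "perfect_upto c R F" and c: "0 < c" "c < 1"
  shows "a \<in> F \<Longrightarrow> 0 < r \<Longrightarrow> r \<le> R \<Longrightarrow> \<rho> > 0 \<Longrightarrow> energy (cube a r) \<le> \<rho> ^ DIM('a) \<Longrightarrow>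
    \<exists>y\<in>F. (\<forall>j\<in>Basis. \<bar>y \<bullet> j - a \<bullet> j\<bar> + child_ratio DIM('a) c ^ k * r \<le> r) \<and>
      \<bar>mean y (child_ratio DIM('a) c ^ k * r) - mean a r\<bar> \<le> density_const DIM('a) c * \<rho>"
proof (induction k arbitrary: a r \<rho>)
  case 0
  have "density_const DIM('a) c \<ge> 0" using c density_const_pos[of "DIM('a)" c] by simp
  then show ?case using 0 by (intro bexI[of _ a]) auto
next
  case (Suc k)
  let ?q = "child_ratio DIM('a) c" and ?h = "half_root DIM('a)"
  have q: "0 < ?q" using c by (simp add: child_ratio_def)
  obtain y where y: "y \<in> F" "\<And>j. j \<in> Basis \<Longrightarrow> \<bar>y \<bullet> j - a \<bullet> j\<bar> + ?q * r \<le> r"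
    "energy (cube y (?q * r)) \<le> (?h * \<rho>) ^ DIM('a)"
    using child_cube[OF F c Suc.prems(1,2,3,5)] by blast
  have qr: "0 < ?q * r" using q Suc.prems by simp
  have qrR: "?q * r \<le> R" using y(2)[OF SOME_Basis] Suc.prems(3) by linarith
  have h\<rho>: "?h * \<rho> > 0" using half_root[of "DIM('a)"] Suc.prems by simp
  obtain z where z: "z \<in> F" "\<And>j. j \<in> Basis \<Longrightarrow> \<bar>z \<bullet> j - y \<bullet> j\<bar> + ?q ^ k * (?q * r) \<le> ?q * r"
    "\<bar>mean z (?q ^ k * (?q * r)) - mean y (?q * r)\<bar> \<le> density_const DIM('a) c * (?h * \<rho>)"
    using Suc.IH[OF y(1) qr qrR h\<rho> y(3)] by blast
  have first: "\<bar>mean y (?q * r) - mean a r\<bar> \<le> osc_const DIM('a) ?q * \<rho>"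
    by (rule mean_nested[OF qr _ _ q]) (use Suc.prems y in auto)
  have "osc_const DIM('a) ?q = density_const DIM('a) c * (1 - ?h)"
    using half_root[of "DIM('a)"] by (simp add: density_const_def)
  then have "osc_const DIM('a) ?q * \<rho> + density_const DIM('a) c * (?h * \<rho>) =
      density_const DIM('a) c * (1 - ?h) * \<rho> + density_const DIM('a) c * (?h * \<rho>)" by simp
  also have "\<dots> = density_const DIM('a) c * \<rho>" by (simp add: algebra_simps)
  finally have "osc_const DIM('a) ?q * \<rho> + density_const DIM('a) c * (?h * \<rho>) = density_const DIM('a) c * \<rho>" .
  moreover have eq: "?q ^ Suc k * r = ?q ^ k * (?q * r)" by simp
  ultimately have "\<bar>mean z (?q ^ Suc k * r) - mean a r\<bar> \<le> density_const DIM('a) c * \<rho>"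
    using first z(3) unfolding eq by linarith
  moreover have "\<bar>z \<bullet> j - a \<bullet> j\<bar> + ?q ^ Suc k * r \<le> r" if "j \<in> Basis" for j
    unfolding eq using z(2)[OF that] y(2)[OF that] by linarith
  ultimately show ?case using z(1) by blast
qed

text \<open>
  At the end of a long descending chain the cube is so small that its mean is within \<open>\<epsilon>\<close> of the value of
  \<open>u\<close> at its centre, which is a point of \<open>F\<close>.
\<close>

lemma mean_near_value_on_perfect_set:
  assumes F: "perfect_upto c R F" and c: "0 < c" "c < 1" and a: "a \<in> F" and r: "0 < r" "r \<le> R"
    and \<rho>: "\<rho> > 0" and E: "energy (cube a r) \<le> \<rho> ^ DIM('a)" and \<epsilon>: "\<epsilon> > 0"
  shows "\<exists>y\<in>F. \<bar>mean a r - u y\<bar> \<le> density_const DIM('a) c * \<rho> + \<epsilon>"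
proof -
  let ?q = "child_ratio DIM('a) c"
  have q: "0 < ?q" "?q < 1"
  proof -
    have "real DIM('a) \<ge> 1" using DIM_positive[where 'a='a] by linarith
    then have "c < 8 * real DIM('a)" using c by linarith
    then show "0 < ?q" "?q < 1" using c by (auto simp: child_ratio_def divide_less_eq)
  qed
  obtain s0 where s0: "s0 > 0" "\<And>y s. y \<in> cube a r \<Longrightarrow> 0 < s \<Longrightarrow> s < s0 \<Longrightarrow> \<bar>mean y s - u y\<bar> \<le> \<epsilon>"
    using mean_tendsto_uniform[OF \<epsilon>] by blast
  obtain k where k: "?q ^ k < s0 / r"
    using real_arch_pow_inv[of "s0 / r" ?q] q s0 r by auto
  obtain y where y: "y \<in> F" "\<And>j. j \<in> Basis \<Longrightarrow> \<bar>y \<bullet> j - a \<bullet> j\<bar> + ?q ^ k * r \<le> r"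
    "\<bar>mean y (?q ^ k * r) - mean a r\<bar> \<le> density_const DIM('a) c * \<rho>"
    using descend_cubes[OF F c a r \<rho> E, of k] by blast
  have pos: "0 < ?q ^ k * r" using q r by simp
  have "\<bar>mean y (?q ^ k * r) - u y\<bar> \<le> \<epsilon>"
  proof (rule s0(2))
    show "y \<in> cube a r" unfolding mem_cube
    proof
      fix j :: 'a assume "j \<in> Basis"
      then show "\<bar>y \<bullet> j - a \<bullet> j\<bar> \<le> r" using y(2)[of j] pos by linarith
    qed
    show "?q ^ k * r < s0" using k r by (simp add: pos_less_divide_eq)
  qed (rule pos)
  then have "\<bar>mean a r - u y\<bar> \<le> density_const DIM('a) c * \<rho> + \<epsilon>" using y(3) by linarith
  then show ?thesis using y(1) by blast
qed

section \<open>Means over cubes in an annulus\<close>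

text \<open>
  The cube of radius \<open>e\<close> around \<open>y\<close> lies in the part of the annulus where the coordinate in direction \<open>i\<close>,
  taken relative to \<open>p\<close> and with sign \<open>\<sigma>\<close>, is at least \<open>s\<close>. This part is a box, and the annulus is the union
  of these boxes.
\<close>

definition in_slab :: "'a \<Rightarrow> real \<Rightarrow> real \<Rightarrow> real \<Rightarrow> 'a \<Rightarrow> real \<Rightarrow> 'a \<Rightarrow> bool" where
  "in_slab p s t e i \<sigma> y \<longleftrightarrow> s + e \<le> \<sigma> * (y \<bullet> i - p \<bullet> i) \<and> (\<forall>j\<in>Basis. \<bar>y \<bullet> j - p \<bullet> j\<bar> \<le> t - e)"

text \<open>
  Both means are compared with the average over the whole slab.
\<close>

lemma means_in_slab:
  assumes i: "i \<in> Basis" and \<sigma>: "\<sigma> = 1 \<or> \<sigma> = -1" and s: "s > 0" and e: "e > 0" and \<rho>: "\<rho> > 0"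
    and E: "energy (annulus p s t) \<le> \<rho> ^ DIM('a)"
    and y: "in_slab p s t e i \<sigma> y" and z: "in_slab p s t e i \<sigma> z"
  shows "\<bar>mean y e - mean z e\<bar> \<le> 2 * (osc_const DIM('a) (e / t) * \<rho>)"
proof -
  define lo where "lo = (\<Sum>j\<in>Basis. (if j = i \<and> \<sigma> = 1 then p \<bullet> j + s else p \<bullet> j - t) *\<^sub>R j)"
  define hi where "hi = (\<Sum>j\<in>Basis. (if j = i \<and> \<sigma> = -1 then p \<bullet> j - s else p \<bullet> j + t) *\<^sub>R j)"
  have lo: "lo \<bullet> j = (if j = i \<and> \<sigma> = 1 then p \<bullet> j + s else p \<bullet> j - t)" if "j \<in> Basis" for j
    using that by (simp add: lo_def)
  have hi: "hi \<bullet> j = (if j = i \<and> \<sigma> = -1 then p \<bullet> j - s else p \<bullet> j + t)" if "j \<in> Basis" for j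
    using that by (simp add: hi_def)
  have t: "t > 0" using y i s e unfolding in_slab_def by (smt (verit))
  have "cbox lo hi \<subseteq> annulus p s t"
  proof
    fix x assume x: "x \<in> cbox lo hi"
    have "x \<in> cube p t" unfolding mem_cube
    proof
      fix j :: 'a assume j: "j \<in> Basis"
      then have "lo \<bullet> j \<le> x \<bullet> j" "x \<bullet> j \<le> hi \<bullet> j" using x by (auto simp: mem_box)
      then show "\<bar>x \<bullet> j - p \<bullet> j\<bar> \<le> t" using s t unfolding lo[OF j] hi[OF j] by (auto split: if_splits)
    qed
    moreover have "lo \<bullet> i \<le> x \<bullet> i" "x \<bullet> i \<le> hi \<bullet> i" using x i by (auto simp: mem_box)
    then have "s \<le> \<bar>x \<bullet> i - p \<bullet> i\<bar>" using \<sigma> unfolding lo[OF i] hi[OF i] by auto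
    ultimately show "x \<in> annulus p s t" using i by (auto simp: mem_annulus)
  qed
  then have E': "energy (cbox lo hi) \<le> \<rho> ^ DIM('a)"
    using E by (meson energy_mono order_trans lmeasurable_cbox fmeasurableD sets_cube_annulus(2))
  have "\<bar>mean w e - avg lo hi\<bar> \<le> osc_const DIM('a) (e / t) * \<rho>" if w: "in_slab p s t e i \<sigma> w" for w
  proof (rule mean_in_box[OF e _ \<rho> _ _ _ E'])
    show "0 < 2 * t" "0 < e / t" "e / t * (2 * t) \<le> 2 * e" using t e by auto
    fix j :: 'a assume j: "j \<in> Basis"
    show "lo \<bullet> j \<le> w \<bullet> j - e \<and> w \<bullet> j + e \<le> hi \<bullet> j \<and> hi \<bullet> j - lo \<bullet> j \<le> 2 * t"
      using w j s t e \<sigma> unfolding in_slab_def lo[OF j] hi[OF j] abs_le_iff by (auto split: if_splits)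
  qed
  from this[OF y] this[OF z] show ?thesis by linarith
qed

lemma slabs_overlap:
  fixes p :: 'a
  assumes i: "i \<in> Basis" "k \<in> Basis" "i \<noteq> k" and \<sigma>: "\<sigma> = 1 \<or> \<sigma> = -1" and \<tau>: "\<tau> = 1 \<or> \<tau> = -1"
    and s: "s > 0" and e: "e > 0" and t: "s + 2 * e \<le> t"
  shows "\<exists>w. in_slab p s t e i \<sigma> w \<and> in_slab p s t e k \<tau> w"
proof -
  \<comment> \<open>the cube around \<open>w\<close> touches the inner faces of both slabs\<close>
  define w where "w = p + (s + e) *\<^sub>R (\<sigma> *\<^sub>R i + \<tau> *\<^sub>R k)"
  have w: "w \<bullet> j - p \<bullet> j = (if j = i then (s + e) * \<sigma> else if j = k then (s + e) * \<tau> else 0)" if "j \<in> Basis" for j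
    using that i by (auto simp: w_def inner_add_left inner_Basis)
  have "\<bar>w \<bullet> j - p \<bullet> j\<bar> \<le> t - e" if "j \<in> Basis" for j
    unfolding w[OF that] using \<sigma> \<tau> s e t by (auto simp: abs_mult)
  moreover have "\<sigma> * (w \<bullet> i - p \<bullet> i) = s + e" "\<tau> * (w \<bullet> k - p \<bullet> k) = s + e"
    unfolding w[OF i(1)] w[OF i(2)] using i(3) \<sigma> \<tau> by auto
  ultimately show ?thesis unfolding in_slab_def by (intro exI[of _ w]) auto
qed

text \<open>
  Slabs in different directions overlap. Opposite slabs do not, but in dimension at least two
  both of them overlap a slab in another direction; so three slabs are enough in every case.
\<close>

lemma means_in_annulus:
  assumes N: "DIM('a) \<ge> 2" and s: "s > 0" and e: "e > 0" and t: "s + 2 * e \<le> t" and \<rho>: "\<rho> > 0"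
    and E: "energy (annulus p s t) \<le> \<rho> ^ DIM('a)"
    and y: "\<exists>j\<in>Basis. s + e \<le> \<bar>y \<bullet> j - p \<bullet> j\<bar>" "\<And>j. j \<in> Basis \<Longrightarrow> \<bar>y \<bullet> j - p \<bullet> j\<bar> \<le> t - e"
    and z: "\<exists>j\<in>Basis. s + e \<le> \<bar>z \<bullet> j - p \<bullet> j\<bar>" "\<And>j. j \<in> Basis \<Longrightarrow> \<bar>z \<bullet> j - p \<bullet> j\<bar> \<le> t - e"
  shows "\<bar>mean y e - mean z e\<bar> \<le> 6 * (osc_const DIM('a) (e / t) * \<rho>)"
proof -
  let ?sgn = "\<lambda>\<sigma>::real. \<sigma> = 1 \<or> \<sigma> = -1"
  have slab: "\<exists>i\<in>Basis. \<exists>\<sigma>. ?sgn \<sigma> \<and> in_slab p s t e i \<sigma> v"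
    if v: "\<exists>j\<in>Basis. s + e \<le> \<bar>v \<bullet> j - p \<bullet> j\<bar>" "\<And>j. j \<in> Basis \<Longrightarrow> \<bar>v \<bullet> j - p \<bullet> j\<bar> \<le> t - e" for v
  proof -
    obtain j where j: "j \<in> Basis" "s + e \<le> \<bar>v \<bullet> j - p \<bullet> j\<bar>" using v(1) by blast
    show ?thesis
    proof (cases "v \<bullet> j - p \<bullet> j \<ge> 0")
      case True
      then have "in_slab p s t e j 1 v" using j v(2) by (auto simp: in_slab_def)
      then show ?thesis using j(1) by blast
    next
      case False
      then have "in_slab p s t e j (-1) v" using j v(2) by (auto simp: in_slab_def)
      then show ?thesis using j(1) by blast
    qed
  qed
  obtain i \<sigma> where i: "i \<in> Basis" "?sgn \<sigma>" "in_slab p s t e i \<sigma> y" using slab[OF y] by blast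
  obtain k \<tau> where k: "k \<in> Basis" "?sgn \<tau>" "in_slab p s t e k \<tau> z" using slab[OF z] by blast
  have pos: "osc_const DIM('a) (e / t) * \<rho> \<ge> 0" using e t s \<rho> by (intro mult_nonneg_nonneg osc_const_nonneg) auto
  note close = means_in_slab[OF _ _ s e \<rho> E]
  show ?thesis
  proof (cases "i = k")
    case False
    obtain w where w: "in_slab p s t e i \<sigma> w" "in_slab p s t e k \<tau> w"
      using slabs_overlap[OF i(1) k(1) False i(2) k(2) s e t] by blast
    show ?thesis using close[OF i w(1)] close[OF k(1,2) w(2) k(3)] pos by linarith
  next
    case True
    have "\<exists>m\<in>Basis. m \<noteq> i"
    proof (rule ccontr)
      assume "\<not> ?thesis"
      then have "(Basis :: 'a set) \<subseteq> {i}" by blast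
      then have "DIM('a) \<le> card {i}" by (intro card_mono) auto
      then show False using N by simp
    qed
    then obtain m where m: "m \<in> Basis" "m \<noteq> i" by blast
    have one: "?sgn 1" by simp
    obtain w where w: "in_slab p s t e i \<sigma> w" "in_slab p s t e m 1 w"
      using slabs_overlap[OF i(1) m(1) m(2)[symmetric] i(2) one s e t] by blast
    obtain w' where w': "in_slab p s t e m 1 w'" "in_slab p s t e k \<tau> w'"
      using slabs_overlap[OF m(1) k(1) _ one k(2) s e t] m(2) True by blast
    show ?thesis
      using close[OF i w(1)] close[OF m(1) one w(2) w'(1)] close[OF k(1,2) w'(2) k(3)] by linarith
  qed
qed

end

section \<open>Lower bounds for the energy\<close>

lemma perfect_upto_mono:
  assumes "perfect_upto c R F" "c' \<le> c" "R' \<le> R"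
  shows "perfect_upto c' R' F"
  unfolding perfect_upto_def
proof (intro ballI allI impI)
  fix a r assume a: "a \<in> F" and r: "0 < r \<and> r < R'"
  then obtain x where x: "x \<in> F" "c * r < dist x a" "dist x a < r"
    using assms(1,3) unfolding perfect_upto_def by (meson less_le_trans)
  moreover have "c' * r \<le> c * r" using r assms(2) by (intro mult_right_mono) auto
  ultimately show "\<exists>x\<in>F. c' * r < dist x a \<and> dist x a < r" by (intro bexI[of _ x]) auto
qed

text \<open>
  Translates estimates in terms of \<open>\<rho>\<close> back into lower bounds for the energy \<open>x\<close>.
\<close>

lemma power_bound_from_root:
  fixes x C :: real
  assumes x: "x \<ge> 0" and C: "C > 0" and n: "n > 0"
    and le: "\<And>\<rho>. \<rho> > 0 \<Longrightarrow> x \<le> \<rho> ^ n \<Longrightarrow> 1 \<le> C * \<rho>"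
  shows "(1 / C) ^ n \<le> x"
proof (rule ccontr)
  assume "\<not> (1 / C) ^ n \<le> x"
  then have lt: "x < (1 / C) ^ n" by simp
  \<comment> \<open>the second term keeps \<open>\<rho>\<close> positive when \<open>x = 0\<close>\<close>
  define \<rho> where "\<rho> = max (root n x) (1 / (2 * C))"
  have "root n x < 1 / C"
  proof -
    have "root n x < root n ((1 / C) ^ n)" using lt n by simp
    also have "\<dots> = 1 / C" using C n by (simp add: real_root_power_cancel)
    finally show ?thesis .
  qed
  moreover have "1 / (2 * C) < 1 / C" using C by (simp add: field_simps)
  ultimately have "\<rho> < 1 / C" by (simp add: \<rho>_def)
  then have "C * \<rho> < 1" using C by (simp add: field_simps)
  moreover have "0 < 1 / (2 * C)" using C by simp
  then have "\<rho> > 0" unfolding \<rho>_def by (rule less_le_trans) simp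
  moreover have "x \<le> \<rho> ^ n"
  proof -
    have "x = root n x ^ n" using x n by simp
    also have "\<dots> \<le> \<rho> ^ n" using x n by (intro power_mono) (auto simp: \<rho>_def)
    finally show ?thesis .
  qed
  ultimately show False using le[of \<rho>] by simp
qed

text \<open>
  The factor of \<open>\<rho>\<close> in the estimate at one scale: twice the error for values on a perfect set, and the
  comparison of means across an annulus.
\<close>

definition scale_const :: "nat \<Rightarrow> real \<Rightarrow> real" where
  "scale_const n c = 2 * density_const n c + 6 * osc_const n (child_ratio n c)"

lemma scale_const_pos: "n > 0 \<Longrightarrow> c > 0 \<Longrightarrow> scale_const n c > 0"
  unfolding scale_const_def
  by (intro add_pos_pos mult_pos_pos density_const_pos osc_const_pos) (auto simp: child_ratio_def)

text \<open>
  From \<open>y \<le> exp y\<close> with \<open>y = (k + 1) * ln 2 / n\<close>, raised to the power \<open>n\<close>.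
\<close>

lemma power_le_two_power:
  assumes n: "n > 0"
  shows "real (k + 1) ^ n \<le> 2 * (n / ln 2) ^ n * 2 ^ k"
proof -
  have l2: "ln (2::real) > 0" by simp
  have "real (k + 1) * ln 2 / n \<le> exp (real (k + 1) * ln 2 / n)"
    using exp_ge_add_one_self[of "real (k + 1) * ln 2 / n"] by linarith
  then have "(real (k + 1) * ln 2 / n) ^ n \<le> exp (real (k + 1) * ln 2 / n) ^ n"
    using l2 by (intro power_mono) auto
  also have "\<dots> = exp (real (k + 1) * ln 2)" using n by (simp add: exp_of_nat_mult[symmetric])
  also have "\<dots> = 2 * 2 ^ k" by (simp add: exp_of_nat_mult exp_add distrib_right)
  finally have le: "(real (k + 1) * ln 2 / n) ^ n \<le> 2 * 2 ^ k" .
  have "real (k + 1) ^ n = (n / ln 2) ^ n * (real (k + 1) * ln 2 / n) ^ n"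
    using n l2 by (simp flip: power_mult_distrib)
  also have "\<dots> \<le> (n / ln 2) ^ n * (2 * 2 ^ k)" using le l2 by (intro mult_left_mono) auto
  finally show ?thesis by (simp add: mult_ac)
qed

text \<open>
  The minimum of the constants for large and for bounded \<open>D / \<delta>\<close>.
\<close>

definition cap_const :: "nat \<Rightarrow> real \<Rightarrow> real" where
  "cap_const n c = min ((1 / scale_const n c) ^ n / (2 * ln (16 * n / c)))
     (1 / ((2 * density_const n c + 2 * osc_const n (1/2)) ^ n * (2 * (n / ln 2) ^ n) * (32 / c\<^sup>2 + 4)))"

lemma cap_const_pos:
  assumes n: "n \<ge> 2" and c: "0 < c" "c < 1"
  shows "cap_const n c > 0"
proof -
  have n0: "n > 0" using n by simp
  have "real n \<ge> 2" using n by simp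
  then have "16 * n / c > 1" using c by (simp add: less_divide_eq)
  then have "(1 / scale_const n c) ^ n / (2 * ln (16 * n / c)) > 0"
    using scale_const_pos[OF n0 c(1)] by simp
  moreover have "1 / ((2 * density_const n c + 2 * osc_const n (1/2)) ^ n * (2 * (n / ln 2) ^ n) * (32 / c\<^sup>2 + 4)) > 0"
  proof -
    have "2 * density_const n c + 2 * osc_const n (1/2) > 0"
      using density_const_pos[OF n0 c(1)] osc_const_pos[OF n0, of "1/2"] by simp
    moreover have "32 / c\<^sup>2 + 4 > 0" using c by (simp add: add_pos_pos)
    ultimately show ?thesis using n0 by simp
  qed
  ultimately show ?thesis by (simp add: cap_const_def)
qed

context finite_energy
begin

text \<open>
  The mean over the cube around \<open>x\<close> is almost at least \<open>1\<close>, the mean over the one around \<open>y\<close> is almost \<open>0\<close>;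
  so if the two means are close, the errors add up to at least \<open>1\<close>.
\<close>

lemma one_le_from_values:
  assumes E: "perfect_upto c R E" and F: "perfect_upto c R F" and c: "0 < c" "c < 1"
    and uE: "\<And>x. x \<in> E \<Longrightarrow> u x \<ge> 1" and uF: "\<And>x. x \<in> F \<Longrightarrow> u x = 0"
    and x: "x \<in> E" "energy (cube x r) \<le> \<rho> ^ DIM('a)" and y: "y \<in> F" "energy (cube y r) \<le> \<rho> ^ DIM('a)"
    and r: "0 < r" "r \<le> R" and \<rho>: "\<rho> > 0"
    and close: "\<bar>mean x r - mean y r\<bar> \<le> B"
  shows "1 \<le> 2 * (density_const DIM('a) c * \<rho>) + B"
proof (rule field_le_epsilon)
  fix e :: real assume e: "e > 0"
  obtain x' where x': "x' \<in> E" "\<bar>mean x r - u x'\<bar> \<le> density_const DIM('a) c * \<rho> + e / 2"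
    using mean_near_value_on_perfect_set[OF E c x(1) r \<rho> x(2), of "e/2"] e by auto
  obtain y' where y': "y' \<in> F" "\<bar>mean y r - u y'\<bar> \<le> density_const DIM('a) c * \<rho> + e / 2"
    using mean_near_value_on_perfect_set[OF F c y(1) r \<rho> y(2), of "e/2"] e by auto
  show "1 \<le> 2 * (density_const DIM('a) c * \<rho>) + B + e"
    using x'(2) y'(2) uE[OF x'(1)] uF[OF y'(1)] close by linarith
qed

text \<open>
  The contribution of one scale \<open>q\<close>. Perfectness gives points \<open>x\<close> of \<open>E\<close> and \<open>y\<close> of \<open>F\<close> at distance about \<open>q\<close>
  from \<open>a\<close>; for \<open>y\<close> this uses that \<open>dist a b\<close> is at most half of \<open>c * q\<close>. The small cubes around \<open>x\<close>
  and \<open>y\<close> lie in the annulus, which keeps the estimate local.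
\<close>

lemma energy_at_scale:
  assumes N: "DIM('a) \<ge> 2" and c: "0 < c" "c < 1"
    and E: "perfect_upto c R E" and F: "perfect_upto c R F"
    and uE: "\<And>x. x \<in> E \<Longrightarrow> u x \<ge> 1" and uF: "\<And>x. x \<in> F \<Longrightarrow> u x = 0"
    and a: "a \<in> E" and b: "b \<in> F" and ab: "2 * dist a b \<le> c * q" and q: "0 < q" "q < R"
  shows "(1 / scale_const DIM('a) c) ^ DIM('a) \<le> energy (annulus a (c / (4 * DIM('a)) * q) (2 * q))"
proof (rule power_bound_from_root)
  show "0 \<le> energy (annulus a (c / (4 * DIM('a)) * q) (2 * q))" by (rule energy_nonneg)
  show "0 < scale_const DIM('a) c" using c by (intro scale_const_pos) auto
  show "0 < DIM('a)" by simp
  fix \<rho> :: real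
  assume \<rho>: "\<rho> > 0" and energy: "energy (annulus a (c / (4 * DIM('a)) * q) (2 * q)) \<le> \<rho> ^ DIM('a)"
  \<comment> \<open>both the inner radius of the annulus and the size of the cubes around \<open>x\<close> and \<open>y\<close>\<close>
  define e where "e = c / (4 * DIM('a)) * q"
  have DN: "real DIM('a) \<ge> 2" using N by simp
  have e0: "e > 0" using c q by (simp add: e_def)
  have e4: "e \<le> q / 4"
  proof -
    have "c / (4 * DIM('a)) \<le> 1 / 4" using c DN by (simp add: divide_le_eq)
    then show ?thesis using q mult_right_mono[of "c / (4 * DIM('a))" "1/4" q] by (simp add: e_def)
  qed
  obtain x where x: "x \<in> E" "c * q < dist x a" "dist x a < q"
    using E a q unfolding perfect_upto_def by blast
  obtain y where y: "y \<in> F" "c * q < dist y b" "dist y b < q"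
    using F b q unfolding perfect_upto_def by blast
  have cq: "c * q < q" "0 < c * q" using c q by auto
  have tri: "dist y b \<le> dist y a + dist a b" "dist y a \<le> dist y b + dist a b"
    by (metis dist_triangle dist_commute)+
  have far: "\<exists>j\<in>Basis. e + e \<le> \<bar>v \<bullet> j - a \<bullet> j\<bar>" if v: "c * q / 2 \<le> dist v a" for v
  proof -
    obtain j where j: "j \<in> Basis" "norm (v - a) \<le> DIM('a) * \<bar>(v - a) \<bullet> j\<bar>"
      using norm_le_DIM_max by blast
    have "c * q / 2 \<le> DIM('a) * \<bar>v \<bullet> j - a \<bullet> j\<bar>"
      using v j by (simp add: dist_norm inner_diff_left)
    then have "e + e \<le> \<bar>v \<bullet> j - a \<bullet> j\<bar>"
      using DN by (simp add: e_def field_simps)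
    then show ?thesis using j(1) by blast
  qed
  have near: "\<bar>v \<bullet> j - a \<bullet> j\<bar> \<le> 2 * q - e" if "dist v a \<le> 3 * q / 2" "j \<in> Basis" for v j
    using coord_le_dist[OF that(2), of v a] that(1) e4 q by linarith
  have small: "energy (cube v e) \<le> \<rho> ^ DIM('a)"
    if v: "\<exists>j\<in>Basis. e + e \<le> \<bar>v \<bullet> j - a \<bullet> j\<bar>" "\<And>j. j \<in> Basis \<Longrightarrow> \<bar>v \<bullet> j - a \<bullet> j\<bar> \<le> 2 * q - e" for v
  proof -
    obtain j where j: "j \<in> Basis" "e + e \<le> \<bar>v \<bullet> j - a \<bullet> j\<bar>" using v(1) by blast
    have "cube v e \<subseteq> annulus a e (2 * q)"
    proof
      fix z assume z: "z \<in> cube v e"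
      have "cube v e \<subseteq> cube a (2 * q)" using v(2) by (intro cube_subset_cube) force
      moreover have "e \<le> \<bar>z \<bullet> j - a \<bullet> j\<bar>"
      proof -
        have "\<bar>z \<bullet> j - v \<bullet> j\<bar> \<le> e" using z j(1) by (simp add: mem_cube)
        then show ?thesis using j(2) by linarith
      qed
      ultimately show "z \<in> annulus a e (2 * q)" using z j(1) by (auto simp: mem_annulus)
    qed
    then have "energy (cube v e) \<le> energy (annulus a e (2 * q))" by (intro energy_mono) auto
    then show ?thesis using energy by (simp add: e_def)
  qed
  have xa: "c * q / 2 \<le> dist x a" "dist x a \<le> 3 * q / 2" using x cq by auto
  have ya: "c * q / 2 \<le> dist y a" "dist y a \<le> 3 * q / 2" using y tri cq ab by linarith+
  have ratio: "e / (2 * q) = child_ratio DIM('a) c" using q by (simp add: e_def child_ratio_def)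
  have "\<bar>mean x e - mean y e\<bar> \<le> 6 * (osc_const DIM('a) (e / (2 * q)) * \<rho>)"
    using e4 q energy
    by (intro means_in_annulus[OF N e0 e0 _ \<rho> _ far[OF xa(1)] near[OF xa(2)] far[OF ya(1)] near[OF ya(2)]])
      (auto simp: e_def)
  then have close: "\<bar>mean x e - mean y e\<bar> \<le> 6 * (osc_const DIM('a) (child_ratio DIM('a) c) * \<rho>)"
    unfolding ratio .
  have "1 \<le> 2 * (density_const DIM('a) c * \<rho>) + 6 * (osc_const DIM('a) (child_ratio DIM('a) c) * \<rho>)"
    by (rule one_le_from_values[OF E F c uE uF x(1) small[OF far[OF xa(1)] near[OF xa(2)]]
      y(1) small[OF far[OF ya(1)] near[OF ya(2)]] e0 _ \<rho> close]) (use e4 q in auto)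
  then show "1 \<le> scale_const DIM('a) c * \<rho>" by (simp add: scale_const_def algebra_simps)
qed

lemma mean_doubling:
  assumes \<rho>: "\<rho> > 0" and E: "energy UNIV \<le> \<rho> ^ DIM('a)" and r: "r > 0"
  shows "\<bar>mean x (2 ^ k * r) - mean x r\<bar> \<le> k * (osc_const DIM('a) (1/2) * \<rho>)"
proof (induction k)
  case (Suc k)
  have "energy (cube x (2 ^ Suc k * r)) \<le> energy UNIV" by (intro energy_mono) auto
  then have "\<bar>mean x (2 ^ k * r) - mean x (2 ^ Suc k * r)\<bar> \<le> osc_const DIM('a) (1/2) * \<rho>"
    using r E by (intro mean_nested[OF _ _ \<rho>]) auto
  then show ?case using Suc.IH by (simp add: distrib_right)
qed simp

text \<open>
  Used when \<open>a\<close> and \<open>b\<close> are far apart compared with the scale \<open>r\<close>. After \<open>k\<close> doublings the cubes around \<open>a\<close> and \<open>b\<close>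
  lie in a common cube of twice their size. The loss is linear in the number of doublings, so it
  enters the bound for the energy with a power.
\<close>

lemma energy_far:
  assumes c: "0 < c" "c < 1"
    and E: "perfect_upto c R E" and F: "perfect_upto c R F"
    and uE: "\<And>x. x \<in> E \<Longrightarrow> u x \<ge> 1" and uF: "\<And>x. x \<in> F \<Longrightarrow> u x = 0"
    and a: "a \<in> E" and b: "b \<in> F" and r: "0 < r" "r \<le> R" and ab: "dist a b \<le> 2 ^ k * r"
  shows "(1 / ((2 * density_const DIM('a) c + 2 * osc_const DIM('a) (1/2)) * (k + 1))) ^ DIM('a) \<le> energy UNIV"
proof (rule power_bound_from_root)
  let ?K = "osc_const DIM('a) (1/2)" and ?A = "density_const DIM('a) c"
  have K: "?K > 0" by (intro osc_const_pos) auto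
  have A: "?A > 0" using c by (intro density_const_pos) auto
  show "0 \<le> energy UNIV" by (rule energy_nonneg)
  show "0 < (2 * ?A + 2 * ?K) * (k + 1)" using A K by simp
  show "0 < DIM('a)" by simp
  fix \<rho> :: real assume \<rho>: "\<rho> > 0" and en: "energy UNIV \<le> \<rho> ^ DIM('a)"
  have ec: "energy (cube x s) \<le> \<rho> ^ DIM('a)" for x s
    using energy_mono[of "cube x s" UNIV] en by auto
  let ?s = "2 ^ k * r"
  have top: "\<bar>mean a ?s - mean a (2 * ?s)\<bar> \<le> ?K * \<rho>" "\<bar>mean b ?s - mean a (2 * ?s)\<bar> \<le> ?K * \<rho>"
  proof -
    show "\<bar>mean a ?s - mean a (2 * ?s)\<bar> \<le> ?K * \<rho>"
      using r by (intro mean_nested[OF _ _ \<rho> _ _ _ ec]) auto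
    show "\<bar>mean b ?s - mean a (2 * ?s)\<bar> \<le> ?K * \<rho>"
    proof (intro mean_nested[OF _ _ \<rho> _ _ _ ec])
      fix j :: 'a assume "j \<in> Basis"
      then have "\<bar>b \<bullet> j - a \<bullet> j\<bar> \<le> ?s"
        using coord_le_dist[of j b a] ab dist_commute[of a b] by linarith
      then show "\<bar>b \<bullet> j - a \<bullet> j\<bar> + ?s \<le> 2 * ?s" by linarith
    qed (use r in auto)
  qed
  have close: "\<bar>mean a r - mean b r\<bar> \<le> 2 * k * (?K * \<rho>) + 2 * (?K * \<rho>)"
    using mean_doubling[OF \<rho> en r(1), of a k] mean_doubling[OF \<rho> en r(1), of b k] top by linarith
  have "1 \<le> 2 * (?A * \<rho>) + (2 * k * (?K * \<rho>) + 2 * (?K * \<rho>))"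
    by (rule one_le_from_values[OF E F c uE uF a ec b ec r \<rho> close])
  also have "\<dots> \<le> 2 * (?A * \<rho>) * (k + 1) + (2 * k * (?K * \<rho>) + 2 * (?K * \<rho>))"
    using A \<rho> by simp
  also have "\<dots> = (2 * ?A + 2 * ?K) * (k + 1) * \<rho>" by (simp add: algebra_simps)
  finally show "1 \<le> (2 * ?A + 2 * ?K) * (k + 1) * \<rho>" .
qed

lemma energy_disjoint_annuli:
  fixes A :: "nat \<Rightarrow> 'a set" and n :: nat and \<kappa> :: real
  assumes "\<And>k. A k \<in> sets lebesgue" "\<And>k l. k < l \<Longrightarrow> A k \<inter> A l = {}"
    and "\<And>k. k < n \<Longrightarrow> \<kappa> \<le> energy (A k)"
  shows "n * \<kappa> \<le> energy UNIV"
proof -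
  have "m \<le> n \<Longrightarrow> m * \<kappa> \<le> energy (\<Union>k<m. A k)" for m
  proof (induction m)
    case 0 then show ?case by (simp add: energy_def)
  next
    case (Suc m)
    have "(\<Union>k<Suc m. A k) = (\<Union>k<m. A k) \<union> A m" by (auto simp: lessThan_Suc)
    moreover have "energy ((\<Union>k<m. A k) \<union> A m) = energy (\<Union>k<m. A k) + energy (A m)"
      using assms(1,2) by (intro energy_disjoint_Un) auto
    moreover have "\<kappa> \<le> energy (A m)" using Suc.prems assms(3) by simp
    ultimately show ?case using Suc by (simp add: distrib_right)
  qed
  from this[of n] have "n * \<kappa> \<le> energy (\<Union>k<n. A k)" by simp
  also have "\<dots> \<le> energy UNIV" using assms(1) by (intro energy_mono) auto
  finally show ?thesis .
qed

text \<open>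
  The annuli at the scales \<open>2 * \<delta> / c * M ^ k\<close> are disjoint by the choice of \<open>M\<close>, and each
  scale below \<open>D / 2\<close> contributes a fixed amount. The condition on \<open>D / \<delta>\<close> makes
  \<open>1 + D / \<delta>\<close> at most the square of \<open>c * D / (4 * \<delta>)\<close>, so that the factor \<open>c / 4\<close> is absorbed.
\<close>

lemma energy_close:
  assumes N: "DIM('a) \<ge> 2" and c: "0 < c" "c < 1"
    and E: "perfect_upto c (D / 2) E" and F: "perfect_upto c (D / 2) F"
    and uE: "\<And>x. x \<in> E \<Longrightarrow> u x \<ge> 1" and uF: "\<And>x. x \<in> F \<Longrightarrow> u x = 0"
    and a: "a \<in> E" and b: "b \<in> F" and \<delta>: "dist a b = \<delta>" "\<delta> > 0" and D: "D / \<delta> \<ge> 32 / c\<^sup>2"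
  shows "(1 / scale_const DIM('a) c) ^ DIM('a) / (2 * ln (16 * DIM('a) / c)) * ln (1 + D / \<delta>) \<le> energy UNIV"
proof -
  \<comment> \<open>each annulus has outer radius \<open>2 * q k\<close>, half of the inner radius of the next one\<close>
  define M where "M = 16 * DIM('a) / c"
  define \<kappa> where "\<kappa> = (1 / scale_const DIM('a) c) ^ DIM('a)"
  define q where "q k = 2 * \<delta> / c * M ^ k" for k
  define A where "A k = annulus a (c / (4 * DIM('a)) * q k) (2 * q k)" for k
  have DN: "real DIM('a) \<ge> 2" using N by simp
  have M1: "M > 1" using DN c by (simp add: M_def less_divide_eq)
  have q0: "q k > 0" for k using \<delta> c M1 by (simp add: q_def)
  have \<kappa>0: "\<kappa> > 0" using scale_const_pos[of "DIM('a)" c] c by (simp add: \<kappa>_def)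
  have "\<exists>n. D / 2 \<le> q n"
  proof -
    obtain n where "D / 2 / (2 * \<delta> / c) < M ^ n" using real_arch_pow[OF M1] by blast
    then have "D / 2 < M ^ n * (2 * \<delta> / c)" using \<delta> c by (subst (asm) pos_divide_less_eq) auto
    then show ?thesis by (intro exI[of _ n]) (simp add: q_def mult.commute)
  qed
  then obtain n where n: "D / 2 \<le> q n" "\<And>k. k < n \<Longrightarrow> q k < D / 2"
    using exists_least_iff[of "\<lambda>n. D / 2 \<le> q n"] by (auto simp: not_le)
  have next_scale: "2 * q k < c / (4 * DIM('a)) * q l" if "k < l" for k l
  proof -
    have "M * M ^ k = M ^ Suc k" by simp
    also have "\<dots> \<le> M ^ l" using that M1 by (intro power_increasing) auto
    finally have "M * q k \<le> q l" using \<delta> c by (simp add: q_def field_simps)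
    then have "c / (4 * DIM('a)) * (M * q k) \<le> c / (4 * DIM('a)) * q l" using c by (intro mult_left_mono) auto
    moreover have "c / (4 * DIM('a)) * (M * q k) = 4 * q k" using c DN by (simp add: M_def)
    ultimately show ?thesis using q0[of k] by linarith
  qed
  have disj: "A k \<inter> A l = {}" if "k < l" for k l
  proof (rule ccontr)
    assume "A k \<inter> A l \<noteq> {}"
    then obtain z where z: "z \<in> A k" "z \<in> A l" by blast
    obtain j where j: "j \<in> Basis" "c / (4 * DIM('a)) * q l \<le> \<bar>z \<bullet> j - a \<bullet> j\<bar>"
      using z(2) by (auto simp: A_def mem_annulus)
    have "\<bar>z \<bullet> j - a \<bullet> j\<bar> \<le> 2 * q k" using z(1) j(1) by (auto simp: A_def mem_annulus mem_cube)
    then show False using j(2) next_scale[OF that] by linarith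
  qed
  have Am: "A k \<in> sets lebesgue" for k by (simp add: A_def)
  have scale: "\<kappa> \<le> energy (A k)" if "k < n" for k
    unfolding A_def \<kappa>_def
  proof (rule energy_at_scale[OF N c E F uE uF a b _ q0 n(2)[OF that]])
    have "1 \<le> M ^ k" using M1 by simp
    then have "2 * \<delta> * 1 \<le> 2 * \<delta> * M ^ k" using \<delta> by (intro mult_left_mono) auto
    then show "2 * dist a b \<le> c * q k" using \<delta> c by (simp add: q_def)
  qed
  have J: "n * \<kappa> \<le> energy UNIV"
    using energy_disjoint_annuli[of A n \<kappa>] Am disj scale by blast
  define X where "X = D / \<delta>"
  have X: "X \<ge> 32 / c\<^sup>2" using D by (simp add: X_def)
  have c2: "0 < c\<^sup>2" "c\<^sup>2 \<le> 1" using c by (auto simp: power_le_one)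
  have X32: "c\<^sup>2 * X \<ge> 32" using X c2 by (simp add: pos_divide_le_eq mult.commute)
  have X1: "X \<ge> 32"
  proof -
    have X0: "X \<ge> 0" using X c2 by (meson divide_nonneg_pos order_trans zero_le_numeral)
    have "c\<^sup>2 * X \<le> 1 * X" using c2 X0 by (intro mult_right_mono) auto
    then show ?thesis using X32 by simp
  qed
  have cX: "c * X / 4 \<le> M ^ n"
  proof -
    have "D = X * \<delta>" using \<delta> by (simp add: X_def)
    then have "X * \<delta> / 2 \<le> 2 * \<delta> / c * M ^ n" using n(1) by (simp add: q_def)
    then have "c * X * \<delta> \<le> 4 * M ^ n * \<delta>" using c by (simp add: field_simps)
    then show ?thesis using \<delta> by simp
  qed
  have "1 + X \<le> (c * X / 4)\<^sup>2"
  proof -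
    have "32 * X \<le> c\<^sup>2 * X * X" using X32 X1 by (intro mult_right_mono) auto
    moreover have "(c * X / 4)\<^sup>2 = c\<^sup>2 * X * X / 16" by (simp add: power2_eq_square)
    ultimately show ?thesis using X1 by linarith
  qed
  also have "\<dots> \<le> (M ^ n)\<^sup>2" using cX c X1 by (intro power_mono) auto
  finally have "ln (1 + X) \<le> ln ((M ^ n)\<^sup>2)" using X1 M1 by (subst ln_le_cancel_iff) auto
  also have "\<dots> = 2 * n * ln M" using M1 by (simp add: ln_realpow)
  finally have ln: "ln (1 + X) \<le> 2 * n * ln M" .
  have lnM: "ln M > 0" using M1 by simp
  have "\<kappa> / (2 * ln M) * ln (1 + X) \<le> \<kappa> / (2 * ln M) * (2 * n * ln M)"
    using ln \<kappa>0 lnM by (intro mult_left_mono) auto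
  also have "\<dots> = n * \<kappa>" using lnM by simp
  finally show ?thesis using J by (simp add: \<kappa>_def M_def X_def)
qed

text \<open>
  The least \<open>k\<close> with \<open>\<delta> \<le> 2 ^ k * (D / 2)\<close> satisfies \<open>D / \<delta> * 2 ^ k \<le> Y\<close> for a constant \<open>Y\<close>. The bound
  of \<open>energy_far\<close> decays like a power of \<open>k + 1\<close>, thus more slowly than \<open>1 / 2 ^ k\<close>, and
  \<open>ln (1 + D / \<delta>) \<le> D / \<delta>\<close>.
\<close>

lemma energy_lower_bound_far:
  assumes c: "0 < c" "c < 1"
    and E: "perfect_upto c (D / 2) E" and F: "perfect_upto c (D / 2) F"
    and uE: "\<And>x. x \<in> E \<Longrightarrow> u x \<ge> 1" and uF: "\<And>x. x \<in> F \<Longrightarrow> u x = 0"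
    and a: "a \<in> E" and b: "b \<in> F" and \<delta>: "dist a b = \<delta>" "\<delta> > 0" and D: "D > 0" "D / \<delta> < 32 / c\<^sup>2"
  shows "1 / ((2 * density_const DIM('a) c + 2 * osc_const DIM('a) (1/2)) ^ DIM('a) *
      (2 * (DIM('a) / ln 2) ^ DIM('a)) * (32 / c\<^sup>2 + 4)) * ln (1 + D / \<delta>) \<le> energy UNIV"
proof -
  define B where "B = 2 * density_const DIM('a) c + 2 * osc_const DIM('a) (1/2)"
  define P where "P = 2 * (DIM('a) / ln 2) ^ DIM('a)"
  define Y where "Y = 32 / c\<^sup>2 + 4"
  define X where "X = D / \<delta>"
  have B: "B > 0" using c density_const_pos[of "DIM('a)" c] osc_const_pos[of "DIM('a)" "1/2"]
    by (simp add: B_def)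
  have P: "P > 0" by (simp add: P_def)
  have c2: "0 < 32 / c\<^sup>2" using c by simp
  have Y: "Y > 0" using c2 unfolding Y_def by linarith
  have X: "X > 0" using D \<delta> by (simp add: X_def)
  have "\<exists>k. \<delta> \<le> 2 ^ k * (D / 2)"
  proof -
    obtain k where "\<delta> / (D / 2) < 2 ^ k" using real_arch_pow[of 2] by auto
    then have "\<delta> < 2 ^ k * (D / 2)" using D by (subst (asm) pos_divide_less_eq) auto
    then show ?thesis by (intro exI[of _ k]) simp
  qed
  then obtain k where k: "\<delta> \<le> 2 ^ k * (D / 2)" "\<And>l. l < k \<Longrightarrow> 2 ^ l * (D / 2) < \<delta>"
    using exists_least_iff[of "\<lambda>k. \<delta> \<le> 2 ^ k * (D / 2)"] by (auto simp: not_le)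
  have XY: "X * 2 ^ k \<le> Y"
  proof (cases k)
    case 0
    then show ?thesis using D by (simp add: X_def Y_def)
  next
    case (Suc l)
    then have "2 ^ l * (D / 2) < \<delta>" using k(2) by simp
    moreover have "2 ^ k * D = 4 * (2 ^ l * (D / 2))" using Suc by simp
    ultimately have "2 ^ k * D < 4 * \<delta>" by linarith
    then have "X * 2 ^ k < 4" using \<delta> by (simp add: X_def field_simps)
    then show ?thesis using c2 unfolding Y_def by linarith
  qed
  have "(1 / (B * (k + 1))) ^ DIM('a) \<le> energy UNIV"
    unfolding B_def by (rule energy_far[OF c E F uE uF a b, where r = "D / 2"]) (use D \<delta> k in auto)
  moreover have "1 / (B ^ DIM('a) * P * Y) * ln (1 + X) \<le> (1 / (B * (k + 1))) ^ DIM('a)"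
  proof -
    have "ln (1 + X) \<le> X" using X by (intro ln_add_one_self_le_self) auto
    also have "\<dots> \<le> Y / 2 ^ k" using XY by (simp add: pos_le_divide_eq)
    finally have "1 / (B ^ DIM('a) * P * Y) * ln (1 + X) \<le> 1 / (B ^ DIM('a) * P * Y) * (Y / 2 ^ k)"
      using B P Y by (intro mult_left_mono) auto
    also have "\<dots> = 1 / (B ^ DIM('a) * (P * 2 ^ k))" using Y by (simp add: mult_ac)
    also have "\<dots> \<le> 1 / (B ^ DIM('a) * real (k + 1) ^ DIM('a))"
      using B power_le_two_power[of "DIM('a)" k] unfolding P_def
      by (intro divide_left_mono mult_left_mono mult_pos_pos) auto
    also have "\<dots> = (1 / (B * (k + 1))) ^ DIM('a)" by (simp add: power_mult_distrib power_divide)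
    finally show ?thesis .
  qed
  ultimately show ?thesis unfolding B_def P_def Y_def X_def by linarith
qed

lemma energy_lower_bound:
  assumes N: "DIM('a) \<ge> 2" and c: "0 < c" "c < 1"
    and E: "perfect_upto c (D / 2) E" and F: "perfect_upto c (D / 2) F"
    and uE: "\<And>x. x \<in> E \<Longrightarrow> u x \<ge> 1" and uF: "\<And>x. x \<in> F \<Longrightarrow> u x = 0"
    and a: "a \<in> E" and b: "b \<in> F" and \<delta>: "dist a b = \<delta>" "\<delta> > 0" and D: "D > 0"
  shows "cap_const DIM('a) c * ln (1 + D / \<delta>) \<le> energy UNIV"
proof -
  have ln: "ln (1 + D / \<delta>) \<ge> 0" using D \<delta> by simp
  show ?thesis
  proof (cases "D / \<delta> \<ge> 32 / c\<^sup>2")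
    case True
    show ?thesis
      by (rule order_trans[OF mult_right_mono[OF _ ln] energy_close[OF N c E F uE uF a b \<delta> True]])
        (simp add: cap_const_def)
  next
    case False
    then have lt: "D / \<delta> < 32 / c\<^sup>2" by simp
    show ?thesis
      by (rule order_trans[OF mult_right_mono[OF _ ln] energy_lower_bound_far[OF c E F uE uF a b \<delta> D lt]])
        (simp add: cap_const_def)
  qed
qed

end

section \<open>The boundary in the one-point compactification\<close>

lemma Some_in_ext_boundary:
  fixes G :: "'a::euclidean_space set"
  assumes G: "open G"
  shows "Some x \<in> ext_boundary G \<longleftrightarrow> x \<in> frontier G"
proof -
  have op: "openin ext_space (Some ` U) \<longleftrightarrow> open U" for U :: "'a set"
    by (simp add: ext_space_def)
  have "ext_space interior_of (Some ` G) = Some ` G"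
    using G op by (simp add: interior_of_openin)
  moreover have "Some x \<in> ext_space closure_of (Some ` G) \<longleftrightarrow> x \<in> closure G"
  proof
    assume L: "Some x \<in> ext_space closure_of (Some ` G)"
    show "x \<in> closure G"
      unfolding closure_iff_nhds_not_empty
    proof (intro allI impI)
      fix A V assume V: "V \<subseteq> A" "open V" "x \<in> V"
      then have "Some x \<in> Some ` V" "openin ext_space (Some ` V)" using op by auto
      then obtain y where "y \<in> Some ` G" "y \<in> Some ` V" using L unfolding in_closure_of by blast
      then show "G \<inter> A \<noteq> {}" using V(1) by auto
    qed
  next
    assume R: "x \<in> closure G"
    show "Some x \<in> ext_space closure_of (Some ` G)"
      unfolding in_closure_of
    proof (intro conjI allI impI)
      show "Some x \<in> topspace ext_space" by (simp add: ext_space_def)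
      fix T :: "'a option set" assume T: "Some x \<in> T \<and> openin ext_space T"
      have "\<exists>V. open V \<and> x \<in> V \<and> Some ` V \<subseteq> T"
      proof -
        from T consider (base) U where "open U" "T = Some ` U"
          | (ext) C where "closed C" "T = insert None (Some ` (- C))"
          unfolding ext_space_def openin_Alexandroff_compactification
          by (auto simp: Compl_eq_Diff_UNIV)
        then show ?thesis
        proof cases
          case base
          then show ?thesis using T by (intro exI[of _ U]) auto
        next
          case ext
          then show ?thesis using T by (intro exI[of _ "- C"]) auto
        qed
      qed
      then obtain V where V: "open V" "x \<in> V" "Some ` V \<subseteq> T" by blast
      then have "G \<inter> V \<noteq> {}" using R closure_iff_nhds_not_empty by blast
      then show "\<exists>y. y \<in> Some ` G \<and> y \<in> T" using V(3) by blast
    qed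
  qed
  ultimately show ?thesis
    using G by (auto simp: ext_boundary_def frontier_of_def frontier_def interior_open)
qed

text \<open>
  A neighbourhood of infinity is the complement of a compact set; one that misses \<open>G\<close> bounds \<open>G\<close>.
\<close>

lemma bounded_if_None_notin_ext_boundary:
  fixes G :: "'a::euclidean_space set"
  assumes "None \<notin> ext_boundary G"
  shows "bounded G"
proof -
  have "None \<notin> ext_space interior_of (Some ` G)"
    using interior_of_subset[of ext_space "Some ` G"] by blast
  then have "None \<notin> ext_space closure_of (Some ` G)"
    using assms by (auto simp: ext_boundary_def frontier_of_def)
  then obtain T where T: "None \<in> T" "openin ext_space T" "T \<inter> Some ` G = {}"
    unfolding in_closure_of by (auto simp: ext_space_def)
  then obtain C where C: "compactin euclidean C" "T = insert None (Some ` (UNIV - C))"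
    unfolding ext_space_def openin_Alexandroff_compactification by auto
  then have "G \<subseteq> C" using T(3) by blast
  moreover have "compact C" using C(1) by simp
  ultimately show ?thesis using bounded_subset compact_imp_bounded by blast
qed

text \<open>
  The line through \<open>x\<close> and \<open>y\<close> leaves \<open>G\<close> on both sides, through boundary points that are at least as far
  apart. So for a bounded domain the scales at which the perfectness of the boundary is required include
  those that occur in \<open>E\<close>.
\<close>

lemma dist_le_diameter_frontier:
  fixes G :: "'a::euclidean_space set"
  assumes G: "open G" "bounded G" and xy: "x \<in> G" "y \<in> G"
  shows "dist x y \<le> diameter (frontier G)"
proof -
  have bd: "bounded (frontier G)"
    using bounded_closure[OF G(2)] by (rule bounded_subset) (auto simp: frontier_def)
  show ?thesis
  proof (cases "x = y")
    case True
    then show ?thesis using bd by (simp add: diameter_ge_0)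
  next
    case False
    obtain d where d: "d > 0" "y + d *\<^sub>R (y - x) \<in> frontier G"
      using ray_to_frontier[OF G(2), of y "y - x"] xy G False by (auto simp: interior_open)
    obtain d' where d': "d' > 0" "x + d' *\<^sub>R (x - y) \<in> frontier G"
      using ray_to_frontier[OF G(2), of x "x - y"] xy G False by (auto simp: interior_open)
    have "(x + d' *\<^sub>R (x - y)) - (y + d *\<^sub>R (y - x)) = (1 + d + d') *\<^sub>R (x - y)"
      by (simp add: algebra_simps)
    then have "dist (x + d' *\<^sub>R (x - y)) (y + d *\<^sub>R (y - x)) = (1 + d + d') * dist x y"
      using d d' by (simp add: dist_norm)
    also have "\<dots> \<ge> 1 * dist x y" using d d' by (intro mult_right_mono) auto
    finally have "dist x y \<le> dist (x + d' *\<^sub>R (x - y)) (y + d *\<^sub>R (y - x))" by simp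
    also have "\<dots> \<le> diameter (frontier G)"
      using d d' G by (intro diameter_bounded_bound bd)
    finally show ?thesis .
  qed
qed

section \<open>The capacity estimate\<close>

lemma UP_perfect_upto:
  assumes "F \<in> UP c" and R: "ereal R \<le> ext_diameter F / 2"
  shows "perfect_upto c R (finite_points F)"
  unfolding perfect_upto_def
proof (intro ballI allI impI)
  fix a r assume a: "a \<in> finite_points F" and r: "0 < r \<and> r < R"
  have "ereal r < ext_diameter F / 2" using r R by (meson ereal_less(2) less_le_trans less_ereal.simps(1))
  then have "{x \<in> finite_points F. c * r < dist x a \<and> dist x a < r} \<noteq> {}"
    using assms(1) a r unfolding UP_def by blast
  then show "\<exists>x\<in>finite_points F. c * r < dist x a \<and> dist x a < r" by blast
qed

text \<open>
  Passes from the extended nonnegative integral in the definition of the capacity to the real-valued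
  energy.
\<close>

lemma admissible_energy:
  fixes G E :: "'a::euclidean_space set"
  assumes u: "u \<in> admissible G E"
    and fin: "(\<integral>\<^sup>+x. ennreal (norm (grad u x) ^ DIM('a)) \<partial>lebesgue) \<noteq> \<infinity>"
  shows "finite_energy u"
    and "(\<integral>\<^sup>+x. ennreal (norm (grad u x) ^ DIM('a)) \<partial>lebesgue) = ennreal (finite_energy.energy u UNIV)"
proof -
  have acl: "ACLn u" using u by (simp add: admissible_def)
  have "grad u \<in> borel_measurable lebesgue"
    unfolding grad_def[abs_def] using acl
    by (intro borel_measurable_sum borel_measurable_scaleR) (auto simp: ACLn_def)
  then have meas: "(\<lambda>x. norm (grad u x) ^ DIM('a)) \<in> borel_measurable lebesgue" by measurable
  have int: "integrable lebesgue (\<lambda>x. norm (grad u x) ^ DIM('a))"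
    using meas fin by (intro integrableI_bounded) (auto simp: less_top norm_power)
  show fe: "finite_energy u" using acl int by unfold_locales
  show "(\<integral>\<^sup>+x. ennreal (norm (grad u x) ^ DIM('a)) \<partial>lebesgue) = ennreal (finite_energy.energy u UNIV)"
    unfolding finite_energy.energy_def[OF fe] using int by (simp add: nn_integral_eq_integral)
qed

text \<open>
  The perfectness condition gets weaker when the parameter decreases, so both sets can be treated with the
  smaller parameter. Up to the scale \<open>D / 2\<close> it holds for the finite boundary points too: either
  infinity is a boundary point, and then there is no restriction on the scale, or \<open>G\<close> is bounded.
\<close>

lemma capacity_lower_bound:
  fixes G E :: "'a::euclidean_space set"
  assumes N: "DIM('a) \<ge> 2" and c: "0 < c1" "c1 < 1" "0 < c2" "c2 < 1"
    and G: "open G" "G \<noteq> {}" "G \<noteq> UNIV" and E: "compact E" "E \<subseteq> G"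
    and UPE: "Some ` E \<in> UP c1" and UPG: "ext_boundary G \<in> UP c2"
  shows "ennreal (cap_const DIM('a) (min c1 c2) * ln (1 + diameter E / setdist E (finite_points (ext_boundary G)))) \<le> cap G E"
proof -
  define c where "c = min c1 c2"
  define D where "D = diameter E"
  have c01: "0 < c" "c < 1" using c by (auto simp: c_def)
  have fpE: "finite_points (Some ` E) = E" by (auto simp: finite_points_def)
  have fpG: "finite_points (ext_boundary G) = frontier G"
    using Some_in_ext_boundary[OF G(1)] by (auto simp: finite_points_def)
  obtain p q where pq: "p \<in> E" "q \<in> E" "p \<noteq> q" using UPE by (auto simp: UP_def)
  have "0 < dist p q" using pq by simp
  also have "\<dots> \<le> D" unfolding D_def using pq E by (intro diameter_bounded_bound compact_imp_bounded)
  finally have D0: "D > 0" .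
  have "perfect_upto c1 (D / 2) E"
    using UP_perfect_upto[OF UPE, of "D / 2"] unfolding fpE
    by (auto simp: ext_diameter_def fpE D_def)
  then have pE: "perfect_upto c (D / 2) E" by (rule perfect_upto_mono) (auto simp: c_def)
  have "ereal (D / 2) \<le> ext_diameter (ext_boundary G) / 2"
  proof (cases "None \<in> ext_boundary G")
    case True
    then show ?thesis by (simp add: ext_diameter_def)
  next
    case False
    then have bd: "bounded G" by (rule bounded_if_None_notin_ext_boundary)
    have "D \<le> diameter (frontier G)" unfolding D_def
    proof (rule diameter_le)
      show "E \<noteq> {} \<or> 0 \<le> diameter (frontier G)" using pq by auto
      fix x y assume "x \<in> E" "y \<in> E"
      then show "norm (x - y) \<le> diameter (frontier G)"
        using dist_le_diameter_frontier[OF G(1) bd, of x y] E(2) by (auto simp: dist_norm)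
    qed
    then show ?thesis using False by (simp add: ext_diameter_def fpG)
  qed
  then have "perfect_upto c2 (D / 2) (frontier G)"
    using UP_perfect_upto[OF UPG, of "D / 2"] unfolding fpG by blast
  then have pF: "perfect_upto c (D / 2) (frontier G)" by (rule perfect_upto_mono) (auto simp: c_def)
  have "frontier G \<noteq> {}" using G by (simp add: frontier_eq_empty)
  then obtain a b where ab: "a \<in> E" "b \<in> frontier G" "dist a b = setdist E (frontier G)"
    using setdist_compact_closed[of E "frontier G"] E pq by auto
  have disj: "G \<inter> frontier G = {}" using G(1) by (simp add: frontier_def interior_open)
  have "a \<noteq> b" using ab disj E(2) by blast
  then have \<delta>: "setdist E (frontier G) > 0" using ab(3) by (metis zero_less_dist_iff)
  have "ennreal (cap_const DIM('a) c * ln (1 + D / setdist E (frontier G))) \<le>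
      (\<integral>\<^sup>+ x. ennreal (norm (grad u x) ^ DIM('a)) \<partial>lebesgue)" if u: "u \<in> admissible G E" for u
  proof (cases "(\<integral>\<^sup>+ x. ennreal (norm (grad u x) ^ DIM('a)) \<partial>lebesgue) = \<infinity>")
    case False
    interpret finite_energy u by (rule admissible_energy(1)[OF u False])
    have "u x = 0" if "x \<in> frontier G" for x
    proof (rule ccontr)
      assume "u x \<noteq> 0"
      then have "x \<in> closure {x. u x \<noteq> 0}" by (intro subsetD[OF closure_subset]) simp
      then have "x \<in> G" using u by (auto simp: admissible_def)
      then show False using that disj by blast
    qed
    then have "cap_const DIM('a) c * ln (1 + D / setdist E (frontier G)) \<le> energy UNIV"
    proof (intro energy_lower_bound[OF N c01 pE pF _ _ ab(1,2,3) \<delta> D0])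
      show "u x \<ge> 1" if "x \<in> E" for x using u that by (simp add: admissible_def)
    qed
    then show ?thesis unfolding admissible_energy(2)[OF u False] by (rule ennreal_leI)
  qed simp
  then show ?thesis unfolding cap_def fpG c_def D_def by (intro INF_greatest) auto
qed

theorem theorem1p5:
  fixes c1 c2 :: real
  assumes "CARD('n::finite) \<ge> 2"
    and "0 < c1" "c1 < 1" "0 < c2" "c2 < 1"
  shows "\<exists>s>0. \<forall>G E :: (real ^ 'n) set.
           open G \<and> connected G \<and> G \<noteq> {} \<and> G \<noteq> UNIV \<and>
           compact E \<and> E \<subseteq> G \<and>
           Some ` E \<in> UP c1 \<and> ext_boundary G \<in> UP c2 \<longrightarrow>
           cap G E \<ge> ennreal (s * ln (1 + diameter E / setdist E (finite_points (ext_boundary G))))"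
proof -
  have N: "DIM(real ^ 'n) \<ge> 2" using assms(1) by simp
  show ?thesis
  proof (intro exI[of _ "cap_const DIM(real ^ 'n) (min c1 c2)"] conjI allI impI)
    show "cap_const DIM(real ^ 'n) (min c1 c2) > 0"
      using assms(2-5) by (intro cap_const_pos N) auto
  next
    fix G E :: "(real ^ 'n) set"
    assume "open G \<and> connected G \<and> G \<noteq> {} \<and> G \<noteq> UNIV \<and> compact E \<and> E \<subseteq> G \<and>
           Some ` E \<in> UP c1 \<and> ext_boundary G \<in> UP c2"
    then show "cap G E \<ge> ennreal (cap_const DIM(real ^ 'n) (min c1 c2) *
        ln (1 + diameter E / setdist E (finite_points (ext_boundary G))))"
      using assms(2-5) by (intro capacity_lower_bound N) auto
  qed
qed

end
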